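(* Let $G$ be a second countable LCA group, and let $L$ and $\mathcal B$ be uniform lattices in $G$ and $\widehat G$ respectively, with $\mathcal B\subset L^\perp$. Let $\Gamma = L\times\mathcal B$. For each set of functional data $\mathcal F=\{f_1,\dots,f_m\}\subset L^2(G)$ and each $n\in\mathbb N$ with $n<m$, there exists $\{\psi_1,\dots,\psi_n\}\subset L^2(G)$ such that $$\mathcal E(\mathcal F; S_\Gamma\{\psi_1,\dots,\psi_n\})\le \mathcal E(\mathcal F;V)$$ for all $\Gamma$-invariant subspaces $V$ of $L^2(G)$ with $\mathrm{length}(V)\le n$. (Some of the $\psi_i$ may be zero.)
   Context: An LCA group $G=(G,+)$ is a locally compact Hausdorff abelian topological group. $\widehat G$ is its dual group (continuous homomorphisms $G\to\mathbb T=\{z\in\mathbb C:|z|=1\}$), and $(x,\alpha)=\alpha(x)$ for $x\in G$, $\alpha\in\widehat G$. $L^2(G)$ is taken with respect to a Haar measure on $G$. A uniform lattice in an LCA group $G$ is a subgroup $L$ whose relative topology is discrete and such that $G/L$ is compact. The annihilator of $L$ is $L^\perp=\{\alpha\in\widehat G:(\ell,\alpha)=1\ \forall \ell\in L\}$. For $\ell\in L$, $\beta\in\mathcal B$ and $f\in L^2(G)$, put $T_\ell f(x)=f(x-\ell)$ and $M_\beta f(x)=(x,\beta)f(x)$. Since $\mathcal B\subset L^\perp$, these operators commute. A closed subspace $V$ of $L^2(G)$ is $\Gamma$-invariant, where $\Gamma=L\times\mathcal B$, if $T_\ell M_\beta f\in V$ for every $f\in V$ and $(\ell,\beta)\in\Gamma$.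 For a countable collection $\mathcal A\subset L^2(G)$, $$S_\Gamma(\mathcal A)=\overline{\mathrm{span}\{T_\ell M_\beta\varphi:\varphi\in\mathcal A,\ (\ell,\beta)\in\Gamma\}}^{L^2(G)}.$$ If $V=S_\Gamma(\mathcal A)$ with $\mathcal A$ finite, $V$ is said to have finite length and $\mathcal A$ is a set of generators of $V$; $\mathrm{length}(V)$ is the minimum positive integer $n$ such that $V$ has a set of generators with $n$ elements. For a closed subspace $V$ of $L^2(G)$, the approximation error is $$\mathcal E(\mathcal F;V)=\sum_{j=1}^m\|f_j-\mathbb P_Vf_j\|_{L^2(G)}^2,$$ where $\mathbb P_V$ is the orthogonal projection of $L^2(G)$ onto $V$. *)

theory Defs
  imports "HOL-Analysis.Analysis" "HOL-Algebra.Coset" "HOL-Library.Function_Algebras"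
begin

section \<open>Uniform lattices\<close>

definition quotient_topology :: "'a topology \<Rightarrow> ('a \<Rightarrow> 'b) \<Rightarrow> 'b topology" where
  "quotient_topology T q =
     topology (\<lambda>U. U \<subseteq> q ` topspace T \<and> openin T {x \<in> topspace T. q x \<in> U})"

lemma openin_quotient_topology:
  "openin (quotient_topology T q) U \<longleftrightarrow>
     U \<subseteq> q ` topspace T \<and> openin T {x \<in> topspace T. q x \<in> U}"
proof -
  have "istopology (\<lambda>U. U \<subseteq> q ` topspace T \<and> openin T {x \<in> topspace T. q x \<in> U})"
    unfolding istopology_def
  proof (intro conjI allI impI)
    fix S S' assume a: "S \<subseteq> q ` topspace T \<and> openin T {x \<in> topspace T. q x \<in> S}"
      "S' \<subseteq> q ` topspace T \<and> openin T {x \<in> topspace T. q x \<in> S'}"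
    have "{x \<in> topspace T. q x \<in> S \<inter> S'} =
        {x \<in> topspace T. q x \<in> S} \<inter> {x \<in> topspace T. q x \<in> S'}" by auto
    with a show "openin T {x \<in> topspace T. q x \<in> S \<inter> S'}" by auto
    from a show "S \<inter> S' \<subseteq> q ` topspace T" by auto
  next
    fix K assume a: "\<forall>S\<in>K. S \<subseteq> q ` topspace T \<and> openin T {x \<in> topspace T. q x \<in> S}"
    have "{x \<in> topspace T. q x \<in> \<Union>K} = (\<Union>S\<in>K. {x \<in> topspace T. q x \<in> S})" by auto
    with a show "openin T {x \<in> topspace T. q x \<in> \<Union>K}" by auto
    from a show "\<Union>K \<subseteq> q ` topspace T" by auto
  qed
  then show ?thesis
    by (simp add: quotient_topology_def topology_inverse')
qed

lemma topspace_quotient_topology: "topspace (quotient_topology T q) = q ` topspace T"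
proof
  show "topspace (quotient_topology T q) \<subseteq> q ` topspace T"
    using openin_quotient_topology[of T q "topspace (quotient_topology T q)"] by simp
  have "{x \<in> topspace T. q x \<in> q ` topspace T} = topspace T" by auto
  then have "openin (quotient_topology T q) (q ` topspace T)"
    by (simp add: openin_quotient_topology)
  then show "q ` topspace T \<subseteq> topspace (quotient_topology T q)"
    by (rule openin_subset)
qed

lemma quotient_map_quotient_topology: "quotient_map T (quotient_topology T q) q"
  by (auto simp: quotient_map_def topspace_quotient_topology openin_quotient_topology)

text \<open>The group \<open>A\<close> carries the topology \<open>T\<close>, with \<open>topspace T = carrier A\<close>.\<close>

definition uniform_lattice :: "('a, 'b) monoid_scheme \<Rightarrow> 'a topology \<Rightarrow> 'a set \<Rightarrow> bool" where
  "uniform_lattice A T H \<longleftrightarrow>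
     subgroup H A \<and>
     subtopology T H = discrete_topology H \<and>
     compact_space (quotient_topology T (\<lambda>x. H #>\<^bsub>A\<^esub> x))"

section \<open>The group and its dual\<close>

definition additive_group :: "'g::ab_group_add monoid" where
  "additive_group = \<lparr>carrier = UNIV, monoid.mult = (+), one = 0\<rparr>"

definition characters :: "('g::topological_ab_group_add \<Rightarrow> complex) set" where
  "characters = {\<alpha>. continuous_on UNIV \<alpha> \<and> (\<forall>x. norm (\<alpha> x) = 1) \<and>
                    (\<forall>x y. \<alpha> (x + y) = \<alpha> x * \<alpha> y)}"

definition dual_group :: "('g::topological_ab_group_add \<Rightarrow> complex) monoid" where
  "dual_group = \<lparr>carrier = characters, monoid.mult = (\<lambda>\<alpha> \<beta> x. \<alpha> x * \<beta> x), one = (\<lambda>x. 1)\<rparr>"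

text \<open>The compact-open topology.\<close>

definition dual_topology :: "('g::topological_ab_group_add \<Rightarrow> complex) topology" where
  "dual_topology = topology_generated_by
     {{\<alpha> \<in> characters. \<alpha> ` K \<subseteq> U} | K U. compact K \<and> open U}"

lemma topspace_dual_topology: "topspace dual_topology = characters"
proof -
  have "characters \<in> {{\<alpha> \<in> characters. \<alpha> ` K \<subseteq> U} | K U. compact (K::'a set) \<and> open (U :: complex set)}"
    by (rule CollectI, rule exI[of _ "{}"], rule exI[of _ UNIV]) auto
  then show ?thesis unfolding dual_topology_def topology_generated_by_topspace by blast
qed

definition annihilator :: "'g::topological_ab_group_add set \<Rightarrow> ('g \<Rightarrow> complex) set" where
  "annihilator L = {\<alpha> \<in> characters. \<forall>l\<in>L. \<alpha> l = 1}"

text \<open>A nonzero translation invariant Radon measure on the Borel sets.\<close>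

definition haar_measure :: "'g::topological_ab_group_add measure \<Rightarrow> bool" where
  "haar_measure \<mu> \<longleftrightarrow>
     sets \<mu> = sets borel \<and>
     emeasure \<mu> UNIV \<noteq> 0 \<and>
     (\<forall>a. \<forall>A\<in>sets borel. emeasure \<mu> ((+) a ` A) = emeasure \<mu> A) \<and>
     (\<forall>K\<in>sets borel. compact K \<longrightarrow> emeasure \<mu> K < \<infinity>) \<and>
     (\<forall>A\<in>sets borel. emeasure \<mu> A = (INF U\<in>{U. open U \<and> A \<subseteq> U}. emeasure \<mu> U)) \<and>
     (\<forall>U. open U \<longrightarrow>
        emeasure \<mu> U = (SUP K\<in>{K \<in> sets borel. compact K \<and> K \<subseteq> U}. emeasure \<mu> K))"

section \<open>The space of square integrable functions\<close>

text \<open>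
  Elements of $L^2$ are represented by functions rather than by classes modulo equality almost
  everywhere. The closure below is with respect to the seminorm, so closed sets are saturated
  under almost everywhere equality and correspond exactly to the closed subsets of $L^2$.
\<close>

definition L2 :: "'g measure \<Rightarrow> ('g \<Rightarrow> complex) set" where
  "L2 \<mu> = {f \<in> borel_measurable \<mu>. integrable \<mu> (\<lambda>x. (norm (f x))\<^sup>2)}"

definition inner_L2 :: "'g measure \<Rightarrow> ('g \<Rightarrow> complex) \<Rightarrow> ('g \<Rightarrow> complex) \<Rightarrow> complex" where
  "inner_L2 \<mu> f g = (\<integral>x. f x * cnj (g x) \<partial>\<mu>)"

definition norm_L2 :: "'g measure \<Rightarrow> ('g \<Rightarrow> complex) \<Rightarrow> real" where
  "norm_L2 \<mu> f = sqrt (\<integral>x. (norm (f x))\<^sup>2 \<partial>\<mu>)"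

definition closure_L2 :: "'g measure \<Rightarrow> ('g \<Rightarrow> complex) set \<Rightarrow> ('g \<Rightarrow> complex) set" where
  "closure_L2 \<mu> A = {f \<in> L2 \<mu>. \<forall>e>0. \<exists>g\<in>A. norm_L2 \<mu> (f - g) < e}"

global_interpretation cfun: vector_space "\<lambda>(c::complex) (f :: 'g \<Rightarrow> complex) x. c * f x"
  by unfold_locales (auto simp: algebra_simps fun_eq_iff)

definition closed_subspace_L2 :: "'g measure \<Rightarrow> ('g \<Rightarrow> complex) set \<Rightarrow> bool" where
  "closed_subspace_L2 \<mu> V \<longleftrightarrow> V \<subseteq> L2 \<mu> \<and> cfun.subspace V \<and> closure_L2 \<mu> V \<subseteq> V"

text \<open>For a closed subspace \<open>V\<close> the chosen function is unique up to equality almost everywhere.\<close>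

definition proj_L2 :: "'g measure \<Rightarrow> ('g \<Rightarrow> complex) set \<Rightarrow> ('g \<Rightarrow> complex) \<Rightarrow> ('g \<Rightarrow> complex)" where
  "proj_L2 \<mu> V f = (SOME p. p \<in> V \<and> (\<forall>v\<in>V. inner_L2 \<mu> (f - p) v = 0))"

definition approx_error ::
  "'g measure \<Rightarrow> nat \<Rightarrow> (nat \<Rightarrow> 'g \<Rightarrow> complex) \<Rightarrow> ('g \<Rightarrow> complex) set \<Rightarrow> real" where
  "approx_error \<mu> m f V = (\<Sum>j=1..m. (norm_L2 \<mu> (f j - proj_L2 \<mu> V (f j)))\<^sup>2)"

section \<open>Invariant subspaces\<close>

definition translation :: "'g::ab_group_add \<Rightarrow> ('g \<Rightarrow> complex) \<Rightarrow> ('g \<Rightarrow> complex)" where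
  "translation l f = (\<lambda>x. f (x - l))"

definition modulation :: "('g \<Rightarrow> complex) \<Rightarrow> ('g \<Rightarrow> complex) \<Rightarrow> ('g \<Rightarrow> complex)" where
  "modulation \<beta> f = (\<lambda>x. \<beta> x * f x)"

definition invariant_subspace ::
  "'g::ab_group_add measure \<Rightarrow> ('g \<times> ('g \<Rightarrow> complex)) set \<Rightarrow> ('g \<Rightarrow> complex) set \<Rightarrow> bool" where
  "invariant_subspace \<mu> \<Gamma> V \<longleftrightarrow>
     closed_subspace_L2 \<mu> V \<and>
     (\<forall>f\<in>V. \<forall>(l, \<beta>)\<in>\<Gamma>. translation l (modulation \<beta> f) \<in> V)"

definition generated_subspace ::
  "'g::ab_group_add measure \<Rightarrow> ('g \<times> ('g \<Rightarrow> complex)) set \<Rightarrow>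
     ('g \<Rightarrow> complex) set \<Rightarrow> ('g \<Rightarrow> complex) set" where
  "generated_subspace \<mu> \<Gamma> A =
     closure_L2 \<mu> (cfun.span {translation l (modulation \<beta> \<phi>) | \<phi> l \<beta>. \<phi> \<in> A \<and> (l, \<beta>) \<in> \<Gamma>})"

definition generators ::
  "'g::ab_group_add measure \<Rightarrow> ('g \<times> ('g \<Rightarrow> complex)) set \<Rightarrow>
     ('g \<Rightarrow> complex) set \<Rightarrow> ('g \<Rightarrow> complex) set \<Rightarrow> bool" where
  "generators \<mu> \<Gamma> V A \<longleftrightarrow> finite A \<and> A \<subseteq> L2 \<mu> \<and> V = generated_subspace \<mu> \<Gamma> A"

definition finite_length ::
  "'g::ab_group_add measure \<Rightarrow> ('g \<times> ('g \<Rightarrow> complex)) set \<Rightarrow> ('g \<Rightarrow> complex) set \<Rightarrow> bool" where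
  "finite_length \<mu> \<Gamma> V \<longleftrightarrow> (\<exists>A. generators \<mu> \<Gamma> V A)"

text \<open>
  Only meaningful if \<open>finite_length \<mu> \<Gamma> V\<close>. Counting functions instead of classes modulo almost
  everywhere equality does not change the minimum.
\<close>

definition invariant_length ::
  "'g::ab_group_add measure \<Rightarrow> ('g \<times> ('g \<Rightarrow> complex)) set \<Rightarrow> ('g \<Rightarrow> complex) set \<Rightarrow> nat" where
  "invariant_length \<mu> \<Gamma> V = (LEAST n. 0 < n \<and> (\<exists>A. generators \<mu> \<Gamma> V A \<and> card A = n))"

end

theory Submission
  imports Defs "HOL-Probability.Probability" "HOL-Algebra.Generated_Groups" "HOL-Library.Real_Mod"
begin

text \<open>
  The operators \<open>T\<^sub>l M\<^sub>\<beta>\<close> commute, so they can be diagonalised simultaneously, and the approximation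
  problem splits into a family of finite-dimensional ones: in each fibre one looks for the space of
  dimension at most \<open>n\<close> that is closest to \<open>m\<close> given vectors, and the answer is the span of the first
  \<open>n\<close> principal components, read off from the \<open>m \<times> m\<close> Gram matrix. The work lies in making the
  diagonalisation explicit and in choosing the principal components measurably.

  \<^emph>\<open>Diagonalisation.\<close> Let \<open>Q\<close> be a fundamental domain of \<open>L\<close>. Since \<open>L\<close> is a countable abelian group, it
  carries a random character \<open>\<xi>\<close>, defined on a probability space \<open>\<Omega>\<close>, whose values \<open>\<xi>\<^sub>l\<close> are
  orthonormal (\<open>ex_random_characters\<close>); it plays the role of a Haar distributed point of the dual
  of \<open>L\<close>. The Zak transform \<open>(x, \<omega>) \<mapsto> \<Sum>\<^sub>l f (x - l) \<xi>\<^sub>l(\<omega>)\<close> is then an isometry of \<open>L\<^sup>2(G)\<close> into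
  \<open>L\<^sup>2(Q \<times> \<Omega>)\<close> (\<open>zak_norm\<close>), and it turns \<open>T\<^sub>l M\<^sub>\<beta>\<close> into multiplication by the unimodular
  function \<open>\<beta>(x) \<xi>\<^sub>-\<^sub>l(\<omega>)\<close> (\<open>zak_intertwines\<close>), because \<open>\<beta>\<close> is constant on the cosets of \<open>L\<close>.

  \<^emph>\<open>The multiplication model.\<close> Let a group \<open>\<Gamma>\<close> of unimodular functions act by multiplication on
  the square integrable functions over a finite measure space, and let \<open>F\<close> be the \<open>\<sigma>\<close>-algebra generated by
  \<open>\<Gamma>\<close>. Closed \<open>\<Gamma>\<close>-invariant subspaces are closed under multiplication by all bounded \<open>F\<close>-measurable
  functions (\<open>bounded_F_mult_closed\<close>), so \<open>F\<close>-measurable functions are the scalars of the fibres, and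
  the conditional expectation of \<open>f\<^sub>i\<close> times the conjugate of \<open>f\<^sub>j\<close> given \<open>F\<close> is the fibrewise inner product.

  \<^emph>\<open>Optimality.\<close> No eigenvectors are computed. For a unitary matrix \<open>u\<close>, the \<^emph>\<open>tail energy\<close> is the sum over
  \<open>k > n\<close> of the squared fibre norms of the rotated data \<open>\<Sum>\<^sub>j u\<^sub>k\<^sub>j f\<^sub>j\<close>. It is continuous in \<open>u\<close>, and the
  unitary matrices are compact, so there is a measurable minimiser \<open>U\<close> (\<open>measurable_argmin\<close>). The first \<open>n\<close>
  rotated functions generate the optimal space: dropping the others costs at most the tail energy
  of \<open>U\<close>. On the other hand, if the data are approximated from a space with \<open>n\<close> generators, then at each point
  some unitary matrix \<open>V\<close> has \<open>m - n\<close> rows that annihilate the coefficients of the approximants; its tail energy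
  is at most the approximation error by Bessel's inequality, and at least that of \<open>U\<close>
  (\<open>ex_optimal_generators\<close>).
\<close>

section \<open>Square integrable functions\<close>

lemma L2_measurable: "f \<in> L2 M \<Longrightarrow> f \<in> borel_measurable M"
  by (simp add: L2_def)

lemma L2_integrable_sq: "f \<in> L2 M \<Longrightarrow> integrable M (\<lambda>x. (norm (f x))\<^sup>2)"
  by (simp add: L2_def)

lemma L2_I:
  assumes "f \<in> borel_measurable M" "integrable M h" "\<And>x. x \<in> space M \<Longrightarrow> (norm (f x))\<^sup>2 \<le> h x"
  shows "f \<in> L2 M"
  unfolding L2_def
proof (safe)
  show "integrable M (\<lambda>x. (norm (f x))\<^sup>2)"
    using assms by (intro Bochner_Integration.integrable_bound[OF assms(2)])
      (auto intro!: AE_I2 order_trans[OF assms(3)])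
qed fact

lemma norm_add_sq_le: "(norm (a + b))\<^sup>2 \<le> (1 + t) * (norm a)\<^sup>2 + (1 + 1/t) * (norm b)\<^sup>2"
  if "0 < t" for a b :: complex
proof -
  have "(norm (a + b))\<^sup>2 \<le> (norm a + norm b)\<^sup>2"
    by (intro power_mono norm_triangle_ineq) auto
  moreover have "0 \<le> (t * norm a - norm b)\<^sup>2 / t" using that by simp
  then have "0 \<le> t * (norm a)\<^sup>2 - 2 * norm a * norm b + (norm b)\<^sup>2 / t"
    using that by (simp add: field_simps power2_eq_square)
  ultimately show ?thesis by (simp add: field_simps power2_eq_square)
qed

lemma L2_add: "f + g \<in> L2 M" if "f \<in> L2 M" "g \<in> L2 M"
proof (rule L2_I)
  show "f + g \<in> borel_measurable M"
    using that[THEN L2_measurable] by (simp add: plus_fun_def)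
  show "integrable M (\<lambda>x. 2 * (norm (f x))\<^sup>2 + 2 * (norm (g x))\<^sup>2)"
    using that[THEN L2_integrable_sq] by auto
qed (use norm_add_sq_le[of 1] in auto)

lemma L2_bounded_mult:
  assumes "f \<in> L2 M" "b \<in> borel_measurable M" "\<And>x. x \<in> space M \<Longrightarrow> norm (b x) \<le> C"
  shows "(\<lambda>x. b x * f x) \<in> L2 M"
proof (rule L2_I)
  show "(\<lambda>x. b x * f x) \<in> borel_measurable M"
    using assms(2) L2_measurable[OF assms(1)] by (rule borel_measurable_times)
  show "integrable M (\<lambda>x. C\<^sup>2 * (norm (f x))\<^sup>2)"
    using assms L2_integrable_sq by auto
  show "(norm (b x * f x))\<^sup>2 \<le> C\<^sup>2 * (norm (f x))\<^sup>2" if "x \<in> space M" for x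
    using assms(3)[OF that] by (auto simp: norm_mult power_mult_distrib intro!: mult_right_mono power_mono)
qed

lemma L2_scale: "f \<in> L2 M \<Longrightarrow> (\<lambda>x. c * f x) \<in> L2 M"
  by (rule L2_bounded_mult[of f M "\<lambda>_. c" "norm c"]) auto

lemma L2_uminus: "f \<in> L2 M \<Longrightarrow> - f \<in> L2 M"
  using L2_scale[of f M "-1"] by (simp add: fun_Compl_def)

lemma L2_diff: "f \<in> L2 M \<Longrightarrow> g \<in> L2 M \<Longrightarrow> f - g \<in> L2 M"
  using L2_add[OF _ L2_uminus, of f M g] by (simp add: fun_eq_iff)

lemma L2_zero: "0 \<in> L2 M"
  by (simp add: L2_def zero_fun_def)

lemma L2_sum: "(\<And>i. i \<in> I \<Longrightarrow> f i \<in> L2 M) \<Longrightarrow> (\<lambda>x. \<Sum>i\<in>I. f i x) \<in> L2 M"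
proof (induction I rule: infinite_finite_induct)
  case (insert i I)
  then have "f i + (\<lambda>x. \<Sum>i\<in>I. f i x) \<in> L2 M" by (intro L2_add) auto
  with insert show ?case by (simp add: plus_fun_def)
qed (use L2_zero in \<open>auto simp: zero_fun_def\<close>)

lemma subspace_L2: "cfun.subspace (L2 M)"
  unfolding cfun.subspace_def using L2_zero L2_add L2_scale by auto

lemma L2_integrable_mult_cnj:
  assumes "f \<in> L2 M" "g \<in> L2 M"
  shows "integrable M (\<lambda>x. f x * cnj (g x))"
proof (rule Bochner_Integration.integrable_bound)
  show "integrable M (\<lambda>x. (norm (f x))\<^sup>2 + (norm (g x))\<^sup>2)"
    using assms[THEN L2_integrable_sq] by auto
  show "(\<lambda>x. f x * cnj (g x)) \<in> borel_measurable M"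
    using assms[THEN L2_measurable]
    by (intro borel_measurable_times measurable_compose[OF _ borel_measurable_continuous_onI[of cnj]])
      (auto intro: continuous_intros)
  have "a * b \<le> a\<^sup>2 + b\<^sup>2" for a b :: real
    using sum_squares_bound[of a b] zero_le_power2[of a] zero_le_power2[of b] by linarith
  then show "AE x in M. norm (f x * cnj (g x)) \<le> norm ((norm (f x))\<^sup>2 + (norm (g x))\<^sup>2)"
    by (auto simp: norm_mult)
qed

lemma norm_L2_nonneg [simp]: "0 \<le> norm_L2 M f"
  by (simp add: norm_L2_def)

lemma norm_L2_sq: "(norm_L2 M f)\<^sup>2 = (\<integral>x. (norm (f x))\<^sup>2 \<partial>M)"
  by (simp add: norm_L2_def)

lemma norm_L2_AE_cong:
  "AE x in M. norm (f x) = norm (g x) \<Longrightarrow> f \<in> L2 M \<Longrightarrow> g \<in> L2 M \<Longrightarrow> norm_L2 M f = norm_L2 M g"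
  unfolding norm_L2_def by (auto intro!: arg_cong[where f=sqrt] integral_cong_AE dest: L2_measurable)

lemma norm_L2_eq_0_AE: "norm_L2 M f = 0 \<Longrightarrow> f \<in> L2 M \<Longrightarrow> AE x in M. f x = 0"
  using integral_nonneg_eq_0_iff_AE[OF L2_integrable_sq, of f M] by (auto simp: norm_L2_def)

lemma norm_L2_scale: "norm_L2 M (\<lambda>x. c * f x) = norm c * norm_L2 M f"
  by (simp add: norm_L2_def norm_mult power_mult_distrib real_sqrt_mult)

lemma norm_L2_minus_commute: "norm_L2 M (f - g) = norm_L2 M (g - f)"
  by (simp add: norm_L2_def norm_minus_commute)

lemma norm_L2_bounded_mult:
  assumes "f \<in> L2 M" "b \<in> borel_measurable M" "\<And>x. x \<in> space M \<Longrightarrow> norm (b x) \<le> C" "0 \<le> C"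
  shows "norm_L2 M (\<lambda>x. b x * f x) \<le> C * norm_L2 M f"
proof -
  have "(norm_L2 M (\<lambda>x. b x * f x))\<^sup>2 \<le> (\<integral>x. C\<^sup>2 * (norm (f x))\<^sup>2 \<partial>M)"
    unfolding norm_L2_sq
    using L2_integrable_sq[OF L2_bounded_mult[OF assms(1-3)]] L2_integrable_sq[OF assms(1)]
    by (intro integral_mono)
      (auto simp: norm_mult power_mult_distrib intro!: mult_right_mono power_mono assms(3))
  also have "\<dots> = (C * norm_L2 M f)\<^sup>2" by (simp add: norm_L2_sq power_mult_distrib)
  finally show ?thesis using assms(4) by (auto intro: power2_le_imp_le)
qed

text \<open>
  Integrating the pointwise bound of \<open>norm_add_sq_le\<close> and choosing \<open>t\<close> as the quotient of the two norms gives
  the square of the right-hand side; the norms are first enlarged by \<open>e\<close> so that the quotient makes sense.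
\<close>

lemma norm_L2_triangle:
  assumes "f \<in> L2 M" "g \<in> L2 M"
  shows "norm_L2 M (f + g) \<le> norm_L2 M f + norm_L2 M g"
proof -
  define A B where "A = norm_L2 M f" and "B = norm_L2 M g"
  have AB: "0 \<le> A" "0 \<le> B" by (auto simp: A_def B_def)
  have main: "(norm_L2 M (f + g))\<^sup>2 \<le> (1 + t) * A\<^sup>2 + (1 + 1/t) * B\<^sup>2" if "0 < t" for t
  proof -
    have "(norm_L2 M (f + g))\<^sup>2 \<le> (\<integral>x. (1 + t) * (norm (f x))\<^sup>2 + (1 + 1/t) * (norm (g x))\<^sup>2 \<partial>M)"
      unfolding norm_L2_sq
      using L2_integrable_sq[OF L2_add[OF assms]] assms[THEN L2_integrable_sq] norm_add_sq_le[OF that]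
      by (intro integral_mono) auto
    also have "\<dots> = (1 + t) * A\<^sup>2 + (1 + 1/t) * B\<^sup>2"
      unfolding A_def B_def norm_L2_sq using assms[THEN L2_integrable_sq] by simp
    finally show ?thesis .
  qed
  have "norm_L2 M (f + g) \<le> (A + e) + (B + e)" if "0 < e" for e
  proof -
    have p: "0 < A + e" "0 < B + e" using AB that by auto
    have "(norm_L2 M (f + g))\<^sup>2 \<le> (1 + (B+e)/(A+e)) * A\<^sup>2 + (1 + 1/((B+e)/(A+e))) * B\<^sup>2"
      using p by (intro main) auto
    also have "\<dots> \<le> (1 + (B+e)/(A+e)) * (A+e)\<^sup>2 + (1 + 1/((B+e)/(A+e))) * (B+e)\<^sup>2"
      using p AB that by (intro add_mono mult_left_mono power_mono) auto
    also have "\<dots> = ((A + e) + (B + e))\<^sup>2"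
      using p by (simp add: divide_simps power2_eq_square) (simp add: algebra_simps)
    finally show ?thesis using p by (auto intro: power2_le_imp_le)
  qed
  from this[of "e/2" for e] have "norm_L2 M (f + g) \<le> A + B + e" if "0 < e" for e
    using that by (metis (no_types, opaque_lifting) add.assoc add.commute field_sum_of_halves half_gt_zero)
  then have "norm_L2 M (f + g) \<le> A + B" by (rule field_le_epsilon)
  then show ?thesis by (simp add: A_def B_def)
qed

lemma norm_L2_triangle_diff:
  assumes "f \<in> L2 M" "g \<in> L2 M" "h \<in> L2 M"
  shows "norm_L2 M (f - h) \<le> norm_L2 M (f - g) + norm_L2 M (g - h)"
  using norm_L2_triangle[OF L2_diff[OF assms(1,2)] L2_diff[OF assms(2,3)]] by simp

lemma norm_L2_abs_diff:
  assumes "f \<in> L2 M" "g \<in> L2 M"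
  shows "\<bar>norm_L2 M f - norm_L2 M g\<bar> \<le> norm_L2 M (f - g)"
  using norm_L2_triangle_diff[OF assms(1,2) L2_zero] norm_L2_triangle_diff[OF assms(2,1) L2_zero]
  by (simp add: norm_L2_minus_commute[of M g f])

lemma norm_L2_diff_scaled:
  assumes "f \<in> L2 M" "v \<in> L2 M"
  shows "(norm_L2 M (\<lambda>x. f x - c * v x))\<^sup>2 =
    (norm_L2 M f)\<^sup>2 - 2 * Re (cnj c * inner_L2 M f v) + (norm c)\<^sup>2 * (norm_L2 M v)\<^sup>2"
proof -
  have pt: "(norm (f x - c * v x))\<^sup>2 =
     ((norm (f x))\<^sup>2 - 2 * Re (cnj c * (f x * cnj (v x)))) + (norm c)\<^sup>2 * (norm (v x))\<^sup>2" for x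
    unfolding cmod_power2 by (simp add: power2_eq_square algebra_simps)
  have i1: "integrable M (\<lambda>x. cnj c * (f x * cnj (v x)))"
    using L2_integrable_mult_cnj[OF assms] by simp
  have "Re (cnj c * inner_L2 M f v) = Re (\<integral>x. cnj c * (f x * cnj (v x)) \<partial>M)"
    using L2_integrable_mult_cnj[OF assms] by (simp only: inner_L2_def Bochner_Integration.integral_mult_right)
  also have "\<dots> = (\<integral>x. Re (cnj c * (f x * cnj (v x))) \<partial>M)"
    by (rule integral_Re[OF i1, symmetric])
  finally have r: "Re (cnj c * inner_L2 M f v) = (\<integral>x. Re (cnj c * (f x * cnj (v x))) \<partial>M)" .
  have i2: "integrable M (\<lambda>x. Re (cnj c * (f x * cnj (v x))))"
    using i1 by (rule integrable_Re)
  show ?thesis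
    unfolding norm_L2_sq pt r
    using i2 assms[THEN L2_integrable_sq]
    by (simp only: Bochner_Integration.integral_add Bochner_Integration.integral_diff
       integrable_mult_right Bochner_Integration.integral_mult_right Bochner_Integration.integrable_diff)
qed

text \<open>
  A subsequence with \<open>\<parallel>f\<^sub>k - f\<^sub>k\<^sub>+\<^sub>1\<parallel> < 2\<^sup>-\<^sup>k\<close> converges almost everywhere, since the sum of the
  absolute increments is square integrable; Fatou's lemma turns this into convergence in norm.
\<close>

lemma L2_complete:
  assumes f: "\<And>k. f k \<in> L2 M"
    and Cauchy: "\<And>e. 0 < e \<Longrightarrow> \<exists>N. \<forall>i\<ge>N. \<forall>j\<ge>N. norm_L2 M (f i - f j) < e"
  obtains g where "g \<in> L2 M" "(\<lambda>k. norm_L2 M (f k - g)) \<longlonglongrightarrow> 0"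
proof -
  have "\<exists>N. \<forall>k. (\<forall>i\<ge>N k. \<forall>j\<ge>N k. norm_L2 M (f i - f j) < (1/2)^k) \<and> N k < N (Suc k)"
  proof (rule dependent_nat_choice)
    show "\<exists>N. \<forall>i\<ge>N. \<forall>j\<ge>N. norm_L2 M (f i - f j) < (1/2)^0" using Cauchy[of 1] by simp
    fix N k
    obtain N' where "\<forall>i\<ge>N'. \<forall>j\<ge>N'. norm_L2 M (f i - f j) < (1/2)^Suc k"
      using Cauchy[of "(1/2)^Suc k"] by auto
    then show "\<exists>y. (\<forall>i\<ge>y. \<forall>j\<ge>y. norm_L2 M (f i - f j) < (1/2)^Suc k) \<and> N < y"
      by (intro exI[of _ "max N' (Suc N)"]) auto
  qed
  then obtain N where N: "\<And>k i j. i \<ge> N k \<Longrightarrow> j \<ge> N k \<Longrightarrow> norm_L2 M (f i - f j) < (1/2)^k"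
    and "\<And>k. N k < N (Suc k)" by blast
  then have sm: "strict_mono N" by (simp add: strict_mono_Suc_iff)
  define h where "h k = f (N k)" for k
  have h: "h k \<in> L2 M" for k using f by (simp add: h_def)
  have [measurable]: "h k \<in> borel_measurable M" for k using h L2_measurable by blast
  define d where "d k x = norm (h (Suc k) x - h k x)" for k x
  have d_meas[measurable]: "d k \<in> borel_measurable M" for k unfolding d_def by measurable
  define S where "S k = (\<lambda>x. \<Sum>i<k. complex_of_real (d i x))" for k
  have dL2: "(\<lambda>x. complex_of_real (d k x)) \<in> L2 M" for k
    by (rule L2_I[OF _ L2_integrable_sq[OF L2_diff[OF h h, of "Suc k" k]]]) (auto simp: d_def)
  have dn: "norm_L2 M (\<lambda>x. complex_of_real (d k x)) \<le> (1/2)^k" for k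
  proof -
    have "norm_L2 M (\<lambda>x. complex_of_real (d k x)) = norm_L2 M (h (Suc k) - h k)"
      by (simp add: norm_L2_def d_def)
    also have "\<dots> \<le> (1/2)^k"
      unfolding h_def using N[of k "N (Suc k)" "N k"] sm by (simp add: strict_mono_less_eq less_imp_le)
    finally show ?thesis .
  qed
  have SL2: "S k \<in> L2 M" for k unfolding S_def by (rule L2_sum) (rule dL2)
  have Sn: "norm_L2 M (S k) \<le> (\<Sum>i<k. (1/2)^i)" for k
  proof (induction k)
    case 0 show ?case by (simp add: S_def norm_L2_def)
  next
    case (Suc k)
    have "S (Suc k) = S k + (\<lambda>x. complex_of_real (d k x))" by (simp add: S_def fun_eq_iff)
    then have "norm_L2 M (S (Suc k)) \<le> norm_L2 M (S k) + norm_L2 M (\<lambda>x. complex_of_real (d k x))"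
      using norm_L2_triangle[OF SL2[of k] dL2[of k]] by metis
    then show ?case using Suc dn[of k] by simp
  qed
  have Sn2: "norm_L2 M (S k) \<le> 2" for k
  proof -
    have "(\<Sum>i<k. (1/2::real)^i) \<le> 2" by (simp add: sum_gp_strict)
    then show ?thesis using Sn[of k] by simp
  qed
  define T where "T k x = (\<Sum>i<k. d i x)" for k x
  have T_meas[measurable]: "T k \<in> borel_measurable M" for k unfolding T_def by measurable
  have T0: "0 \<le> T k x" for k x by (auto simp: T_def d_def intro: sum_nonneg)
  have Tinc: "T k x \<le> T (Suc k) x" for k x by (simp add: T_def d_def)
  have nT: "(\<integral>\<^sup>+x. ennreal ((T k x)\<^sup>2) \<partial>M) \<le> 4" for k
  proof -
    have eq: "(norm (S k x))\<^sup>2 = (T k x)\<^sup>2" for x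
      unfolding S_def T_def of_real_sum[symmetric] norm_of_real by simp
    have "(\<integral>\<^sup>+x. ennreal ((T k x)\<^sup>2) \<partial>M) = ennreal ((norm_L2 M (S k))\<^sup>2)"
      unfolding norm_L2_sq using L2_integrable_sq[OF SL2[of k]]
      by (subst nn_integral_eq_integral) (auto simp: eq)
    also have "\<dots> \<le> ennreal (2\<^sup>2)"
      using Sn2[of k] by (intro ennreal_leI power_mono) auto
    finally show ?thesis by simp
  qed
  have "(\<integral>\<^sup>+x. (SUP k. ennreal ((T k x)\<^sup>2)) \<partial>M) = (SUP k. \<integral>\<^sup>+x. ennreal ((T k x)\<^sup>2) \<partial>M)"
    by (rule nn_integral_monotone_convergence_SUP)
       (auto intro!: incseq_SucI le_funI ennreal_leI power_mono Tinc T0)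
  also have "\<dots> \<le> 4" using nT by (simp add: SUP_le_iff)
  finally have "(\<integral>\<^sup>+x. (SUP k. ennreal ((T k x)\<^sup>2)) \<partial>M) < \<infinity>"
    by (rule order_le_less_trans) simp
  then have "AE x in M. (SUP k. ennreal ((T k x)\<^sup>2)) \<noteq> \<infinity>"
    by (intro nn_integral_noteq_infinite) auto
  then have "AE x in M. summable (\<lambda>i. d i x)"
  proof eventually_elim
    case (elim x)
    then obtain c where c: "0 \<le> c" "(SUP k. ennreal ((T k x)\<^sup>2)) = ennreal c"
      by (cases "SUP k. ennreal ((T k x)\<^sup>2)") auto
    have "(T k x)\<^sup>2 \<le> c" for k
      using SUP_upper[of k UNIV "\<lambda>k. ennreal ((T k x)\<^sup>2)"] c by (simp add: ennreal_le_iff)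
    then have "T k x \<le> sqrt c" for k using T0[of k x] by (simp add: real_le_rsqrt)
    then show ?case unfolding T_def
      by (intro bounded_imp_summable[of _ "sqrt c"])
         (auto simp: d_def lessThan_Suc_atMost[symmetric] simp del: sum.lessThan_Suc)
  qed
  then have conv: "AE x in M. convergent (\<lambda>k. h k x)"
  proof eventually_elim
    case (elim x)
    then have "summable (\<lambda>i. h (Suc i) x - h i x)"
      unfolding d_def by (rule summable_norm_cancel)
    then have "convergent (\<lambda>k. \<Sum>i<k. h (Suc i) x - h i x)" by (simp add: summable_iff_convergent)
    moreover have "(\<Sum>i<k. h (Suc i) x - h i x) = h k x - h 0 x" for k by (induction k) auto
    ultimately have "convergent (\<lambda>k. h k x - h 0 x)" by simp
    then show ?case using convergent_add[OF _ convergent_const[of "h 0 x"], of "\<lambda>k. h k x - h 0 x"] by simp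
  qed
  define g where "g x = lim (\<lambda>k. h k x)" for x
  have g_meas[measurable]: "g \<in> borel_measurable M" unfolding g_def by measurable
  have lim: "AE x in M. (\<lambda>k. h k x) \<longlonglongrightarrow> g x"
    using conv by eventually_elim (simp add: g_def convergent_LIMSEQ_iff)
  have fatou: "(\<integral>\<^sup>+x. ennreal ((norm (f i x - g x))\<^sup>2) \<partial>M) \<le> ennreal (((1/2)^k)\<^sup>2)" if "i \<ge> N k" for i k
  proof -
    have [measurable]: "f i \<in> borel_measurable M" using f L2_measurable by blast
    have "(\<integral>\<^sup>+x. ennreal ((norm (f i x - g x))\<^sup>2) \<partial>M)
        = (\<integral>\<^sup>+x. liminf (\<lambda>j. ennreal ((norm (f i x - h j x))\<^sup>2)) \<partial>M)"
    proof (rule nn_integral_cong_AE)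
      show "AE x in M. ennreal ((norm (f i x - g x))\<^sup>2) = liminf (\<lambda>j. ennreal ((norm (f i x - h j x))\<^sup>2))"
        using lim
      proof eventually_elim
        case (elim x)
        have "(\<lambda>j. ennreal ((norm (f i x - h j x))\<^sup>2)) \<longlonglongrightarrow> ennreal ((norm (f i x - g x))\<^sup>2)"
          by (intro tendsto_ennrealI tendsto_intros elim)
        from lim_imp_Liminf[OF _ this] show ?case by simp
      qed
    qed
    also have "\<dots> \<le> liminf (\<lambda>j. \<integral>\<^sup>+x. ennreal ((norm (f i x - h j x))\<^sup>2) \<partial>M)"
      by (rule nn_integral_liminf) measurable
    also have "\<dots> \<le> ennreal (((1/2)^k)\<^sup>2)"
    proof (rule Liminf_le)
      show "\<forall>\<^sub>F j in sequentially. (\<integral>\<^sup>+x. ennreal ((norm (f i x - h j x))\<^sup>2) \<partial>M) \<le> ennreal (((1/2)^k)\<^sup>2)"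
        using eventually_ge_at_top[of k]
      proof eventually_elim
        case (elim j)
        have "N j \<ge> N k" using sm elim by (simp add: strict_mono_less_eq)
        have "(\<integral>\<^sup>+x. ennreal ((norm (f i x - h j x))\<^sup>2) \<partial>M) = ennreal ((norm_L2 M (f i - h j))\<^sup>2)"
          unfolding norm_L2_sq using L2_integrable_sq[OF L2_diff[OF f h, of i j]]
          by (subst nn_integral_eq_integral) auto
        also have "\<dots> \<le> ennreal (((1/2)^k)\<^sup>2)"
          using N[OF that \<open>N j \<ge> N k\<close>] by (intro ennreal_leI power_mono) (auto simp: h_def)
        finally show ?case .
      qed
    qed simp
    finally show ?thesis .
  qed
  have diffL2: "f i - g \<in> L2 M" if "i \<ge> N k" for i k
  proof -
    have [measurable]: "f i \<in> borel_measurable M" using f L2_measurable by blast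
    show ?thesis unfolding L2_def
    proof safe
      show "f i - g \<in> borel_measurable M" unfolding fun_diff_def by measurable
      show "integrable M (\<lambda>x. (norm ((f i - g) x))\<^sup>2)"
        using fatou[OF that] by (intro integrableI_bounded) (auto intro: order_le_less_trans)
    qed
  qed
  have "f (N 0) - (f (N 0) - g) \<in> L2 M" by (intro L2_diff f diffL2[of 0]) simp
  then have gL2: "g \<in> L2 M" by simp
  have bd: "norm_L2 M (f i - g) \<le> (1/2)^k" if "i \<ge> N k" for i k
  proof -
    have "ennreal ((norm_L2 M (f i - g))\<^sup>2) = (\<integral>\<^sup>+x. ennreal ((norm (f i x - g x))\<^sup>2) \<partial>M)"
      unfolding norm_L2_sq using L2_integrable_sq[OF diffL2[OF that]]
      by (subst nn_integral_eq_integral) auto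
    also note fatou[OF that]
    finally show ?thesis by (auto simp: ennreal_le_iff intro: power2_le_imp_le)
  qed
  have "(\<lambda>k. norm_L2 M (f k - g)) \<longlonglongrightarrow> 0"
  proof (rule LIMSEQ_I)
    fix e :: real assume "0 < e"
    then obtain k where "(1/2::real)^k < e" using real_arch_pow_inv[of e "1/2"] by auto
    then show "\<exists>no. \<forall>n\<ge>no. norm (norm_L2 M (f n - g) - 0) < e"
      using bd by (intro exI[of _ "N k"]) (auto intro: order_le_less_trans)
  qed
  with gL2 show ?thesis by (rule that)
qed

lemma closure_L2_approx:
  "f \<in> closure_L2 M S \<Longrightarrow> 0 < e \<Longrightarrow> \<exists>g\<in>S. norm_L2 M (f - g) < e"
  by (simp add: closure_L2_def)

lemma closure_L2_superset: "S \<subseteq> L2 M \<Longrightarrow> S \<subseteq> closure_L2 M S"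
  by (auto simp: closure_L2_def norm_L2_def intro!: bexI)

lemma closure_L2_closed:
  assumes "S \<subseteq> L2 M" shows "closure_L2 M (closure_L2 M S) \<subseteq> closure_L2 M S"
proof
  fix f assume f: "f \<in> closure_L2 M (closure_L2 M S)"
  then have fL: "f \<in> L2 M" by (simp add: closure_L2_def)
  have "\<exists>g\<in>S. norm_L2 M (f - g) < e" if e: "0 < e" for e
  proof -
    obtain h where h: "h \<in> closure_L2 M S" "norm_L2 M (f - h) < e/2"
      using closure_L2_approx[OF f half_gt_zero[OF e]] by blast
    then obtain g where g: "g \<in> S" "norm_L2 M (h - g) < e/2"
      using closure_L2_approx[OF h(1) half_gt_zero[OF e]] by blast
    have "h \<in> L2 M" "g \<in> L2 M" using h g assms by (auto simp: closure_L2_def)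
    then have "norm_L2 M (f - g) < e" using norm_L2_triangle_diff[OF fL] h g by fastforce
    with g show ?thesis by blast
  qed
  with fL show "f \<in> closure_L2 M S" by (simp add: closure_L2_def)
qed

lemma closed_subspace_closure_L2:
  assumes S: "S \<subseteq> L2 M" "cfun.subspace S"
  shows "closed_subspace_L2 M (closure_L2 M S)"
  unfolding closed_subspace_L2_def
proof (intro conjI closure_L2_closed S(1))
  show "closure_L2 M S \<subseteq> L2 M" by (auto simp: closure_L2_def)
  show "cfun.subspace (closure_L2 M S)"
  proof (rule cfun.subspaceI)
    show "0 \<in> closure_L2 M S"
      by (rule subsetD[OF closure_L2_superset[OF S(1)] cfun.subspace_0[OF S(2)]])
  next
    fix f g assume f: "f \<in> closure_L2 M S" and g: "g \<in> closure_L2 M S"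
    then have L: "f \<in> L2 M" "g \<in> L2 M" by (auto simp: closure_L2_def)
    have "\<exists>h\<in>S. norm_L2 M (f + g - h) < e" if e: "0 < e" for e
    proof -
      obtain f' where f': "f' \<in> S" "norm_L2 M (f - f') < e/2"
        using closure_L2_approx[OF f half_gt_zero[OF e]] by blast
      obtain g' where g': "g' \<in> S" "norm_L2 M (g - g') < e/2"
        using closure_L2_approx[OF g half_gt_zero[OF e]] by blast
      have "norm_L2 M ((f - f') + (g - g')) < e"
        using norm_L2_triangle[of "f - f'" M "g - g'"] f' g' L S(1) by (fastforce intro: L2_diff)
      moreover have "(f - f') + (g - g') = f + g - (f' + g')" by simp
      ultimately show ?thesis using cfun.subspace_add[OF S(2) f'(1) g'(1)] by (intro bexI) simp_all
    qed
    then show "f + g \<in> closure_L2 M S" using L2_add[OF L] by (simp add: closure_L2_def)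
  next
    fix c f assume f: "f \<in> closure_L2 M S"
    then have L: "f \<in> L2 M" by (auto simp: closure_L2_def)
    have "\<exists>h\<in>S. norm_L2 M ((\<lambda>x. c * f x) - h) < e" if e: "0 < e" for e
    proof -
      have "0 < e / (norm c + 1)" using e by (intro divide_pos_pos) (auto intro: add_nonneg_pos)
      then obtain f' where f': "f' \<in> S" "norm_L2 M (f - f') < e / (norm c + 1)"
        using f unfolding closure_L2_def by blast
      have eq: "(\<lambda>x. c * f x) - (\<lambda>x. c * f' x) = (\<lambda>x. c * (f - f') x)" by (auto simp: algebra_simps)
      have "norm_L2 M ((\<lambda>x. c * f x) - (\<lambda>x. c * f' x)) \<le> (norm c + 1) * norm_L2 M (f - f')"
        unfolding eq norm_L2_scale by (intro mult_right_mono) auto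
      also have "\<dots> < (norm c + 1) * (e / (norm c + 1))"
        using f'(2) by (intro mult_strict_left_mono) (auto intro: add_nonneg_pos)
      also have "\<dots> = e" by (simp add: add_nonneg_eq_0_iff)
      finally show ?thesis using cfun.subspace_scale[OF S(2) f'(1), of c] by blast
    qed
    then show "(\<lambda>x. c * f x) \<in> closure_L2 M S" using L2_scale[OF L] by (simp add: closure_L2_def)
  qed
qed

text \<open>
  Orthogonal projections exist: by the parallelogram law a sequence in \<open>V\<close> whose distances to \<open>f\<close>
  tend to the infimum is Cauchy.
\<close>

lemma ex_orthogonal_projection:
  assumes V: "closed_subspace_L2 M V" and f: "f \<in> L2 M"
  shows "\<exists>p\<in>V. \<forall>v\<in>V. inner_L2 M (f - p) v = 0"
proof -
  have VL: "V \<subseteq> L2 M" and sub: "cfun.subspace V" and clo: "closure_L2 M V \<subseteq> V"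
    using V by (auto simp: closed_subspace_L2_def)
  define D where "D = (INF v\<in>V. (norm_L2 M (f - v))\<^sup>2)"
  have ne: "V \<noteq> {}" using cfun.subspace_0[OF sub] by auto
  have bdd: "bdd_below ((\<lambda>v. (norm_L2 M (f - v))\<^sup>2) ` V)" by (rule bdd_belowI2[of _ 0]) simp
  have D_le: "D \<le> (norm_L2 M (f - v))\<^sup>2" if "v \<in> V" for v
    unfolding D_def using bdd that by (rule cINF_lower)
  have "\<exists>v\<in>V. (norm_L2 M (f - v))\<^sup>2 < D + 1 / real (Suc k)" for k
    using cINF_less_iff[OF ne bdd, of "D + 1 / real (Suc k)"] by (simp add: D_def)
  then obtain w where wV: "\<And>k. w k \<in> V" and w: "\<And>k. (norm_L2 M (f - w k))\<^sup>2 < D + 1 / real (Suc k)" by metis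
  have wL: "w k \<in> L2 M" for k using wV VL by blast
  have par: "(norm_L2 M (w i - w j))\<^sup>2 \<le> 2 * (1 / real (Suc i)) + 2 * (1 / real (Suc j))" for i j
  proof -
    define m where "m = (\<lambda>x. (1/2) * (w i + w j) x)"
    have mV: "m \<in> V" unfolding m_def by (intro cfun.subspace_scale[OF sub] cfun.subspace_add[OF sub] wV)
    then have mL: "m \<in> L2 M" using VL by blast
    have pt: "(norm ((w i - w j) x))\<^sup>2 = 2 * (norm ((f - w i) x))\<^sup>2 + 2 * (norm ((f - w j) x))\<^sup>2 - 4 * (norm ((f - m) x))\<^sup>2" for x
      unfolding m_def cmod_power2 by (simp add: power2_eq_square field_simps)
    have "(norm_L2 M (w i - w j))\<^sup>2 =
      2 * (norm_L2 M (f - w i))\<^sup>2 + 2 * (norm_L2 M (f - w j))\<^sup>2 - 4 * (norm_L2 M (f - m))\<^sup>2"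
      unfolding norm_L2_sq pt
      using L2_integrable_sq[OF L2_diff[OF f wL]] L2_integrable_sq[OF L2_diff[OF f mL]]
      by (simp only: Bochner_Integration.integral_add Bochner_Integration.integral_diff Bochner_Integration.integrable_add
       integrable_mult_right Bochner_Integration.integral_mult_right)
    then show ?thesis using D_le[OF mV] w[of i] w[of j] by simp
  qed
  have cau: "\<exists>N. \<forall>i\<ge>N. \<forall>j\<ge>N. norm_L2 M (w i - w j) < e" if "0 < e" for e
  proof -
    obtain N where N: "1 / real (Suc N) < e\<^sup>2 / 4"
      using \<open>0 < e\<close> reals_Archimedean[of "e\<^sup>2/4"] unfolding inverse_eq_divide by fastforce
    have "norm_L2 M (w i - w j) < e" if ij: "i \<ge> N" "j \<ge> N" for i j
    proof -
      have "1 / real (Suc i) \<le> 1 / real (Suc N)" "1 / real (Suc j) \<le> 1 / real (Suc N)"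
        using ij by (auto simp: frac_le)
      with par[of i j] N have "(norm_L2 M (w i - w j))\<^sup>2 < e\<^sup>2" by linarith
      then show ?thesis using \<open>0 < e\<close> by (auto intro: power2_less_imp_less)
    qed
    then show ?thesis by blast
  qed
  obtain p where pL: "p \<in> L2 M" and wp: "(\<lambda>k. norm_L2 M (w k - p)) \<longlonglongrightarrow> 0"
    using L2_complete[OF wL cau] by blast
  have "\<exists>g\<in>V. norm_L2 M (p - g) < e" if e: "0 < e" for e
  proof -
    obtain k where "norm_L2 M (w k - p) < e"
      using order_tendstoD(2)[OF wp e] by (auto simp: eventually_sequentially)
    then show ?thesis using wV by (auto simp: norm_L2_minus_commute[of M p])
  qed
  then have pV: "p \<in> V" using clo pL by (auto simp: closure_L2_def)
  have lim: "(\<lambda>k. norm_L2 M (f - w k)) \<longlonglongrightarrow> norm_L2 M (f - p)"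
  proof (rule LIM_zero_cancel, rule tendsto_rabs_zero_cancel, rule tendsto_sandwich[OF _ _ tendsto_const wp])
    show "\<forall>\<^sub>F k in sequentially. \<bar>norm_L2 M (f - w k) - norm_L2 M (f - p)\<bar> \<le> norm_L2 M (w k - p)"
      using norm_L2_abs_diff[OF L2_diff[OF f wL] L2_diff[OF f pL]] norm_L2_minus_commute[of M p] by (simp add: fun_diff_def)
  qed simp
  have "(norm_L2 M (f - p))\<^sup>2 \<le> D"
  proof (rule LIMSEQ_le)
    show "(\<lambda>k. (norm_L2 M (f - w k))\<^sup>2) \<longlonglongrightarrow> (norm_L2 M (f - p))\<^sup>2" by (intro tendsto_power lim)
    show "(\<lambda>k. D + 1 / real (Suc k)) \<longlonglongrightarrow> D"
      using tendsto_add[OF tendsto_const LIMSEQ_inverse_real_of_nat, of D] by (simp add: inverse_eq_divide)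
  qed (use w in \<open>auto intro: less_imp_le\<close>)
  then have min: "(norm_L2 M (f - p))\<^sup>2 \<le> (norm_L2 M (f - v))\<^sup>2" if "v \<in> V" for v
    using D_le[OF that] by (rule order_trans)
  have "inner_L2 M (f - p) v = 0" if vV: "v \<in> V" for v
  proof (rule ccontr)
    define a where "a = inner_L2 M (f - p) v"
    assume "inner_L2 M (f - p) v \<noteq> 0"
    then have a: "0 < (norm a)\<^sup>2" by (simp add: a_def)
    \<comment> \<open>Moving \<open>p\<close> by \<open>t a v\<close> would bring it closer to \<open>f\<close>.\<close>
    define t where "t = 1 / ((norm_L2 M v)\<^sup>2 + 1)"
    have t: "0 < t" "t * (norm_L2 M v)\<^sup>2 < 1"
      unfolding t_def by (auto simp: add_nonneg_pos divide_simps)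
    have "(\<lambda>x. complex_of_real t * a * v x) \<in> V" by (rule cfun.subspace_scale[OF sub vV])
    then have "p + (\<lambda>x. complex_of_real t * a * v x) \<in> V" using pV by (intro cfun.subspace_add[OF sub])
    moreover have "f - (p + (\<lambda>x. complex_of_real t * a * v x)) = (\<lambda>x. (f - p) x - complex_of_real t * a * v x)"
      by (simp add: fun_eq_iff)
    ultimately have "(norm_L2 M (f - p))\<^sup>2 \<le> (norm_L2 M (\<lambda>x. (f - p) x - complex_of_real t * a * v x))\<^sup>2"
      using min by metis
    also have "\<dots> = (norm_L2 M (f - p))\<^sup>2 - 2 * Re (cnj (complex_of_real t * a) * a) + (norm (complex_of_real t * a))\<^sup>2 * (norm_L2 M v)\<^sup>2"
      unfolding a_def using VL vV by (intro norm_L2_diff_scaled L2_diff f pL) auto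
    also have "Re (cnj (complex_of_real t * a) * a) = t * (norm a)\<^sup>2"
      unfolding cmod_power2 by (simp add: power2_eq_square algebra_simps)
    also have "(norm (complex_of_real t * a))\<^sup>2 = t * t * (norm a)\<^sup>2"
      by (simp add: norm_mult power2_eq_square)
    finally have "2 * (t * (norm a)\<^sup>2) \<le> t * (norm a)\<^sup>2 * (t * (norm_L2 M v)\<^sup>2)" by (simp add: algebra_simps)
    also have "\<dots> \<le> t * (norm a)\<^sup>2 * 1" using t a by (intro mult_left_mono) auto
    finally show False using t a by simp
  qed
  with pV show ?thesis by blast
qed

lemma proj_L2_nearest:
  assumes V: "closed_subspace_L2 M V" and f: "f \<in> L2 M"
  shows "proj_L2 M V f \<in> V" "v \<in> V \<Longrightarrow> norm_L2 M (f - proj_L2 M V f) \<le> norm_L2 M (f - v)"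
proof -
  define p where "p = proj_L2 M V f"
  have "p \<in> V \<and> (\<forall>v\<in>V. inner_L2 M (f - p) v = 0)"
    unfolding p_def proj_L2_def
    by (rule someI_ex[of "\<lambda>p. p \<in> V \<and> (\<forall>v\<in>V. inner_L2 M (f - p) v = 0)"])
      (use ex_orthogonal_projection[OF assms] in blast)
  then have pV: "p \<in> V" and orth: "\<And>v. v \<in> V \<Longrightarrow> inner_L2 M (f - p) v = 0" by auto
  show "proj_L2 M V f \<in> V" using pV by (simp add: p_def)
  have VL: "V \<subseteq> L2 M" and sub: "cfun.subspace V" using V by (auto simp: closed_subspace_L2_def)
  show "norm_L2 M (f - proj_L2 M V f) \<le> norm_L2 M (f - v)" if v: "v \<in> V"
  proof -
    have d: "v - p \<in> V" using cfun.subspace_diff[OF sub v pV] by simp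
    have "(norm_L2 M (\<lambda>x. (f - p) x - 1 * (v - p) x))\<^sup>2 =
      (norm_L2 M (f - p))\<^sup>2 - 2 * Re (cnj 1 * inner_L2 M (f - p) (v - p)) + (norm (1::complex))\<^sup>2 * (norm_L2 M (v - p))\<^sup>2"
      using pV v VL by (intro norm_L2_diff_scaled L2_diff f) auto
    then have "(norm_L2 M (f - p))\<^sup>2 \<le> (norm_L2 M (f - v))\<^sup>2"
      using orth[OF d] by (simp add: fun_diff_def)
    then show ?thesis unfolding p_def by (rule power2_le_imp_le) simp
  qed
qed

section \<open>Measurable selection of a minimiser\<close>

lemma compact_nested_Inter_nonempty:
  fixes B :: "nat \<Rightarrow> 'b::t2_space set"
  assumes B: "\<And>k. compact (B k)" "\<And>k. B k \<noteq> {}" and dec: "\<And>i j. i \<le> j \<Longrightarrow> B j \<subseteq> B i"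
  shows "(\<Inter>k. B k) \<noteq> {}"
proof -
  have "B 0 \<inter> (\<Inter>k\<in>UNIV. B k) \<noteq> {}"
  proof (rule compact_imp_fip_image)
    fix I :: "nat set" assume "finite I"
    then have "B (Max (insert 0 I)) \<subseteq> B 0 \<inter> (\<Inter>k\<in>I. B k)"
      by (intro Int_greatest INT_greatest dec Max_ge) auto
    then show "B 0 \<inter> (\<Inter>k\<in>I. B k) \<noteq> {}" using B(2)[of "Max (insert 0 I)"] by blast
  qed (use B(1) in \<open>auto intro: compact_imp_closed\<close>)
  then show ?thesis by blast
qed

text \<open>
  A compact-valued map that hits closed sets measurably has a measurable selection: intersect its
  values with balls of radius \<open>1 / (k + 1)\<close> about a dense sequence, always taking the first ball that
  is met. The resulting nested compact sets shrink to a single point.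
\<close>

lemma compact_measurable_selection:
  fixes A :: "'x \<Rightarrow> 'b::{metric_space, second_countable_topology} set"
  assumes A: "\<And>x. x \<in> space M \<Longrightarrow> compact (A x)" "\<And>x. x \<in> space M \<Longrightarrow> A x \<noteq> {}"
    and hit: "\<And>C. closed C \<Longrightarrow> {x \<in> space M. A x \<inter> C \<noteq> {}} \<in> sets M"
  obtains s where "s \<in> borel_measurable M" "\<And>x. x \<in> space M \<Longrightarrow> s x \<in> A x"
proof -
  obtain D :: "'b set" where D: "countable D" "\<And>X. open X \<Longrightarrow> X \<noteq> {} \<Longrightarrow> \<exists>d\<in>D. d \<in> X"
    using countable_dense_exists by blast
  then have "D \<noteq> {}" using D(2)[of UNIV] by auto
  define d where "d = from_nat_into D"
  have dense: "\<exists>i. d i \<in> X" if "open X" "X \<noteq> {}" for X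
    using D(2)[OF that] from_nat_into_surj[OF D(1)] unfolding d_def by metis
  define first where "first k S = (LEAST i. S \<inter> cball (d i) (1 / real (Suc k)) \<noteq> {})" for k and S :: "'b set"
  define B where "B = rec_nat A (\<lambda>k B x. B x \<inter> cball (d (first k (B x))) (1 / real (Suc k)))"
  have B0: "B 0 = A" and BS: "B (Suc k) x = B k x \<inter> cball (d (first k (B k x))) (1 / real (Suc k))" for k x
    by (auto simp: B_def)
  have first: "S \<inter> cball (d (first k S)) (1 / real (Suc k)) \<noteq> {}" if ne: "S \<noteq> {}" for S k
  proof -
    obtain a where a: "a \<in> S" using ne by blast
    have "ball a (1 / real (Suc k)) \<noteq> {}" by simp
    then obtain i where "d i \<in> ball a (1 / real (Suc k))" using dense[OF open_ball] by blast
    then have "a \<in> S \<inter> cball (d i) (1 / real (Suc k))" using a by (simp add: dist_commute)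
    then have "S \<inter> cball (d i) (1 / real (Suc k)) \<noteq> {}" by blast
    then show ?thesis unfolding first_def by (rule LeastI)
  qed
  have B: "(\<forall>x\<in>space M. compact (B k x) \<and> B k x \<noteq> {}) \<and>
     (\<forall>C. closed C \<longrightarrow> {x \<in> space M. B k x \<inter> C \<noteq> {}} \<in> sets M)" for k
  proof (induction k)
    case 0 show ?case using A hit by (simp add: B0)
  next
    case (Suc k)
    have "{x \<in> space M. B (Suc k) x \<inter> C \<noteq> {}} \<in> sets M" if "closed C" for C
    proof -
      have first_eq: "first k S = i \<longleftrightarrow> S \<inter> cball (d i) (1 / real (Suc k)) \<noteq> {} \<and>
          (\<forall>j<i. S \<inter> cball (d j) (1 / real (Suc k)) = {})" if "S \<noteq> {}" for S i
        using first[OF that, of k] not_less_Least[of _ "\<lambda>i. S \<inter> cball (d i) (1 / real (Suc k)) \<noteq> {}"]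
        unfolding first_def by (metis (no_types, lifting) linorder_neqE_nat)
      define h where "h i = {x \<in> space M. B k x \<inter> cball (d i) (1 / real (Suc k)) \<noteq> {}}" for i
      define hC where "hC i = {x \<in> space M. B k x \<inter> (cball (d i) (1 / real (Suc k)) \<inter> C) \<noteq> {}}" for i
      have "{x \<in> space M. B (Suc k) x \<inter> C \<noteq> {}} = (\<Union>i. (h i - (\<Union>j\<in>{..<i}. h j)) \<inter> hC i)"
      proof (intro equalityI subsetI)
        fix x assume "x \<in> {x \<in> space M. B (Suc k) x \<inter> C \<noteq> {}}"
        then have x: "x \<in> space M" "B (Suc k) x \<inter> C \<noteq> {}" by auto
        then have "B k x \<noteq> {}" using Suc by auto
        with x have "x \<in> (h i - (\<Union>j\<in>{..<i}. h j)) \<inter> hC i" if "i = first k (B k x)" for i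
          using first_eq[of "B k x" i] that unfolding BS h_def hC_def by blast
        then show "x \<in> (\<Union>i. (h i - (\<Union>j\<in>{..<i}. h j)) \<inter> hC i)" by blast
      next
        fix x assume "x \<in> (\<Union>i. (h i - (\<Union>j\<in>{..<i}. h j)) \<inter> hC i)"
        then obtain i where i: "x \<in> h i" "\<And>j. j < i \<Longrightarrow> x \<notin> h j" "x \<in> hC i" by blast
        then have x: "x \<in> space M" "B k x \<noteq> {}" by (auto simp: h_def)
        from first_eq[OF x(2), of i] i have "first k (B k x) = i" using x(1) unfolding h_def by blast
        with i show "x \<in> {x \<in> space M. B (Suc k) x \<inter> C \<noteq> {}}" unfolding BS hC_def by blast
      qed
      also have "\<dots> \<in> sets M"
      proof -
        have "h i \<in> sets M" "hC i \<in> sets M" for i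
          unfolding h_def hC_def using Suc that by (auto intro: closed_Int)
        then show ?thesis by (intro sets.countable_UN' sets.Int sets.Diff sets.finite_UN) auto
      qed
      finally show ?thesis .
    qed
    moreover have "compact (B (Suc k) x)" "B (Suc k) x \<noteq> {}" if "x \<in> space M" for x
      using Suc that first[of "B k x" k] unfolding BS by (auto intro: compact_Int_closed)
    ultimately show ?case by (intro conjI ballI allI impI) auto
  qed
  have dec: "B j x \<subseteq> B i x" if "i \<le> j" for i j x
    using lift_Suc_antimono_le[of "\<lambda>k. B k x" i j] that BS by auto
  have uniq: "z = z'" if "z \<in> (\<Inter>k. B k x)" "z' \<in> (\<Inter>k. B k x)" for z z' x
  proof (rule ccontr)
    assume "z \<noteq> z'"
    then obtain k where k: "1 / real (Suc k) < dist z z' / 2"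
      using reals_Archimedean[of "dist z z' / 2"] by (auto simp: inverse_eq_divide)
    have "z \<in> B (Suc k) x" "z' \<in> B (Suc k) x" using that by blast+
    then have "dist (d (first k (B k x))) z \<le> 1 / real (Suc k)" "dist (d (first k (B k x))) z' \<le> 1 / real (Suc k)"
      unfolding BS by auto
    with k dist_triangle3[of z z' "d (first k (B k x))"] show False by linarith
  qed
  define s where "s x = (SOME z. z \<in> (\<Inter>k. B k x))" for x
  have s: "s x \<in> (\<Inter>k. B k x)" if "x \<in> space M" for x
  proof -
    have "(\<Inter>k. B k x) \<noteq> {}" using B that dec by (intro compact_nested_Inter_nonempty) auto
    then show ?thesis unfolding s_def by (rule someI_ex[of "\<lambda>z. z \<in> (\<Inter>k. B k x)", OF ex_in_conv[THEN iffD2]])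
  qed
  have hits: "s x \<in> C \<longleftrightarrow> (\<forall>k. B k x \<inter> C \<noteq> {})" if x: "x \<in> space M" and C: "closed C" for x C
  proof
    assume "s x \<in> C" then show "\<forall>k. B k x \<inter> C \<noteq> {}" using s[OF x] by blast
  next
    assume "\<forall>k. B k x \<inter> C \<noteq> {}"
    then have "(\<Inter>k. B k x \<inter> C) \<noteq> {}" using B x C
      by (intro compact_nested_Inter_nonempty Int_mono dec) (auto intro: compact_Int_closed)
    then obtain z where "z \<in> (\<Inter>k. B k x)" "z \<in> C" by blast
    then show "s x \<in> C" using uniq s[OF x] by blast
  qed
  show ?thesis
  proof (rule that)
    show "s x \<in> A x" if "x \<in> space M" for x using s[OF that] B0 by (metis INT_E UNIV_I)
    show "s \<in> borel_measurable M"
    proof (rule borel_measurableI)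
      fix S :: "'b set" assume "open S"
      then have cl: "closed (- S)" by auto
      have "s -` S \<inter> space M = space M - (\<Inter>k. {x \<in> space M. B k x \<inter> - S \<noteq> {}})"
        using hits[OF _ cl] by auto
      also have "\<dots> \<in> sets M" using B cl by (intro sets.compl_sets sets.countable_INT) auto
      finally show "s -` S \<inter> space M \<in> sets M" .
    qed
  qed
qed

text \<open>
  The set of minimisers is compact, and it meets a closed set \<open>C\<close> exactly if the infimum over \<open>K \<inter> C\<close>
  does not exceed the infimum over \<open>K\<close>. By continuity both infima can be taken over countable dense
  subsets, which makes this a measurable condition.
\<close>

lemma measurable_argmin:
  fixes \<phi> :: "'x \<Rightarrow> 'b::{metric_space, second_countable_topology} \<Rightarrow> real"
  assumes K: "compact K" "K \<noteq> {}"
    and meas: "\<And>u. u \<in> K \<Longrightarrow> (\<lambda>x. \<phi> x u) \<in> borel_measurable M"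
    and cont: "\<And>x. x \<in> space M \<Longrightarrow> continuous_on K (\<phi> x)"
  obtains s where "s \<in> borel_measurable M" "\<And>x. x \<in> space M \<Longrightarrow> s x \<in> K"
    "\<And>x u. x \<in> space M \<Longrightarrow> u \<in> K \<Longrightarrow> \<phi> x (s x) \<le> \<phi> x u"
proof -
  define A where "A x = {u \<in> K. \<forall>v\<in>K. \<phi> x u \<le> \<phi> x v}" for x
  have near: "\<exists>e\<in>E. \<phi> x e < \<phi> x u + r"
    if x: "x \<in> space M" and E: "E \<subseteq> K" and u: "u \<in> K" and "u \<in> closure E" and r: "0 < r" for x E u and r :: real
  proof -
    obtain e where e: "\<And>n. e n \<in> E" "e \<longlonglongrightarrow> u" using \<open>u \<in> closure E\<close> by (auto simp: closure_sequential)
    have "(\<lambda>n. \<phi> x (e n)) \<longlonglongrightarrow> \<phi> x u"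
      using e(1) E
      by (intro continuous_on_tendsto_compose[OF cont[OF x] e(2) u] always_eventually) auto
    from order_tendstoD(2)[OF this, of "\<phi> x u + r"] r obtain n where "\<phi> x (e n) < \<phi> x u + r"
      by (auto simp: eventually_sequentially)
    with e(1) show ?thesis by blast
  qed
  have cA: "compact (A x)" "A x \<noteq> {}" if x: "x \<in> space M" for x
  proof -
    obtain u where u: "u \<in> K" "\<And>v. v \<in> K \<Longrightarrow> \<phi> x u \<le> \<phi> x v"
      using continuous_attains_inf[OF K cont[OF x]] by blast
    then show "A x \<noteq> {}" by (auto simp: A_def)
    have "A x = K \<inter> \<phi> x -` {..\<phi> x u}" using u by (force simp: A_def)
    moreover have "closed (K \<inter> \<phi> x -` {..\<phi> x u})"
      using K cont[OF x] by (intro continuous_closed_preimage) (auto intro: compact_imp_closed)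
    ultimately show "compact (A x)" using compact_Int_closed[OF K(1), of "A x"] by (auto simp: A_def Int_absorb1)
  qed
  have hit: "{x \<in> space M. A x \<inter> C \<noteq> {}} \<in> sets M" if C: "closed C" for C
  proof (cases "K \<inter> C = {}")
    case True
    then have "{x \<in> space M. A x \<inter> C \<noteq> {}} = {}" by (auto simp: A_def)
    then show ?thesis by (metis sets.empty_sets)
  next
    case False
    have cKC: "compact (K \<inter> C)" using K C by (intro compact_Int_closed)
    obtain D where D: "countable D" "D \<subseteq> K" "K \<subseteq> closure D" using separable by blast
    obtain E where E: "countable E" "E \<subseteq> K \<inter> C" "K \<inter> C \<subseteq> closure E" using separable by blast
    have "A x \<inter> C \<noteq> {} \<longleftrightarrow> (\<forall>d\<in>D. \<forall>j. \<exists>e\<in>E. \<phi> x e < \<phi> x d + 1 / real (Suc j))" (is "_ = ?R")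
      if x: "x \<in> space M" for x
    proof
      assume "A x \<inter> C \<noteq> {}"
      then obtain a where a: "a \<in> K \<inter> C" "\<And>v. v \<in> K \<Longrightarrow> \<phi> x a \<le> \<phi> x v" by (auto simp: A_def)
      show ?R
      proof (intro ballI allI)
        fix d and j :: nat assume "d \<in> D"
        then have "\<phi> x a \<le> \<phi> x d" using a D by blast
        moreover obtain e where "e \<in> E" "\<phi> x e < \<phi> x a + 1 / real (Suc j)"
          using near[OF x, of E a "1 / real (Suc j)"] E a by auto
        ultimately show "\<exists>e\<in>E. \<phi> x e < \<phi> x d + 1 / real (Suc j)" by (intro bexI[of _ e]) auto
      qed
    next
      assume R: ?R
      obtain c where c: "c \<in> K \<inter> C" "\<And>v. v \<in> K \<inter> C \<Longrightarrow> \<phi> x c \<le> \<phi> x v"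
        using continuous_attains_inf[OF cKC False continuous_on_subset[OF cont[OF x]]] by auto
      have cd: "\<phi> x c \<le> \<phi> x d" if d: "d \<in> D" for d
      proof (rule field_le_epsilon)
        fix r :: real assume "0 < r"
        then obtain j where j: "1 / real (Suc j) < r"
          using reals_Archimedean[of r] by (auto simp: inverse_eq_divide)
        obtain e where "e \<in> E" "\<phi> x e < \<phi> x d + 1 / real (Suc j)" using R d by blast
        then show "\<phi> x c \<le> \<phi> x d + r" using c(2)[of e] E j by force
      qed
      have "\<phi> x c \<le> \<phi> x v" if v: "v \<in> K" for v
      proof (rule field_le_epsilon)
        fix r :: real assume "0 < r"
        then obtain d where "d \<in> D" "\<phi> x d < \<phi> x v + r" using near[OF x D(2) v] D(3) v by blast
        then show "\<phi> x c \<le> \<phi> x v + r" using cd by force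
      qed
      with c(1) show "A x \<inter> C \<noteq> {}" by (auto simp: A_def)
    qed
    then have "{x \<in> space M. A x \<inter> C \<noteq> {}} = {x \<in> space M. \<forall>d\<in>D. \<forall>j. \<exists>e\<in>E. \<phi> x e < \<phi> x d + 1 / real (Suc j)}"
      by auto
    also have "\<dots> \<in> sets M"
    proof -
      have [measurable]: "(\<lambda>x. \<phi> x e) \<in> borel_measurable M" if "e \<in> D \<union> E" for e
        using that D E by (intro meas) auto
      have "{x \<in> space M. \<phi> x e < \<phi> x d + 1 / real (Suc j)} \<in> sets M" if "d \<in> D" "e \<in> E" for d e j
        using that by (intro borel_measurable_less borel_measurable_add) auto
      then have "(\<Union>e\<in>E. {x \<in> space M. \<phi> x e < \<phi> x d + 1 / real (Suc j)}) \<in> sets M" if "d \<in> D" for d j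
        using that E(1) by (intro sets.countable_UN') auto
      moreover have "D \<noteq> {}" using K(2) D(3) by auto
      ultimately have "(\<Inter>d\<in>D. \<Inter>j. \<Union>e\<in>E. {x \<in> space M. \<phi> x e < \<phi> x d + 1 / real (Suc j)}) \<in> sets M"
        by (intro sets.countable_INT' sets.countable_INT D(1)) auto
      also have "(\<Inter>d\<in>D. \<Inter>j. \<Union>e\<in>E. {x \<in> space M. \<phi> x e < \<phi> x d + 1 / real (Suc j)}) =
        {x \<in> space M. \<forall>d\<in>D. \<forall>j. \<exists>e\<in>E. \<phi> x e < \<phi> x d + 1 / real (Suc j)}"
        using \<open>D \<noteq> {}\<close> by auto
      finally show ?thesis .
    qed
    finally show ?thesis .
  qed
  obtain s where "s \<in> borel_measurable M" "\<And>x. x \<in> space M \<Longrightarrow> s x \<in> A x"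
    using compact_measurable_selection[of M A, OF cA hit] by blast
  then show ?thesis by (intro that[of s]) (auto simp: A_def)
qed

section \<open>Unitary matrices\<close>

text \<open>
  Matrices with indices in \<open>{1..m}\<close>, extended by zero, are functions on pairs of natural numbers. In this
  form they live in one topological space for all \<open>m\<close>, and compactness follows from Tychonoff's theorem.
\<close>

definition unitary_matrices :: "nat \<Rightarrow> (nat \<times> nat \<Rightarrow> complex) set" where
  "unitary_matrices m = {u.
     (\<forall>p. p \<notin> {1..m} \<times> {1..m} \<longrightarrow> u p = 0) \<and>
     (\<forall>k\<in>{1..m}. \<forall>l\<in>{1..m}. (\<Sum>j=1..m. u (k, j) * cnj (u (l, j))) = (if k = l then 1 else 0)) \<and>
     (\<forall>i\<in>{1..m}. \<forall>j\<in>{1..m}. (\<Sum>k=1..m. cnj (u (k, i)) * u (k, j)) = (if i = j then 1 else 0))}"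

lemma unitary_matrices_outside: "u \<in> unitary_matrices m \<Longrightarrow> p \<notin> {1..m} \<times> {1..m} \<Longrightarrow> u p = 0"
  unfolding unitary_matrices_def by blast

lemma unitary_matrices_rows:
  "u \<in> unitary_matrices m \<Longrightarrow> k \<in> {1..m} \<Longrightarrow> l \<in> {1..m} \<Longrightarrow>
     (\<Sum>j=1..m. u (k, j) * cnj (u (l, j))) = (if k = l then 1 else 0)"
  unfolding unitary_matrices_def by blast

lemma unitary_matrices_columns:
  "u \<in> unitary_matrices m \<Longrightarrow> i \<in> {1..m} \<Longrightarrow> j \<in> {1..m} \<Longrightarrow>
     (\<Sum>k=1..m. cnj (u (k, i)) * u (k, j)) = (if i = j then 1 else 0)"
  unfolding unitary_matrices_def by blast

lemma unitary_matrices_norm_le: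
  assumes "u \<in> unitary_matrices m" shows "norm (u p) \<le> 1"
proof (cases "p \<in> {1..m} \<times> {1..m}")
  case True
  then obtain k j where p: "p = (k, j)" "k \<in> {1..m}" "j \<in> {1..m}" by auto
  have "(\<Sum>j=1..m. u (k, j) * cnj (u (k, j))) = of_real (\<Sum>j=1..m. (norm (u (k, j)))\<^sup>2)"
    by (simp add: complex_norm_square del: of_real_power)
  then have "(\<Sum>j=1..m. (norm (u (k, j)))\<^sup>2) = 1"
    using unitary_matrices_rows[OF assms p(2) p(2)] by (simp flip: of_real_eq_iff[where 'a=complex])
  moreover have "(norm (u (k, j)))\<^sup>2 \<le> (\<Sum>j=1..m. (norm (u (k, j)))\<^sup>2)"
    by (rule member_le_sum) (use p in auto)
  ultimately have "(norm (u p))\<^sup>2 \<le> 1\<^sup>2" using p by simp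
  then show ?thesis by (rule power2_le_imp_le) simp
next
  case False
  then show ?thesis using unitary_matrices_outside[OF assms] by simp
qed

lemma compact_unitary_matrices: "compact (unitary_matrices m)"
proof -
  have "compactin (product_topology (\<lambda>_::nat \<times> nat. euclidean) UNIV) (PiE UNIV (\<lambda>_. cball (0::complex) 1))"
    by (simp add: compactin_PiE)
  then have cpt: "compact (PiE UNIV (\<lambda>_::nat \<times> nat. cball (0::complex) 1))"
    by (simp add: euclidean_product_topology)
  have [continuous_intros]: "continuous_on UNIV (\<lambda>u::nat \<times> nat \<Rightarrow> complex. u p)" for p
    by (rule continuous_on_product_coordinates)
  have "closed (unitary_matrices m)"
    unfolding unitary_matrices_def Ball_def
    by (intro closed_Collect_conj closed_Collect_all closed_Collect_imp open_Collect_const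
        closed_Collect_eq continuous_intros)
  moreover have "unitary_matrices m \<subseteq> PiE UNIV (\<lambda>_. cball 0 1)"
    using unitary_matrices_norm_le by auto
  ultimately show ?thesis using compact_Int_closed[OF cpt, of "unitary_matrices m"] by (simp add: Int_absorb1)
qed

lemma orthonormal_rows_isometry:
  fixes w :: "'k \<Rightarrow> 'j \<Rightarrow> complex"
  assumes "finite I" and orth: "\<And>k l. k \<in> I \<Longrightarrow> l \<in> I \<Longrightarrow> (\<Sum>j\<in>J. w k j * cnj (w l j)) = (if k = l then 1 else 0)"
  shows "(\<Sum>j\<in>J. (norm (\<Sum>k\<in>I. w k j * y k))\<^sup>2) = (\<Sum>k\<in>I. (norm (y k))\<^sup>2)"
proof -
  have "complex_of_real (\<Sum>j\<in>J. (norm (\<Sum>k\<in>I. w k j * y k))\<^sup>2)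
     = (\<Sum>j\<in>J. (\<Sum>k\<in>I. w k j * y k) * (\<Sum>l\<in>I. cnj (w l j) * cnj (y l)))"
    by (simp add: complex_norm_square del: of_real_power)
  also have "\<dots> = (\<Sum>j\<in>J. \<Sum>k\<in>I. \<Sum>l\<in>I. (y k * cnj (y l)) * (w k j * cnj (w l j)))"
    by (simp add: sum_product mult_ac)
  also have "\<dots> = (\<Sum>k\<in>I. \<Sum>j\<in>J. \<Sum>l\<in>I. (y k * cnj (y l)) * (w k j * cnj (w l j)))"
    by (rule sum.swap)
  also have "\<dots> = (\<Sum>k\<in>I. \<Sum>l\<in>I. (y k * cnj (y l)) * (\<Sum>j\<in>J. w k j * cnj (w l j)))"
    unfolding sum_distrib_left by (intro sum.cong refl sum.swap)
  also have "\<dots> = (\<Sum>k\<in>I. \<Sum>l\<in>I. if k = l then y k * cnj (y l) else 0)"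
    using orth by (intro sum.cong) auto
  also have "\<dots> = (\<Sum>k\<in>I. y k * cnj (y k))" using \<open>finite I\<close> by simp
  also have "\<dots> = complex_of_real (\<Sum>k\<in>I. (norm (y k))\<^sup>2)"
    by (simp add: complex_norm_square del: of_real_power)
  finally show ?thesis by (simp only: of_real_eq_iff)
qed

lemma unitary_Bessel:
  assumes u: "u \<in> unitary_matrices m" and S: "S \<subseteq> {1..m}"
  shows "(\<Sum>k\<in>S. (norm (\<Sum>j=1..m. u (k, j) * x j))\<^sup>2) \<le> (\<Sum>j=1..m. (norm (x j))\<^sup>2)"
proof -
  have "(\<Sum>k\<in>S. (norm (\<Sum>j=1..m. u (k, j) * x j))\<^sup>2) \<le> (\<Sum>k=1..m. (norm (\<Sum>j=1..m. u (k, j) * x j))\<^sup>2)"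
    using S by (intro sum_mono2) auto
  also have "\<dots> = (\<Sum>j=1..m. (norm (x j))\<^sup>2)"
  proof (rule orthonormal_rows_isometry)
    fix k l assume kl: "k \<in> {1..m}" "l \<in> {1..m}"
    show "(\<Sum>j=1..m. u (j, k) * cnj (u (j, l))) = (if k = l then 1 else 0)"
      using unitary_matrices_columns[OF u kl(2) kl(1)] by (auto simp: mult.commute)
  qed simp
  finally show ?thesis .
qed

lemma unitary_adjoint_isometry:
  assumes u: "u \<in> unitary_matrices m" and S: "S \<subseteq> {1..m}"
  shows "(\<Sum>j=1..m. (norm (\<Sum>k\<in>S. cnj (u (k, j)) * y k))\<^sup>2) = (\<Sum>k\<in>S. (norm (y k))\<^sup>2)"
proof (rule orthonormal_rows_isometry)
  show "finite S" using S by (rule finite_subset) simp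
  fix k l assume "k \<in> S" "l \<in> S"
  then show "(\<Sum>j=1..m. cnj (u (k, j)) * cnj (cnj (u (l, j)))) = (if k = l then 1 else 0)"
    using unitary_matrices_rows[OF u, of l k] S by (auto simp: mult.commute subset_iff)
qed

lemma unitary_reconstruct:
  assumes u: "u \<in> unitary_matrices m" and i: "i \<in> {1..m}"
  shows "(\<Sum>k=1..m. cnj (u (k, i)) * (\<Sum>j=1..m. u (k, j) * x j)) = x i"
proof -
  have "(\<Sum>k=1..m. cnj (u (k, i)) * (\<Sum>j=1..m. u (k, j) * x j))
      = (\<Sum>k=1..m. \<Sum>j=1..m. (cnj (u (k, i)) * u (k, j)) * x j)"
    by (simp add: sum_distrib_left mult.assoc)
  also have "\<dots> = (\<Sum>j=1..m. \<Sum>k=1..m. (cnj (u (k, i)) * u (k, j)) * x j)"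
    by (rule sum.swap)
  also have "\<dots> = (\<Sum>j=1..m. (if i = j then 1 else 0) * x j)"
    unfolding sum_distrib_right[symmetric] using unitary_matrices_columns[OF u i]
    by (intro sum.cong) auto
  also have "\<dots> = x i" using i by (simp add: if_distrib[of "\<lambda>c. c * _"] cong: if_cong)
  finally show ?thesis .
qed

text \<open>Gaussian elimination: solve one equation for one unknown and substitute.\<close>

lemma ex_homogeneous_solution:
  fixes c :: "'i \<Rightarrow> 'j \<Rightarrow> complex"
  assumes "finite I" "finite J" "card I < card J"
  shows "\<exists>x. (\<exists>j\<in>J. x j \<noteq> 0) \<and> (\<forall>i\<in>I. (\<Sum>j\<in>J. x j * c i j) = 0)"
  using assms
proof (induction I arbitrary: J c rule: finite_induct)
  case empty
  then have "J \<noteq> {}" by auto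
  then show ?case by (intro exI[of _ "\<lambda>_. 1"]) auto
next
  case (insert i0 I)
  show ?case
  proof (cases "\<exists>j0\<in>J. c i0 j0 \<noteq> 0")
    case False
    obtain x where "\<exists>j\<in>J. x j \<noteq> 0" "\<forall>i\<in>I. (\<Sum>j\<in>J. x j * c i j) = 0"
      using insert.IH[of J c] insert.prems insert.hyps by auto
    with False show ?thesis by (intro exI[of _ x]) auto
  next
    case True
    then obtain j0 where j0: "j0 \<in> J" "c i0 j0 \<noteq> 0" by blast
    define J' where "J' = J - {j0}"
    have J: "finite J'" "card I < card J'" "J = insert j0 J'" "j0 \<notin> J'"
      using insert.prems insert.hyps j0 by (auto simp: J'_def)
    obtain x where x: "\<exists>j\<in>J'. x j \<noteq> 0"
      "\<And>i. i \<in> I \<Longrightarrow> (\<Sum>j\<in>J'. x j * (c i j - c i j0 * c i0 j / c i0 j0)) = 0"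
      using insert.IH[OF J(1,2), of "\<lambda>i j. c i j - c i j0 * c i0 j / c i0 j0"] by blast
    define s where "s = (\<Sum>j\<in>J'. x j * c i0 j)"
    define y where "y = x(j0 := - s / c i0 j0)"
    have sum_y: "(\<Sum>j\<in>J. y j * c i j) = - s / c i0 j0 * c i j0 + (\<Sum>j\<in>J'. x j * c i j)" for i
    proof -
      have "(\<Sum>j\<in>J'. y j * c i j) = (\<Sum>j\<in>J'. x j * c i j)"
        using J(4) by (intro sum.cong) (auto simp: y_def)
      then show ?thesis using J by (simp add: y_def)
    qed
    have "(\<Sum>j\<in>J. y j * c i j) = 0" if "i \<in> insert i0 I" for i
    proof (cases "i = i0")
      case True then show ?thesis using j0 by (simp add: sum_y s_def)
    next
      case False
      then have "(\<Sum>j\<in>J'. x j * (c i j - c i j0 * c i0 j / c i0 j0)) = 0" using x(2) that by auto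
      moreover have "(\<Sum>j\<in>J'. x j * (c i j - c i j0 * c i0 j / c i0 j0))
          = (\<Sum>j\<in>J'. x j * c i j) - (\<Sum>j\<in>J'. (c i j0 / c i0 j0) * (x j * c i0 j))"
        by (simp add: sum_subtractf algebra_simps)
      moreover have "(\<Sum>j\<in>J'. (c i j0 / c i0 j0) * (x j * c i0 j)) = (c i j0 / c i0 j0) * s"
        unfolding s_def sum_distrib_left ..
      ultimately show ?thesis by (simp add: sum_y)
    qed
    moreover have "\<exists>j\<in>J. y j \<noteq> 0" using x(1) J(3,4) by (auto simp: y_def)
    ultimately show ?thesis by blast
  qed
qed

text \<open>
  A square matrix with orthonormal rows has orthonormal columns: \<open>m + 1\<close> vectors in \<open>\<complex>\<^sup>m\<close> are linearly
  dependent, so every unit vector is a combination of the rows, with coefficients given by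
  orthonormality.
\<close>

lemma orthonormal_rows_imp_unitary:
  fixes v :: "nat \<Rightarrow> nat \<Rightarrow> complex"
  assumes rows: "\<And>k l. k \<in> {1..m} \<Longrightarrow> l \<in> {1..m} \<Longrightarrow> (\<Sum>j=1..m. v k j * cnj (v l j)) = (if k = l then 1 else 0)"
  shows "(\<lambda>(k, j). if k \<in> {1..m} \<and> j \<in> {1..m} then v k j else 0) \<in> unitary_matrices m"
proof -
  have cols: "(\<Sum>k=1..m. cnj (v k i) * v k j) = (if i = j then 1 else 0)"
    if i: "i \<in> {1..m}" and j: "j \<in> {1..m}" for i j
  proof -
    define r where "r k j = (if k = 0 then (if i = j then 1 else 0) else v k j)" for k j
    have "\<exists>x. (\<exists>k\<in>{0..m}. x k \<noteq> 0) \<and> (\<forall>j\<in>{1..m}. (\<Sum>k\<in>{0..m}. x k * r k j) = 0)"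
      by (rule ex_homogeneous_solution) auto
    then obtain x where x: "\<exists>k\<in>{0..m}. x k \<noteq> 0" "\<And>j. j \<in> {1..m} \<Longrightarrow> (\<Sum>k\<in>{0..m}. x k * r k j) = 0"
      by blast
    have eq: "x 0 * (if i = j then 1 else 0) + (\<Sum>k=1..m. x k * v k j) = 0" if "j \<in> {1..m}" for j
    proof -
      have "(\<Sum>k=1..m. x k * r k j) = (\<Sum>k=1..m. x k * v k j)" by (intro sum.cong) (auto simp: r_def)
      then show ?thesis using x(2)[OF that] by (simp add: sum.atLeast_Suc_atMost r_def)
    qed
    have coeff: "x 0 * cnj (v l i) + x l = 0" if l: "l \<in> {1..m}" for l
    proof -
      have "0 = (\<Sum>j=1..m. (x 0 * (if i = j then 1 else 0) + (\<Sum>k=1..m. x k * v k j)) * cnj (v l j))"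
        using eq by simp
      also have "\<dots> = (\<Sum>j=1..m. if i = j then x 0 * cnj (v l j) else 0) + (\<Sum>j=1..m. \<Sum>k=1..m. x k * (v k j * cnj (v l j)))"
        unfolding distrib_right sum.distrib sum_distrib_right
        by (intro arg_cong2[where f="(+)"] sum.cong) (auto simp: mult.assoc)
      also have "(\<Sum>j=1..m. \<Sum>k=1..m. x k * (v k j * cnj (v l j))) = (\<Sum>k=1..m. x k * (\<Sum>j=1..m. v k j * cnj (v l j)))"
        unfolding sum_distrib_left by (rule sum.swap)
      also have "\<dots> = (\<Sum>k=1..m. if k = l then x k else 0)"
        using rows[OF _ l] by (intro sum.cong) auto
      finally show ?thesis using i l by simp
    qed
    have x0: "x 0 \<noteq> 0"
    proof
      assume "x 0 = 0"
      with coeff have "\<And>l. l \<in> {1..m} \<Longrightarrow> x l = 0" by auto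
      with \<open>x 0 = 0\<close> x(1) show False by (metis atLeastAtMost_iff le0 less_one linorder_le_less_linear)
    qed
    have "x 0 * (if i = j then 1 else 0) = - (\<Sum>k=1..m. x k * v k j)"
      using eq[OF j] by (simp add: eq_neg_iff_add_eq_0)
    also have "\<dots> = (\<Sum>k=1..m. x 0 * (cnj (v k i) * v k j))"
      unfolding sum_negf[symmetric]
    proof (intro sum.cong refl)
      fix k assume "k \<in> {1..m}"
      then have "x k = - (x 0 * cnj (v k i))" using coeff[of k] by (simp add: eq_neg_iff_add_eq_0 add.commute)
      then show "- (x k * v k j) = x 0 * (cnj (v k i) * v k j)" by simp
    qed
    also have "\<dots> = x 0 * (\<Sum>k=1..m. cnj (v k i) * v k j)" by (rule sum_distrib_left[symmetric])
    finally have "x 0 * (if i = j then 1 else 0) = x 0 * (\<Sum>k=1..m. cnj (v k i) * v k j)" .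
    then have "(if i = j then 1 else 0) = (\<Sum>k=1..m. cnj (v k i) * v k j)"
      using x0 by (simp only: mult_cancel_left simp_thms)
    then show ?thesis by (rule sym)
  qed
  define u where "u = (\<lambda>(k, j). if k \<in> {1..m} \<and> j \<in> {1..m} then v k j else 0)"
  have u: "u (k, j) = v k j" if "k \<in> {1..m}" "j \<in> {1..m}" for k j
    using that by (simp add: u_def)
  have "u \<in> unitary_matrices m"
    unfolding unitary_matrices_def mem_Collect_eq
  proof (intro conjI ballI allI impI)
    show "u p = 0" if "p \<notin> {1..m} \<times> {1..m}" for p
      using that by (cases p) (auto simp: u_def)
    show "(\<Sum>j=1..m. u (k, j) * cnj (u (l, j))) = (if k = l then 1 else 0)"
      if "k \<in> {1..m}" "l \<in> {1..m}" for k l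
      unfolding rows[OF that, symmetric] by (rule sum.cong) (simp_all only: u that)
    show "(\<Sum>k=1..m. cnj (u (k, i)) * u (k, j)) = (if i = j then 1 else 0)"
      if "i \<in> {1..m}" "j \<in> {1..m}" for i j
      unfolding cols[OF that, symmetric] by (rule sum.cong) (simp_all only: u that)
  qed
  then show ?thesis by (simp only: u_def)
qed

text \<open>
  The rows are chosen from the last one upwards. Row \<open>k\<close> has to be orthogonal to the \<open>m - k\<close> rows below
  it and, if \<open>k > n\<close>, to solve \<open>n\<close> further equations; in either case there are fewer than \<open>m\<close>
  linear conditions.
\<close>

lemma ex_unitary_with_kernel_rows:
  fixes a :: "'i \<Rightarrow> nat \<Rightarrow> complex"
  assumes I: "finite I" "card I \<le> n"
  shows "\<exists>u\<in>unitary_matrices m. \<forall>k\<in>{n<..m}. \<forall>i\<in>I. (\<Sum>j=1..m. u (k, j) * a i j) = 0"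
proof -
  have rows: "\<exists>v. (\<forall>k\<in>{m - t<..m}. \<forall>l\<in>{m - t<..m}. (\<Sum>j=1..m. v k j * cnj (v l j)) = (if k = l then 1 else 0)) \<and>
     (\<forall>k\<in>{m - t<..m}. n < k \<longrightarrow> (\<forall>i\<in>I. (\<Sum>j=1..m. v k j * a i j) = 0))" if "t \<le> m" for t
    using that
  proof (induction t)
    case 0 show ?case by simp
  next
    case (Suc t)
    have "\<exists>v. (\<forall>k\<in>{m - t<..m}. \<forall>l\<in>{m - t<..m}. (\<Sum>j=1..m. v k j * cnj (v l j)) = (if k = l then 1 else 0)) \<and>
     (\<forall>k\<in>{m - t<..m}. n < k \<longrightarrow> (\<forall>i\<in>I. (\<Sum>j=1..m. v k j * a i j) = 0))"
      by (rule Suc.IH) (use Suc.prems in simp)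
    then obtain v where v: "\<And>k l. k \<in> {m - t<..m} \<Longrightarrow> l \<in> {m - t<..m} \<Longrightarrow> (\<Sum>j=1..m. v k j * cnj (v l j)) = (if k = l then 1 else 0)"
      "\<And>k i. k \<in> {m - t<..m} \<Longrightarrow> n < k \<Longrightarrow> i \<in> I \<Longrightarrow> (\<Sum>j=1..m. v k j * a i j) = 0"
      by blast
    define p where "p = m - t"
    have set_eq: "{m - Suc t<..m} = insert p {p<..m}" using Suc.prems by (auto simp: p_def)
    define A where "A = (if n < p then a ` I else {})"
    define E where "E = A \<union> (\<lambda>l j. cnj (v l j)) ` {p<..m}"
    have "card A + t < m"
    proof (cases "n < p")
      case True
      then have "card A \<le> n" using I card_image_le[OF I(1), of a] by (simp add: A_def)
      then show ?thesis using True Suc.prems by (auto simp: p_def)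
    qed (use Suc.prems in \<open>auto simp: A_def\<close>)
    moreover have "card E \<le> card A + card ((\<lambda>l j. cnj (v l j)) ` {p<..m})"
      unfolding E_def by (rule card_Un_le)
    moreover have "card ((\<lambda>l j. cnj (v l j)) ` {p<..m}) \<le> t"
      using card_image_le[of "{p<..m}" "\<lambda>l j. cnj (v l j)"] Suc.prems by (simp add: p_def)
    ultimately have "card E < card {1..m}" by simp
    moreover have "finite E" using I(1) by (simp add: E_def A_def)
    ultimately obtain x where x: "\<exists>j\<in>{1..m}. x j \<noteq> 0" "\<And>e. e \<in> E \<Longrightarrow> (\<Sum>j=1..m. x j * e j) = 0"
      using ex_homogeneous_solution[of E "{1..m}" "\<lambda>e j. e j"] by auto
    define N where "N = (\<Sum>j=1..m. (norm (x j))\<^sup>2)"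
    obtain j0 where j0: "j0 \<in> {1..m}" "x j0 \<noteq> 0" using x(1) by blast
    have N: "0 < N" unfolding N_def by (rule sum_pos2[OF _ j0(1)]) (use j0(2) in auto)
    define y where "y j = x j / of_real (sqrt N)" for j
    define w where "w = v(p := y)"
    have yE: "(\<Sum>j=1..m. y j * e j) = 0" if "e \<in> E" for e
      using x(2)[OF that] by (simp add: y_def sum_divide_distrib[symmetric])
    have yy: "(\<Sum>j=1..m. y j * cnj (y j)) = 1"
    proof -
      have "(\<Sum>j=1..m. y j * cnj (y j)) = (\<Sum>j=1..m. x j * cnj (x j)) / (of_real (sqrt N) * of_real (sqrt N))"
        by (simp add: y_def sum_divide_distrib)
      also have "(\<Sum>j=1..m. x j * cnj (x j)) = of_real N"
        by (simp add: N_def complex_norm_square del: of_real_power)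
      also have "complex_of_real (sqrt N) * of_real (sqrt N) = of_real N" using N by (simp flip: of_real_mult)
      finally show ?thesis using N by simp
    qed
    have yv: "(\<Sum>j=1..m. y j * cnj (v l j)) = 0" if "l \<in> {p<..m}" for l
      using yE[of "\<lambda>j. cnj (v l j)"] that by (auto simp: E_def)
    have vy: "(\<Sum>j=1..m. v l j * cnj (y j)) = 0" if "l \<in> {p<..m}" for l
      using arg_cong[OF yv[OF that], of cnj] by (simp add: mult.commute)
    have "(\<Sum>j=1..m. w k j * cnj (w l j)) = (if k = l then 1 else 0)"
      if "k \<in> insert p {p<..m}" "l \<in> insert p {p<..m}" for k l
      using that v(1)[of k l] yy yv[of l] vy[of k] by (auto simp: w_def p_def)
    moreover have "(\<Sum>j=1..m. w k j * a i j) = 0" if "k \<in> insert p {p<..m}" "n < k" "i \<in> I" for k i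
      using that v(2)[of k i] yE[of "a i"] by (auto simp: w_def p_def E_def A_def)
    ultimately show ?case unfolding set_eq by blast
  qed
  have all: "{m - m<..m} = {1..m}" by auto
  from rows[OF order_refl, unfolded all] obtain v where v: "\<And>k l. k \<in> {1..m} \<Longrightarrow> l \<in> {1..m} \<Longrightarrow> (\<Sum>j=1..m. v k j * cnj (v l j)) = (if k = l then 1 else 0)"
      "\<And>k i. k \<in> {1..m} \<Longrightarrow> n < k \<Longrightarrow> i \<in> I \<Longrightarrow> (\<Sum>j=1..m. v k j * a i j) = 0"
    by blast
  show ?thesis
  proof (intro bexI[OF _ orthonormal_rows_imp_unitary[OF v(1)]] ballI)
    fix k i assume "k \<in> {n<..m}" "i \<in> I"
    then show "(\<Sum>j=1..m. (case (k, j) of (k, j) \<Rightarrow> if k \<in> {1..m} \<and> j \<in> {1..m} then v k j else 0) * a i j) = 0"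
      using v(2)[of k i] by simp
  qed
qed

section \<open>Approximation in a multiplication model\<close>

lemma norm_L2_mult_tendsto_0:
  assumes g: "g \<in> L2 M" and b: "\<And>n. b n \<in> borel_measurable M"
    and bound: "\<And>n x. x \<in> space M \<Longrightarrow> norm (b n x) \<le> C"
    and lim: "\<And>x. x \<in> space M \<Longrightarrow> (\<lambda>n. b n x) \<longlonglongrightarrow> 0"
  shows "(\<lambda>n. norm_L2 M (\<lambda>x. b n x * g x)) \<longlonglongrightarrow> 0"
proof -
  have [measurable]: "g \<in> borel_measurable M" "\<And>n. b n \<in> borel_measurable M"
    using g b L2_measurable by auto
  have "(\<lambda>n. \<integral>x. (norm (b n x * g x))\<^sup>2 \<partial>M) \<longlonglongrightarrow> (\<integral>x. 0 \<partial>M)"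
  proof (rule integral_dominated_convergence)
    show "integrable M (\<lambda>x. C\<^sup>2 * (norm (g x))\<^sup>2)" using L2_integrable_sq[OF g] by simp
    show "AE x in M. (\<lambda>n. (norm (b n x * g x))\<^sup>2) \<longlonglongrightarrow> 0"
    proof (rule AE_I2)
      fix x assume "x \<in> space M"
      then have "(\<lambda>n. (norm (b n x * g x))\<^sup>2) \<longlonglongrightarrow> (norm (0 * g x))\<^sup>2"
        by (intro tendsto_intros lim)
      then show "(\<lambda>n. (norm (b n x * g x))\<^sup>2) \<longlonglongrightarrow> 0" by simp
    qed
    show "AE x in M. norm ((norm (b n x * g x))\<^sup>2) \<le> C\<^sup>2 * (norm (g x))\<^sup>2" for n
      using bound by (auto simp: norm_mult power_mult_distrib intro!: AE_I2 mult_right_mono power_mono)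
  qed auto
  then have "(\<lambda>n. sqrt (\<integral>x. (norm (b n x * g x))\<^sup>2 \<partial>M)) \<longlonglongrightarrow> sqrt (\<integral>x. 0 \<partial>M)"
    by (rule tendsto_real_sqrt)
  then show ?thesis by (simp add: norm_L2_def)
qed

lemma closed_subspace_L2_limit:
  assumes K: "closed_subspace_L2 M K" and "h \<in> L2 M" "\<And>n. k n \<in> K"
    and lim: "(\<lambda>n. norm_L2 M (h - k n)) \<longlonglongrightarrow> 0"
  shows "h \<in> K"
proof -
  have "\<exists>g\<in>K. norm_L2 M (h - g) < e" if e: "0 < e" for e
    using order_tendstoD(2)[OF lim e] assms(3) by (auto simp: eventually_sequentially)
  then show ?thesis using K \<open>h \<in> L2 M\<close> unfolding closed_subspace_L2_def closure_L2_def by blast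
qed

lemma closed_subspace_L2_AE:
  assumes K: "closed_subspace_L2 M K" and h: "h \<in> L2 M" and k: "k \<in> K" and eq: "AE x in M. h x = k x"
  shows "h \<in> K"
proof (rule closed_subspace_L2_limit[OF K h])
  have kL: "k \<in> L2 M" using K k by (auto simp: closed_subspace_L2_def)
  have "norm_L2 M (h - k) = norm_L2 M 0"
    using eq by (intro norm_L2_AE_cong L2_diff h kL L2_zero) auto
  then show "(\<lambda>n. norm_L2 M (h - k)) \<longlonglongrightarrow> 0" by (simp add: norm_L2_def zero_fun_def)
qed (rule k)

lemma closed_subspace_L2_sum:
  assumes K: "closed_subspace_L2 M K" and "\<And>i. i \<in> I \<Longrightarrow> h i \<in> K"
  shows "(\<lambda>x. \<Sum>i\<in>I. h i x) \<in> K"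
proof -
  have sub: "cfun.subspace K" using K by (simp add: closed_subspace_L2_def)
  show ?thesis using assms(2)
  proof (induction I rule: infinite_finite_induct)
    case (insert i I)
    then have "h i + (\<lambda>x. \<Sum>i\<in>I. h i x) \<in> K" by (intro cfun.subspace_add[OF sub]) auto
    with insert show ?case by (simp add: plus_fun_def)
  qed (use cfun.subspace_0[OF sub] in \<open>auto simp: zero_fun_def\<close>)
qed

locale unimodular_group = finite_measure M for M :: "'x measure" +
  fixes \<Gamma> :: "('x \<Rightarrow> complex) set"
  assumes measurable_\<Gamma>: "\<gamma> \<in> \<Gamma> \<Longrightarrow> \<gamma> \<in> borel_measurable M"
    and norm_\<Gamma>: "\<gamma> \<in> \<Gamma> \<Longrightarrow> x \<in> space M \<Longrightarrow> norm (\<gamma> x) = 1"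
    and one_\<Gamma>: "(\<lambda>_. 1) \<in> \<Gamma>"
    and mult_\<Gamma>: "\<gamma> \<in> \<Gamma> \<Longrightarrow> \<delta> \<in> \<Gamma> \<Longrightarrow> (\<lambda>x. \<gamma> x * \<delta> x) \<in> \<Gamma>"
    and cnj_\<Gamma>: "\<gamma> \<in> \<Gamma> \<Longrightarrow> (\<lambda>x. cnj (\<gamma> x)) \<in> \<Gamma>"
begin

text \<open>
  Half-plane preimages suffice to make the elements of \<open>\<Gamma>\<close> measurable, and their indicators are limits
  of polynomials in real and imaginary parts.
\<close>

definition generating_sets :: "'x set set" where
  "generating_sets = {{x \<in> space M. t < Re (\<gamma> x)} | t \<gamma>. \<gamma> \<in> \<Gamma>} \<union> {{x \<in> space M. t < Im (\<gamma> x)} | t \<gamma>. \<gamma> \<in> \<Gamma>}"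

definition F :: "'x measure" where
  "F = sigma (space M) generating_sets"

definition orbit_span :: "('x \<Rightarrow> complex) set \<Rightarrow> ('x \<Rightarrow> complex) set" where
  "orbit_span \<Phi> = cfun.span {(\<lambda>x. \<gamma> x * \<phi> x) | \<gamma> \<phi>. \<gamma> \<in> \<Gamma> \<and> \<phi> \<in> \<Phi>}"

lemma generating_sets_subset: "generating_sets \<subseteq> sets M"
proof
  fix A assume "A \<in> generating_sets"
  then obtain t \<gamma> where \<gamma>: "\<gamma> \<in> \<Gamma>" and A: "A = {x \<in> space M. t < Re (\<gamma> x)} \<or> A = {x \<in> space M. t < Im (\<gamma> x)}"
    unfolding generating_sets_def by blast
  have [measurable]: "\<gamma> \<in> borel_measurable M" using \<gamma> by (rule measurable_\<Gamma>)
  from A show "A \<in> sets M" by (rule disjE; simp)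
qed

lemma sets_F: "sets F = sigma_sets (space M) generating_sets"
  unfolding F_def by (rule sets_measure_of) (use generating_sets_subset sets.sets_into_space in blast)

lemma space_F: "space F = space M"
  unfolding F_def by (rule space_measure_of) (use generating_sets_subset sets.sets_into_space in blast)

lemma subalgebra_F: "subalgebra M F"
  unfolding subalgebra_def sets_F space_F
  using sets.sigma_sets_subset[OF generating_sets_subset] by simp

sublocale finite_measure_subalgebra M F
  by unfold_locales (rule subalgebra_F)

lemma measurable_F_M: "b \<in> borel_measurable F \<Longrightarrow> b \<in> borel_measurable M"
  by (rule measurable_from_subalg[OF subalgebra_F])

lemma measurable_F_\<Gamma>:
  assumes "\<gamma> \<in> \<Gamma>" shows "\<gamma> \<in> borel_measurable F"
  unfolding borel_measurable_complex_iff borel_measurable_iff_greater space_F sets_F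
  using assms by (auto intro!: sigma_sets.Basic simp: generating_sets_def)

lemma orbit_span_subset_L2:
  assumes "\<Phi> \<subseteq> L2 M" shows "orbit_span \<Phi> \<subseteq> L2 M"
  unfolding orbit_span_def
proof (rule cfun.span_minimal[OF _ subspace_L2], safe)
  fix \<gamma> \<phi> assume "\<gamma> \<in> \<Gamma>" "\<phi> \<in> \<Phi>"
  then show "(\<lambda>x. \<gamma> x * \<phi> x) \<in> L2 M"
    using assms measurable_\<Gamma> norm_\<Gamma> by (intro L2_bounded_mult[of _ _ _ 1]) auto
qed

lemma closed_subspace_orbit:
  "\<Phi> \<subseteq> L2 M \<Longrightarrow> closed_subspace_L2 M (closure_L2 M (orbit_span \<Phi>))"
  using orbit_span_subset_L2 by (intro closed_subspace_closure_L2) (auto simp: orbit_span_def)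

lemma generator_in_orbit:
  assumes "\<Phi> \<subseteq> L2 M" "\<phi> \<in> \<Phi>" shows "\<phi> \<in> closure_L2 M (orbit_span \<Phi>)"
proof (rule subsetD[OF closure_L2_superset[OF orbit_span_subset_L2[OF assms(1)]]])
  have "(\<lambda>x. 1 * \<phi> x) \<in> orbit_span \<Phi>"
    unfolding orbit_span_def
    by (intro cfun.span_base CollectI exI[of _ "\<lambda>_. 1"] exI[of _ \<phi>]) (use assms one_\<Gamma> in auto)
  then show "\<phi> \<in> orbit_span \<Phi>" by simp
qed

lemma orbit_span_invariant:
  assumes \<gamma>: "\<gamma> \<in> \<Gamma>" and q: "q \<in> orbit_span \<Phi>"
  shows "(\<lambda>x. \<gamma> x * q x) \<in> orbit_span \<Phi>"
  using q unfolding orbit_span_def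
proof (induction rule: cfun.span_induct_alt)
  case base
  have "(\<lambda>x. \<gamma> x * (0 :: 'x \<Rightarrow> complex) x) = 0" by (simp add: fun_eq_iff)
  then show ?case by (simp only: cfun.span_zero)
next
  case (step c \<psi> r)
  from step(1) obtain \<delta> \<phi> where \<delta>: "\<delta> \<in> \<Gamma>" "\<phi> \<in> \<Phi>" and \<psi>: "\<psi> = (\<lambda>x. \<delta> x * \<phi> x)" by blast
  have "(\<lambda>x. (\<gamma> x * \<delta> x) * \<phi> x) \<in> cfun.span {(\<lambda>x. \<gamma> x * \<phi> x) | \<gamma> \<phi>. \<gamma> \<in> \<Gamma> \<and> \<phi> \<in> \<Phi>}"
    by (intro cfun.span_base CollectI exI[of _ "\<lambda>x. \<gamma> x * \<delta> x"] exI[of _ \<phi>])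
      (use mult_\<Gamma>[OF \<gamma> \<delta>(1)] \<delta>(2) in auto)
  from cfun.span_add[OF cfun.span_scale[OF this, of c] step(2)]
  show ?case by (simp add: \<psi> plus_fun_def algebra_simps)
qed

lemma closure_orbit_invariant:
  assumes \<gamma>: "\<gamma> \<in> \<Gamma>" and \<Phi>: "\<Phi> \<subseteq> L2 M" and g: "g \<in> closure_L2 M (orbit_span \<Phi>)"
  shows "(\<lambda>x. \<gamma> x * g x) \<in> closure_L2 M (orbit_span \<Phi>)"
proof -
  have gL: "g \<in> L2 M" using g by (simp add: closure_L2_def)
  have mult: "(\<lambda>x. \<gamma> x * h x) \<in> L2 M" "norm_L2 M (\<lambda>x. \<gamma> x * h x) \<le> norm_L2 M h" if "h \<in> L2 M" for h
    using L2_bounded_mult[OF that measurable_\<Gamma>[OF \<gamma>], of 1] norm_L2_bounded_mult[OF that measurable_\<Gamma>[OF \<gamma>], of 1]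
    by (auto simp: norm_\<Gamma>[OF \<gamma>])
  have "\<exists>h\<in>orbit_span \<Phi>. norm_L2 M ((\<lambda>x. \<gamma> x * g x) - h) < e" if e: "0 < e" for e
  proof -
    obtain h where h: "h \<in> orbit_span \<Phi>" "norm_L2 M (g - h) < e"
      using closure_L2_approx[OF g e] by blast
    have hL: "h \<in> L2 M" using h(1) orbit_span_subset_L2[OF \<Phi>] by blast
    have "(\<lambda>x. \<gamma> x * g x) - (\<lambda>x. \<gamma> x * h x) = (\<lambda>x. \<gamma> x * (g - h) x)"
      by (simp add: fun_eq_iff algebra_simps)
    then have "norm_L2 M ((\<lambda>x. \<gamma> x * g x) - (\<lambda>x. \<gamma> x * h x)) < e"
      using mult(2)[OF L2_diff[OF gL hL]] h(2) by simp
    with orbit_span_invariant[OF \<gamma> h(1)] show ?thesis by blast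
  qed
  with mult(1)[OF gL] show ?thesis by (simp add: closure_L2_def)
qed

text \<open>
  The bounded multipliers of a closed invariant subspace \<open>K\<close> form an algebra that is closed under
  bounded pointwise limits. By the Weierstrass theorem this algebra contains the indicator
  of \<open>{t < r}\<close> for each of its real elements \<open>r\<close>, hence the indicators of all sets in the
  \<open>\<sigma>\<close>-algebra generated by \<open>\<Gamma>\<close>, and finally all bounded functions measurable for that \<open>\<sigma>\<close>-algebra.
\<close>

definition multipliers :: "('x \<Rightarrow> complex) set \<Rightarrow> ('x \<Rightarrow> complex) set" where
  "multipliers K = {b \<in> borel_measurable M. (\<exists>C. \<forall>x\<in>space M. norm (b x) \<le> C) \<and> (\<forall>g\<in>K. (\<lambda>x. b x * g x) \<in> K)}"

context
  fixes K assumes K: "closed_subspace_L2 M K"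
    and inv: "\<And>\<gamma> g. \<gamma> \<in> \<Gamma> \<Longrightarrow> g \<in> K \<Longrightarrow> (\<lambda>x. \<gamma> x * g x) \<in> K"
begin

lemma K_L2: "g \<in> K \<Longrightarrow> g \<in> L2 M" and K_subspace: "cfun.subspace K"
  using K by (auto simp: closed_subspace_L2_def)

lemma multipliersI:
  assumes "b \<in> borel_measurable M" "\<And>x. x \<in> space M \<Longrightarrow> norm (b x) \<le> C"
    "\<And>g. g \<in> K \<Longrightarrow> (\<lambda>x. b x * g x) \<in> K"
  shows "b \<in> multipliers K"
  unfolding multipliers_def mem_Collect_eq
  by (intro conjI exI[of _ C] ballI assms)

lemma multipliers_measurable: "b \<in> multipliers K \<Longrightarrow> b \<in> borel_measurable M"
  unfolding multipliers_def mem_Collect_eq by (rule conjunct1)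

lemma multipliers_apply: "b \<in> multipliers K \<Longrightarrow> g \<in> K \<Longrightarrow> (\<lambda>x. b x * g x) \<in> K"
  unfolding multipliers_def mem_Collect_eq by (elim conjE) (drule (1) bspec)

lemma multipliers_bounded_by:
  assumes "b \<in> multipliers K"
  obtains C where "\<And>x. x \<in> space M \<Longrightarrow> norm (b x) \<le> C"
  using assms unfolding multipliers_def mem_Collect_eq by (elim conjE exE) (rule that, erule bspec)

lemma multipliers_\<Gamma>: "\<gamma> \<in> \<Gamma> \<Longrightarrow> \<gamma> \<in> multipliers K"
  by (rule multipliersI[of _ 1]) (simp_all add: inv norm_\<Gamma> measurable_\<Gamma>)

lemma multipliers_const: "(\<lambda>_. c) \<in> multipliers K"
  by (rule multipliersI[of _ "norm c"]) (simp_all add: cfun.subspace_scale[OF K_subspace])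

lemma multipliers_mult:
  assumes b: "b \<in> multipliers K" and c: "c \<in> multipliers K" shows "(\<lambda>x. b x * c x) \<in> multipliers K"
proof -
  obtain B where B: "\<And>x. x \<in> space M \<Longrightarrow> norm (b x) \<le> B" using multipliers_bounded_by[OF b] by blast
  obtain C where C: "\<And>x. x \<in> space M \<Longrightarrow> norm (c x) \<le> C" using multipliers_bounded_by[OF c] by blast
  show ?thesis
  proof (rule multipliersI[of _ "B * C"])
    show "(\<lambda>x. b x * c x) \<in> borel_measurable M"
      by (intro borel_measurable_times multipliers_measurable b c)
    show "norm (b x * c x) \<le> B * C" if "x \<in> space M" for x
      unfolding norm_mult using norm_ge_zero[of "b x"] B[OF that] C[OF that]
      by (intro mult_mono norm_ge_zero) linarith+
    show "(\<lambda>x. b x * c x * g x) \<in> K" if "g \<in> K" for g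
      using multipliers_apply[OF b multipliers_apply[OF c that]] by (simp only: mult.assoc)
  qed
qed

lemma multipliers_add:
  assumes b: "b \<in> multipliers K" and c: "c \<in> multipliers K" shows "(\<lambda>x. b x + c x) \<in> multipliers K"
proof -
  obtain B where B: "\<And>x. x \<in> space M \<Longrightarrow> norm (b x) \<le> B" using multipliers_bounded_by[OF b] by blast
  obtain C where C: "\<And>x. x \<in> space M \<Longrightarrow> norm (c x) \<le> C" using multipliers_bounded_by[OF c] by blast
  show ?thesis
  proof (rule multipliersI[of _ "B + C"])
    show "(\<lambda>x. b x + c x) \<in> borel_measurable M"
      by (intro borel_measurable_add multipliers_measurable b c)
    show "norm (b x + c x) \<le> B + C" if "x \<in> space M" for x
      by (rule norm_triangle_mono[OF B[OF that] C[OF that]])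
    show "(\<lambda>x. (b x + c x) * g x) \<in> K" if "g \<in> K" for g
      using cfun.subspace_add[OF K_subspace multipliers_apply[OF b that] multipliers_apply[OF c that]]
      by (simp add: plus_fun_def distrib_right)
  qed
qed

lemma multipliers_scale: "b \<in> multipliers K \<Longrightarrow> (\<lambda>x. c * b x) \<in> multipliers K"
  by (rule multipliers_mult[OF multipliers_const])

lemma multipliers_limit:
  assumes b: "\<And>n::nat. b n \<in> multipliers K" and bound: "\<And>n x. x \<in> space M \<Longrightarrow> norm (b n x) \<le> C"
    and lim: "\<And>x. x \<in> space M \<Longrightarrow> (\<lambda>n. b n x) \<longlonglongrightarrow> c x"
  shows "c \<in> multipliers K"
proof -
  have bm: "b n \<in> borel_measurable M" for n by (rule multipliers_measurable[OF b])
  have cm: "c \<in> borel_measurable M" by (rule borel_measurable_LIMSEQ_metric[OF bm lim])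
  have cC: "norm (c x) \<le> C" if "x \<in> space M" for x
    by (rule LIMSEQ_le_const2[OF tendsto_norm[OF lim[OF that]]]) (use bound[OF that] in blast)
  have "(\<lambda>x. c x * g x) \<in> K" if g: "g \<in> K" for g
  proof (rule closed_subspace_L2_limit[OF K])
    show "(\<lambda>x. c x * g x) \<in> L2 M" by (rule L2_bounded_mult[OF K_L2[OF g] cm cC])
    show "(\<lambda>x. b n x * g x) \<in> K" for n by (rule multipliers_apply[OF b g])
    have "(\<lambda>n. norm_L2 M (\<lambda>x. (c x - b n x) * g x)) \<longlonglongrightarrow> 0"
    proof (rule norm_L2_mult_tendsto_0[OF K_L2[OF g]])
      show "(\<lambda>x. c x - b n x) \<in> borel_measurable M" for n using cm bm by (rule borel_measurable_diff)
      show "norm (c x - b n x) \<le> C + C" if "x \<in> space M" for n x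
        using norm_triangle_ineq4[of "c x" "b n x"] cC[OF that] bound[OF that, of n] by linarith
      show "(\<lambda>n. c x - b n x) \<longlonglongrightarrow> 0" if "x \<in> space M" for x
        using tendsto_diff[OF tendsto_const lim[OF that], of "c x"] by simp
    qed
    then show "(\<lambda>n. norm_L2 M ((\<lambda>x. c x * g x) - (\<lambda>x. b n x * g x))) \<longlonglongrightarrow> 0"
      by (simp add: fun_diff_def left_diff_distrib)
  qed
  then show ?thesis using cm cC by (intro multipliersI[of _ C])
qed

lemma multipliers_cong:
  assumes b: "b \<in> multipliers K" and "\<And>x. x \<in> space M \<Longrightarrow> c x = b x" shows "c \<in> multipliers K"
proof -
  obtain C where "\<And>x. x \<in> space M \<Longrightarrow> norm (b x) \<le> C" using multipliers_bounded_by[OF b] by blast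
  then show ?thesis
    by (rule multipliers_limit[OF b]) (simp_all add: assms(2))
qed

lemma multipliers_polynomial:
  assumes p: "real_polynomial_function p" and r: "(\<lambda>x. complex_of_real (r x)) \<in> multipliers K"
  shows "(\<lambda>x. complex_of_real (p (r x))) \<in> multipliers K"
  using p
proof (induction rule: real_polynomial_function.induct)
  case (linear p)
  then have "p y = p 1 * y" for y
    using linear_scale[OF bounded_linear.linear[OF linear], of y 1] by (simp add: mult.commute)
  then have "(\<lambda>x. complex_of_real (p (r x))) = (\<lambda>x. complex_of_real (p 1) * complex_of_real (r x))"
    by (metis of_real_mult)
  with multipliers_scale[OF r] show ?case by simp
next
  case (const c)
  show ?case by (rule multipliers_const)
next
  case (add p q)
  from multipliers_add[OF add.IH] show ?case by simp
next
  case (mult p q)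
  from multipliers_mult[OF mult.IH] show ?case by simp
qed

lemma multipliers_indicator_greater:
  assumes r: "(\<lambda>x. complex_of_real (r x)) \<in> multipliers K"
  shows "indicator {x \<in> space M. t < r x} \<in> multipliers K"
proof -
  obtain C where "\<And>x. x \<in> space M \<Longrightarrow> norm (complex_of_real (r x)) \<le> C"
    using multipliers_bounded_by[OF r] by blast
  then have C: "\<bar>r x\<bar> \<le> C" if "x \<in> space M" for x using that by simp
  define f where "f n y = min 1 (real n * max 0 (y - t))" for n :: nat and y
  have "\<exists>p. real_polynomial_function p \<and> (\<forall>y\<in>{-C..C}. \<bar>f n y - p y\<bar> < 1 / real (Suc n))" for n
  proof -
    have "continuous_on {-C..C} (f n)" unfolding f_def by (intro continuous_intros)
    then obtain p where "real_polynomial_function p" "\<And>y. y \<in> {-C..C} \<Longrightarrow> \<bar>f n y - p y\<bar> < 1 / real (Suc n)"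
      using Stone_Weierstrass_real_polynomial_function[OF compact_Icc, of "-C" C "f n" "1 / real (Suc n)"] by auto
    then show ?thesis by blast
  qed
  then obtain p where p: "\<And>n. real_polynomial_function (p n)"
    "\<And>n y. y \<in> {-C..C} \<Longrightarrow> \<bar>f n y - p n y\<bar> < 1 / real (Suc n)" by metis
  have pf: "\<bar>f n (r x) - p n (r x)\<bar> < 1 / real (Suc n)" if "x \<in> space M" for n x
    using p(2)[of "r x" n] C[OF that] by (auto simp: abs_le_iff)
  show ?thesis
  proof (rule multipliers_limit[of "\<lambda>n x. complex_of_real (p n (r x))" 2])
    show "(\<lambda>x. complex_of_real (p n (r x))) \<in> multipliers K" for n
      by (rule multipliers_polynomial[OF p(1) r])
    show "norm (complex_of_real (p n (r x))) \<le> 2" if "x \<in> space M" for n x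
    proof -
      have "1 / real (Suc n) \<le> 1" by simp
      moreover have "\<bar>f n (r x)\<bar> \<le> 1" by (auto simp: f_def)
      ultimately show ?thesis using pf[OF that, of n] unfolding norm_of_real by linarith
    qed
    show "(\<lambda>n. complex_of_real (p n (r x))) \<longlonglongrightarrow> indicator {x \<in> space M. t < r x} x" if x: "x \<in> space M" for x
    proof -
      have f_lim: "(\<lambda>n. f n (r x)) \<longlonglongrightarrow> indicator {x \<in> space M. t < r x} x"
      proof (cases "t < r x")
        case True
        obtain N where N: "1 < real N * (r x - t)" using reals_Archimedean3[of "r x - t"] True by auto
        have "f n (r x) = 1" if "n \<ge> N" for n
        proof -
          have "1 \<le> real n * (r x - t)"
            using N mult_right_mono[of "real N" "real n" "r x - t"] that True by linarith
          then show ?thesis using True by (simp add: f_def)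
        qed
        then have "\<forall>\<^sub>F n in sequentially. f n (r x) = indicator {x \<in> space M. t < r x} x"
          using True x by (auto simp: eventually_sequentially)
        then show ?thesis by (rule tendsto_eventually)
      qed (auto simp: f_def)
      have "(\<lambda>n. f n (r x) - p n (r x)) \<longlonglongrightarrow> 0"
      proof (rule Lim_null_comparison)
        show "\<forall>\<^sub>F n in sequentially. norm (f n (r x) - p n (r x)) \<le> inverse (real (Suc n))"
          using pf[OF x] by (auto intro!: always_eventually less_imp_le simp: inverse_eq_divide)
      qed (rule LIMSEQ_inverse_real_of_nat)
      from tendsto_diff[OF f_lim this] have "(\<lambda>n. p n (r x)) \<longlonglongrightarrow> indicator {x \<in> space M. t < r x} x" by simp
      then have "(\<lambda>n. complex_of_real (p n (r x))) \<longlonglongrightarrow> complex_of_real (indicator {x \<in> space M. t < r x} x)"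
        by (rule tendsto_of_real)
      moreover have "complex_of_real (indicator {x \<in> space M. t < r x} x) = indicator {x \<in> space M. t < r x} x"
        by (simp add: indicator_def)
      ultimately show ?thesis by simp
    qed
  qed
qed

lemma multipliers_indicator:
  assumes "A \<in> sets F" shows "indicator A \<in> multipliers K"
  using assms unfolding sets_F
proof (induction rule: sigma_sets.induct)
  case (Basic A)
  then obtain t \<gamma> where \<gamma>: "\<gamma> \<in> \<Gamma>" and A: "A = {x \<in> space M. t < Re (\<gamma> x)} \<or> A = {x \<in> space M. t < Im (\<gamma> x)}"
    unfolding generating_sets_def by blast
  have \<gamma>': "\<gamma> \<in> multipliers K" "(\<lambda>x. cnj (\<gamma> x)) \<in> multipliers K"
    using \<gamma> cnj_\<Gamma> multipliers_\<Gamma> by auto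
  have "(\<lambda>x. complex_of_real (Re (\<gamma> x))) \<in> multipliers K"
    using multipliers_scale[OF multipliers_add[OF \<gamma>'], of "1/2"] by (simp add: complex_add_cnj)
  note re = multipliers_indicator_greater[OF this]
  have "(\<lambda>x. complex_of_real (Im (\<gamma> x))) \<in> multipliers K"
    by (rule multipliers_cong[OF multipliers_scale[OF multipliers_add[OF \<gamma>'(1)
          multipliers_scale[OF \<gamma>'(2), of "-1"]], of "-\<i>/2"]])
      (simp add: complex_eq_iff)
  note im = multipliers_indicator_greater[OF this]
  from A show ?case by (elim disjE) (simp_all only: re im)
next
  case Empty
  then show ?case using multipliers_const[of 0] by simp
next
  case (Compl A)
  show ?case
    by (rule multipliers_cong[OF multipliers_add[OF multipliers_const[of 1] multipliers_scale[OF Compl.IH, of "-1"]]])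
      (auto simp: indicator_def)
next
  case (Union A)
  have prod: "(\<lambda>x. \<Prod>i<n. 1 + (-1) * indicator (A i) x) \<in> multipliers K" for n
  proof (induction n)
    case 0 show ?case using multipliers_const[of 1] by simp
  next
    case (Suc n)
    show ?case unfolding prod.lessThan_Suc
      by (intro multipliers_mult multipliers_add multipliers_const multipliers_scale Suc Union.IH)
  qed
  show ?case
  proof (rule multipliers_limit)
    show "(\<lambda>x. 1 + (-1) * (\<Prod>i<n. 1 + (-1) * indicator (A i) x)) \<in> multipliers K" for n
      by (intro multipliers_add multipliers_const multipliers_scale prod)
    have val: "1 + (-1) * (\<Prod>i<n. 1 + (-1) * indicator (A i) x) = (indicator (\<Union>i<n. A i) x :: complex)" for n x
      by (auto simp: indicator_def prod_zero_iff intro!: prod.neutral)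
    show "norm (1 + (-1) * (\<Prod>i<n. 1 + (-1) * indicator (A i) x) :: complex) \<le> 1" for n x
      unfolding val by (simp add: indicator_def)
    show "(\<lambda>n. 1 + (-1) * (\<Prod>i<n. 1 + (-1) * indicator (A i) x)) \<longlonglongrightarrow> (indicator (\<Union>i. A i) x :: complex)" for x
      unfolding val by (rule LIMSEQ_indicator_UN)
  qed
qed

lemma multipliers_nonneg:
  assumes "u \<in> borel_measurable F" "\<And>x. 0 \<le> u x" "\<And>x. x \<in> space M \<Longrightarrow> u x \<le> C"
  shows "(\<lambda>x. complex_of_real (u x)) \<in> multipliers K"
  using assms
proof (induction arbitrary: C rule: borel_measurable_induct_real)
  case (set A)
  have "(\<lambda>x. complex_of_real (indicator A x)) = indicator A" by (simp add: indicator_def fun_eq_iff)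
  then show ?case using multipliers_indicator[OF set(1)] by simp
next
  case (mult u c)
  show ?case
  proof (cases "c = 0")
    case True then show ?thesis using multipliers_const[of 0] by simp
  next
    case False
    then have "0 < c" using mult(1) by linarith
    have "u x \<le> C / c" if "x \<in> space M" for x
      using mult.prems[OF that] \<open>0 < c\<close> by (simp add: field_simps)
    then have "(\<lambda>x. complex_of_real (u x)) \<in> multipliers K" by (rule mult.IH)
    from multipliers_scale[OF this, of "complex_of_real c"] show ?thesis by (simp only: of_real_mult)
  qed
next
  case (add u v)
  have *: "u x \<le> C" "v x \<le> C" if "x \<in> space M" for x
    using add.prems[OF that] add(2)[of x] add(4)[of x] by linarith+
  have u: "(\<lambda>x. complex_of_real (u x)) \<in> multipliers K" using *(1) by (rule add.IH(1))
  have v: "(\<lambda>x. complex_of_real (v x)) \<in> multipliers K" using *(2) by (rule add.IH(2))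
  from multipliers_add[OF v u] show ?case by (simp only: of_real_add)
next
  case (seq U)
  have UC: "U i x \<le> C" if x: "x \<in> space M" for i x
  proof -
    have "(\<lambda>i. U i x) \<longlonglongrightarrow> u x" using seq(4)[of x] x by (simp only: space_F)
    moreover have "incseq (\<lambda>i. U i x)" using seq(3) by (simp add: incseq_def le_fun_def)
    ultimately have "U i x \<le> u x" by (intro incseq_le)
    then show ?thesis using seq.prems[OF x] by simp
  qed
  show ?case
  proof (rule multipliers_limit)
    show "(\<lambda>x. complex_of_real (U i x)) \<in> multipliers K" for i using UC by (rule seq.IH)
    show "norm (complex_of_real (U i x)) \<le> C" if "x \<in> space M" for i x
      using UC[OF that] seq(2)[of i x] by simp
    show "(\<lambda>i. complex_of_real (U i x)) \<longlonglongrightarrow> complex_of_real (u x)" if "x \<in> space M" for x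
      using seq(4)[of x] that by (intro tendsto_of_real) (simp only: space_F)
  qed
qed

lemma multipliers_bounded:
  assumes b: "b \<in> borel_measurable F" and C: "\<And>x. x \<in> space M \<Longrightarrow> norm (b x) \<le> C"
  shows "b \<in> multipliers K"
proof -
  have real: "(\<lambda>x. complex_of_real (u x)) \<in> multipliers K"
    if u: "u \<in> borel_measurable F" and uC: "\<And>x. x \<in> space M \<Longrightarrow> \<bar>u x\<bar> \<le> C" for u
  proof -
    have 1: "(\<lambda>x. complex_of_real (max 0 (u x))) \<in> multipliers K"
    proof (rule multipliers_nonneg)
      show "max 0 (u x) \<le> C" if "x \<in> space M" for x using uC[OF that] by auto
    qed (use u in auto)
    have 2: "(\<lambda>x. complex_of_real (max 0 (- u x))) \<in> multipliers K"
    proof (rule multipliers_nonneg)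
      show "max 0 (- u x) \<le> C" if "x \<in> space M" for x using uC[OF that] by auto
    qed (use u in auto)
    show ?thesis
      by (rule multipliers_cong[OF multipliers_add[OF 1 multipliers_scale[OF 2, of "-1"]]]) (auto simp: max_def)
  qed
  have "(\<lambda>x. complex_of_real (Re (b x))) \<in> multipliers K" "(\<lambda>x. complex_of_real (Im (b x))) \<in> multipliers K"
    using b C order_trans[OF abs_Re_le_cmod C] order_trans[OF abs_Im_le_cmod C]
    by (auto intro!: real simp: borel_measurable_complex_iff)
  from multipliers_cong[OF multipliers_add[OF this(1) multipliers_scale[OF this(2), of \<i>]]]
  show ?thesis by (simp add: complex_eq)
qed

lemma bounded_F_mult_closed:
  "b \<in> borel_measurable F \<Longrightarrow> (\<And>x. x \<in> space M \<Longrightarrow> norm (b x) \<le> C) \<Longrightarrow> g \<in> K \<Longrightarrow> (\<lambda>x. b x * g x) \<in> K"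
  by (rule multipliers_apply[OF multipliers_bounded])

end

end

lemma borel_measurable_entry:
  fixes U :: "'x \<Rightarrow> nat \<times> nat \<Rightarrow> complex"
  assumes "U \<in> borel_measurable N" shows "(\<lambda>x. U x p) \<in> borel_measurable N"
  using measurable_compose[OF assms borel_measurable_continuous_onI[OF continuous_on_product_coordinates]] .

lemma borel_measurable_cnj:
  "f \<in> borel_measurable N \<Longrightarrow> (\<lambda>x. cnj (f x)) \<in> borel_measurable N"
  by (rule measurable_compose[OF _ borel_measurable_continuous_onI]) (auto intro: continuous_intros)

context unimodular_group
begin

text \<open>
  The conditional expectations of \<open>f\<^sub>i\<close> times the conjugate of \<open>f\<^sub>j\<close>, split into real and imaginary parts,
  form the Gram matrix of the data in the fibres.
\<close>

definition gram_Re :: "(nat \<Rightarrow> 'x \<Rightarrow> complex) \<Rightarrow> nat \<Rightarrow> nat \<Rightarrow> 'x \<Rightarrow> real" where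
  "gram_Re f i j = real_cond_exp M F (\<lambda>x. Re (f i x * cnj (f j x)))"

definition gram_Im :: "(nat \<Rightarrow> 'x \<Rightarrow> complex) \<Rightarrow> nat \<Rightarrow> nat \<Rightarrow> 'x \<Rightarrow> real" where
  "gram_Im f i j = real_cond_exp M F (\<lambda>x. Im (f i x * cnj (f j x)))"

text \<open>
  The energy at \<open>x\<close> of the rotated data \<open>\<Sum>\<^sub>j u\<^sub>k\<^sub>j f\<^sub>j\<close> with \<open>k > n\<close>. Almost everywhere its minimum over the
  unitary matrices is the sum of the \<open>m - n\<close> smallest eigenvalues of the Gram matrix.
\<close>

definition tail_energy :: "(nat \<Rightarrow> 'x \<Rightarrow> complex) \<Rightarrow> nat \<Rightarrow> nat \<Rightarrow> 'x \<Rightarrow> (nat \<times> nat \<Rightarrow> complex) \<Rightarrow> real" where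
  "tail_energy f n m x u = (\<Sum>k\<in>{n<..m}. \<Sum>i=1..m. \<Sum>j=1..m.
     Re (u (k, i) * cnj (u (k, j))) * gram_Re f i j x - Im (u (k, i) * cnj (u (k, j))) * gram_Im f i j x)"

lemma integral_mult_cond_exp:
  assumes a: "a \<in> borel_measurable F" and bound: "\<And>x. x \<in> space M \<Longrightarrow> \<bar>a x\<bar> \<le> 1" and h: "integrable M h"
  shows "integrable M (\<lambda>x. a x * h x)" "integrable M (\<lambda>x. a x * real_cond_exp M F h x)"
    "(\<integral>x. a x * real_cond_exp M F h x \<partial>M) = (\<integral>x. a x * h x \<partial>M)"
proof -
  have hm: "h \<in> borel_measurable M" using h by (rule borel_measurable_integrable)
  show int: "integrable M (\<lambda>x. a x * h x)"
  proof (rule Bochner_Integration.integrable_bound[OF h])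
    show "(\<lambda>x. a x * h x) \<in> borel_measurable M"
      using measurable_F_M[OF a] hm by (rule borel_measurable_times)
    show "AE x in M. norm (a x * h x) \<le> norm (h x)"
    proof (rule AE_I2)
      fix x assume "x \<in> space M"
      then show "norm (a x * h x) \<le> norm (h x)"
        using mult_right_mono[OF bound abs_ge_zero, of x "h x"] by (simp add: abs_mult)
    qed
  qed
  show "integrable M (\<lambda>x. a x * real_cond_exp M F h x)"
    "(\<integral>x. a x * real_cond_exp M F h x \<partial>M) = (\<integral>x. a x * h x \<partial>M)"
    by (rule real_cond_exp_intg[OF int a hm])+
qed

text \<open>
  Expanding the squared norm gives products of \<open>f\<^sub>i\<close> and the conjugate of \<open>f\<^sub>j\<close> with \<open>F\<close>-measurable coefficients
  of modulus at most one; under the integral such products may be replaced by their conditional expectations.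
\<close>

lemma tail_energy_integral:
  assumes f: "\<And>j. j \<in> {1..m} \<Longrightarrow> f j \<in> L2 M"
    and U: "U \<in> borel_measurable F" "\<And>x. x \<in> space M \<Longrightarrow> U x \<in> unitary_matrices m"
  shows "integrable M (\<lambda>x. tail_energy f n m x (U x))"
    and "(\<integral>x. tail_energy f n m x (U x) \<partial>M)
       = (\<Sum>k\<in>{n<..m}. (norm_L2 M (\<lambda>x. \<Sum>j=1..m. U x (k, j) * f j x))\<^sup>2)"
proof -
  define c where "c k i j x = U x (k, i) * cnj (U x (k, j))" for k i j x
  define h where "h i j x = f i x * cnj (f j x)" for i j x
  have cm: "c k i j \<in> borel_measurable F" for k i j
    unfolding c_def by (intro borel_measurable_times borel_measurable_cnj borel_measurable_entry U)
  have cRe: "(\<lambda>x. Re (c k i j x)) \<in> borel_measurable F" and cIm: "(\<lambda>x. Im (c k i j x)) \<in> borel_measurable F" for k i j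
    using cm[of k i j] unfolding borel_measurable_complex_iff by auto
  have c1: "norm (c k i j x) \<le> 1" if "x \<in> space M" for k i j x
    unfolding c_def norm_mult complex_mod_cnj
    using unitary_matrices_norm_le[OF U(2)[OF that], of "(k, i)"] unitary_matrices_norm_le[OF U(2)[OF that], of "(k, j)"]
    by (intro mult_le_one) auto
  have c2: "\<bar>Re (c k i j x)\<bar> \<le> 1" "\<bar>Im (c k i j x)\<bar> \<le> 1" if "x \<in> space M" for k i j x
    using c1[OF that, of k i j] abs_Re_le_cmod[of "c k i j x"] abs_Im_le_cmod[of "c k i j x"] by linarith+
  have hi: "integrable M (\<lambda>x. Re (h i j x))" "integrable M (\<lambda>x. Im (h i j x))" if "i \<in> {1..m}" "j \<in> {1..m}" for i j
    using L2_integrable_mult_cnj[OF f[OF that(1)] f[OF that(2)]] unfolding h_def by (rule integrable_Re, rule integrable_Im)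
  note RE = integral_mult_cond_exp[OF cRe c2(1) hi(1)] and IM = integral_mult_cond_exp[OF cIm c2(2) hi(2)]
  define A where "A k i j x = Re (c k i j x) * gram_Re f i j x - Im (c k i j x) * gram_Im f i j x" for k i j x
  have Ai: "integrable M (A k i j)" if "i \<in> {1..m}" "j \<in> {1..m}" for k i j
    unfolding A_def gram_Re_def gram_Im_def h_def[symmetric]
    by (intro Bochner_Integration.integrable_diff RE(2)[OF _ that] IM(2)[OF _ that])
  have Bi: "integrable M (\<lambda>x. Re (c k i j x * h i j x))" if "i \<in> {1..m}" "j \<in> {1..m}" for k i j
    unfolding times_complex.sel
    by (intro Bochner_Integration.integrable_diff RE(1)[OF _ that] IM(1)[OF _ that])
  have AB: "(\<integral>x. A k i j x \<partial>M) = (\<integral>x. Re (c k i j x * h i j x) \<partial>M)" if "i \<in> {1..m}" "j \<in> {1..m}" for k i j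
  proof -
    have "(\<integral>x. A k i j x \<partial>M) = (\<integral>x. Re (c k i j x) * gram_Re f i j x \<partial>M) - (\<integral>x. Im (c k i j x) * gram_Im f i j x \<partial>M)"
      unfolding A_def gram_Re_def gram_Im_def h_def[symmetric]
      by (intro Bochner_Integration.integral_diff RE(2)[OF _ that] IM(2)[OF _ that])
    also have "\<dots> = (\<integral>x. Re (c k i j x) * Re (h i j x) \<partial>M) - (\<integral>x. Im (c k i j x) * Im (h i j x) \<partial>M)"
      unfolding gram_Re_def gram_Im_def h_def[symmetric] using RE(3)[OF _ that] IM(3)[OF _ that] by simp
    also have "\<dots> = (\<integral>x. Re (c k i j x * h i j x) \<partial>M)"
      unfolding times_complex.sel
      by (intro Bochner_Integration.integral_diff[symmetric] RE(1)[OF _ that] IM(1)[OF _ that])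
    finally show ?thesis .
  qed
  have te: "tail_energy f n m x (U x) = (\<Sum>k\<in>{n<..m}. \<Sum>i=1..m. \<Sum>j=1..m. A k i j x)" for x
    unfolding tail_energy_def A_def c_def ..
  show "integrable M (\<lambda>x. tail_energy f n m x (U x))"
    unfolding te by (intro Bochner_Integration.integrable_sum Ai)
  have sq: "(norm (\<Sum>j=1..m. U x (k, j) * f j x))\<^sup>2 = (\<Sum>i=1..m. \<Sum>j=1..m. Re (c k i j x * h i j x))" for k x
  proof -
    have "complex_of_real ((norm (\<Sum>j=1..m. U x (k, j) * f j x))\<^sup>2)
        = (\<Sum>i=1..m. U x (k, i) * f i x) * (\<Sum>j=1..m. cnj (U x (k, j)) * cnj (f j x))"
      unfolding complex_norm_square cnj_sum complex_cnj_mult ..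
    also have "\<dots> = (\<Sum>i=1..m. \<Sum>j=1..m. c k i j x * h i j x)"
      unfolding sum_product c_def h_def by (intro sum.cong refl) (simp only: mult_ac)
    finally have "Re (complex_of_real ((norm (\<Sum>j=1..m. U x (k, j) * f j x))\<^sup>2)) = Re (\<Sum>i=1..m. \<Sum>j=1..m. c k i j x * h i j x)"
      by (rule arg_cong)
    then show ?thesis unfolding Re_complex_of_real Re_sum .
  qed
  have swap: "(\<integral>x. (\<Sum>k\<in>{n<..m}. \<Sum>i=1..m. \<Sum>j=1..m. B k i j x) \<partial>M) = (\<Sum>k\<in>{n<..m}. \<Sum>i=1..m. \<Sum>j=1..m. \<integral>x. B k i j x \<partial>M)"
    if B: "\<And>k i j. i \<in> {1..m} \<Longrightarrow> j \<in> {1..m} \<Longrightarrow> integrable M (B k i j)" for B :: "nat \<Rightarrow> nat \<Rightarrow> nat \<Rightarrow> 'x \<Rightarrow> real"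
  proof -
    have "(\<integral>x. (\<Sum>k\<in>{n<..m}. \<Sum>i=1..m. \<Sum>j=1..m. B k i j x) \<partial>M) = (\<Sum>k\<in>{n<..m}. \<integral>x. (\<Sum>i=1..m. \<Sum>j=1..m. B k i j x) \<partial>M)"
      by (intro Bochner_Integration.integral_sum Bochner_Integration.integrable_sum B)
    also have "\<dots> = (\<Sum>k\<in>{n<..m}. \<Sum>i=1..m. \<integral>x. (\<Sum>j=1..m. B k i j x) \<partial>M)"
      by (intro sum.cong refl Bochner_Integration.integral_sum Bochner_Integration.integrable_sum B)
    also have "\<dots> = (\<Sum>k\<in>{n<..m}. \<Sum>i=1..m. \<Sum>j=1..m. \<integral>x. B k i j x \<partial>M)"
      by (intro sum.cong refl Bochner_Integration.integral_sum B)
    finally show ?thesis .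
  qed
  have "(\<integral>x. tail_energy f n m x (U x) \<partial>M) = (\<Sum>k\<in>{n<..m}. \<Sum>i=1..m. \<Sum>j=1..m. \<integral>x. A k i j x \<partial>M)"
    unfolding te by (rule swap[OF Ai])
  also have "\<dots> = (\<Sum>k\<in>{n<..m}. \<Sum>i=1..m. \<Sum>j=1..m. \<integral>x. Re (c k i j x * h i j x) \<partial>M)"
    by (intro sum.cong refl AB)
  also have "\<dots> = (\<integral>x. (\<Sum>k\<in>{n<..m}. \<Sum>i=1..m. \<Sum>j=1..m. Re (c k i j x * h i j x)) \<partial>M)"
    by (rule swap[OF Bi, symmetric])
  also have "\<dots> = (\<Sum>k\<in>{n<..m}. \<integral>x. (\<Sum>i=1..m. \<Sum>j=1..m. Re (c k i j x * h i j x)) \<partial>M)"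
    by (intro Bochner_Integration.integral_sum Bochner_Integration.integrable_sum Bi)
  also have "\<dots> = (\<Sum>k\<in>{n<..m}. (norm_L2 M (\<lambda>x. \<Sum>j=1..m. U x (k, j) * f j x))\<^sup>2)"
    unfolding norm_L2_sq sq ..
  finally show "(\<integral>x. tail_energy f n m x (U x) \<partial>M)
       = (\<Sum>k\<in>{n<..m}. (norm_L2 M (\<lambda>x. \<Sum>j=1..m. U x (k, j) * f j x))\<^sup>2)" .
qed

lemma measurable_unitary_argmin:
  fixes \<theta> :: "'x \<Rightarrow> (nat \<times> nat \<Rightarrow> complex) \<Rightarrow> real"
  assumes "\<And>u. (\<lambda>x. \<theta> x u) \<in> borel_measurable F" "\<And>x. continuous_on (unitary_matrices m) (\<theta> x)"
  obtains U where "U \<in> borel_measurable F" "\<And>x. x \<in> space M \<Longrightarrow> U x \<in> unitary_matrices m"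
    "\<And>x u. x \<in> space M \<Longrightarrow> u \<in> unitary_matrices m \<Longrightarrow> \<theta> x (U x) \<le> \<theta> x u"
proof -
  have ne: "unitary_matrices m \<noteq> {}"
    using ex_unitary_with_kernel_rows[of "{} :: nat set" 0 m "\<lambda>_ _. 0"] by (auto simp del: ex_in_conv)
  obtain U where "U \<in> borel_measurable F" "\<And>x. x \<in> space F \<Longrightarrow> U x \<in> unitary_matrices m"
    "\<And>x u. x \<in> space F \<Longrightarrow> u \<in> unitary_matrices m \<Longrightarrow> \<theta> x (U x) \<le> \<theta> x u"
    by (rule measurable_argmin[OF compact_unitary_matrices, of m \<theta> F, OF ne assms]) blast
  then show ?thesis by (intro that[of U]) (simp_all add: space_F)
qed

lemma bounded_F_mult_orbit:
  assumes \<Phi>: "\<Phi> \<subseteq> L2 M" and b: "b \<in> borel_measurable F" "\<And>x. x \<in> space M \<Longrightarrow> norm (b x) \<le> C"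
    and g: "g \<in> closure_L2 M (orbit_span \<Phi>)"
  shows "(\<lambda>x. b x * g x) \<in> closure_L2 M (orbit_span \<Phi>)"
  by (rule bounded_F_mult_closed[OF closed_subspace_orbit[OF \<Phi>] _ b g])
    (rule closure_orbit_invariant[OF _ \<Phi>])

lemma sum_norm_L2_sq_mono:
  assumes "\<And>k. k \<in> A \<Longrightarrow> g k \<in> L2 M" "\<And>j. j \<in> B \<Longrightarrow> h j \<in> L2 M"
    and "\<And>x. x \<in> space M \<Longrightarrow> (\<Sum>k\<in>A. (norm (g k x))\<^sup>2) \<le> (\<Sum>j\<in>B. (norm (h j x))\<^sup>2)"
  shows "(\<Sum>k\<in>A. (norm_L2 M (g k))\<^sup>2) \<le> (\<Sum>j\<in>B. (norm_L2 M (h j))\<^sup>2)"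
proof -
  have "(\<Sum>k\<in>A. (norm_L2 M (g k))\<^sup>2) = (\<integral>x. (\<Sum>k\<in>A. (norm (g k x))\<^sup>2) \<partial>M)"
    unfolding norm_L2_sq by (intro Bochner_Integration.integral_sum[symmetric] L2_integrable_sq assms(1))
  also have "\<dots> \<le> (\<integral>x. (\<Sum>j\<in>B. (norm (h j x))\<^sup>2) \<partial>M)"
    by (intro integral_mono Bochner_Integration.integrable_sum L2_integrable_sq assms)
  also have "\<dots> = (\<Sum>j\<in>B. (norm_L2 M (h j))\<^sup>2)"
    unfolding norm_L2_sq by (intro Bochner_Integration.integral_sum L2_integrable_sq assms(2))
  finally show ?thesis .
qed

lemma unitary_combination_L2:
  assumes "\<And>j. j \<in> {1..m} \<Longrightarrow> f j \<in> L2 M" "U \<in> borel_measurable F" "\<And>x. x \<in> space M \<Longrightarrow> U x \<in> unitary_matrices m"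
  shows "(\<lambda>x. \<Sum>j=1..m. U x (k, j) * f j x) \<in> L2 M"
proof (rule L2_sum)
  show "(\<lambda>x. U x (k, j) * f j x) \<in> L2 M" if "j \<in> {1..m}" for j
    by (rule L2_bounded_mult[OF assms(1)[OF that] measurable_F_M[OF borel_measurable_entry[OF assms(2)]], of _ 1])
      (rule unitary_matrices_norm_le[OF assms(3)])
qed

text \<open>
  The coefficients are linear combinations of elements of \<open>\<Gamma>\<close> and therefore measurable for \<open>F\<close>.
\<close>

lemma orbit_span_coefficients:
  assumes \<Phi>: "finite \<Phi>" and q: "q \<in> orbit_span \<Phi>"
  shows "\<exists>a. (\<forall>\<phi>. a \<phi> \<in> borel_measurable F) \<and> q = (\<lambda>x. \<Sum>\<phi>\<in>\<Phi>. a \<phi> x * \<phi> x)"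
  using q unfolding orbit_span_def
proof (induction rule: cfun.span_induct_alt)
  case base
  show ?case by (intro exI[of _ "\<lambda>_ _. 0"]) (simp add: zero_fun_def)
next
  case (step c \<psi> r)
  from step(1) obtain \<gamma> \<phi>' where \<gamma>: "\<gamma> \<in> \<Gamma>" "\<phi>' \<in> \<Phi>" and \<psi>: "\<psi> = (\<lambda>x. \<gamma> x * \<phi>' x)" by blast
  from step(2) obtain a where a: "\<And>\<phi>. a \<phi> \<in> borel_measurable F" and r: "r = (\<lambda>x. \<Sum>\<phi>\<in>\<Phi>. a \<phi> x * \<phi> x)" by blast
  define b where "b \<phi> x = (if \<phi> = \<phi>' then c * \<gamma> x else 0) + a \<phi> x" for \<phi> x
  have "b \<phi> \<in> borel_measurable F" for \<phi>
    unfolding b_def using measurable_F_\<Gamma>[OF \<gamma>(1)] a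
    by (cases "\<phi> = \<phi>'") (simp_all add: borel_measurable_add borel_measurable_times)
  moreover have "(\<Sum>\<phi>\<in>\<Phi>. b \<phi> x * \<phi> x) = c * (\<gamma> x * \<phi>' x) + (\<Sum>\<phi>\<in>\<Phi>. a \<phi> x * \<phi> x)" for x
  proof -
    have "(\<Sum>\<phi>\<in>\<Phi>. b \<phi> x * \<phi> x) = (\<Sum>\<phi>\<in>\<Phi>. (if \<phi> = \<phi>' then c * \<gamma> x * \<phi> x else 0) + a \<phi> x * \<phi> x)"
      unfolding b_def by (intro sum.cong refl) (simp add: distrib_right)
    also have "\<dots> = (\<Sum>\<phi>\<in>\<Phi>. if \<phi> = \<phi>' then c * \<gamma> x * \<phi> x else 0) + (\<Sum>\<phi>\<in>\<Phi>. a \<phi> x * \<phi> x)"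
      by (rule sum.distrib)
    also have "(\<Sum>\<phi>\<in>\<Phi>. if \<phi> = \<phi>' then c * \<gamma> x * \<phi> x else 0) = c * \<gamma> x * \<phi>' x"
      using \<Phi> \<gamma>(2) by simp
    finally show ?thesis by (simp only: mult.assoc)
  qed
  ultimately show ?case unfolding \<psi> r by (intro exI[of _ b]) (simp add: plus_fun_def)
qed

text \<open>
  Rotating the data at each point by a measurable unitary matrix \<open>U\<close> that minimises the tail energy
  gives \<open>g\<^sub>1, \<dots>, g\<^sub>m\<close>. The first \<open>n\<close> of them generate the optimal space: the functions \<open>q\<^sub>j\<close> obtained by rotating
  only the components \<open>k \<le> n\<close> back leave an error of at most \<open>\<Sum>\<^sub>k\<^sub>>\<^sub>n \<parallel>g\<^sub>k\<parallel>\<^sup>2\<close>. Conversely, let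
  \<open>p\<^sub>j\<close> be combinations of \<open>n\<close> functions with \<open>F\<close>-measurable coefficients. At each point these coefficients
  form a matrix with \<open>m\<close> columns and \<open>n\<close> rows, so some unitary \<open>V\<close> has its last \<open>m - n\<close> rows orthogonal
  to them. Then \<open>\<Sum>\<^sub>j V\<^sub>k\<^sub>j f\<^sub>j = \<Sum>\<^sub>j V\<^sub>k\<^sub>j (f\<^sub>j - p\<^sub>j)\<close> for \<open>k > n\<close>, and the tail energy of \<open>V\<close>, which is at least
  that of \<open>U\<close>, is at most \<open>\<Sum>\<^sub>j \<parallel>f\<^sub>j - p\<^sub>j\<parallel>\<^sup>2\<close> by Bessel's inequality.
\<close>

theorem ex_optimal_generators:
  fixes f :: "nat \<Rightarrow> 'x \<Rightarrow> complex"
  assumes f: "\<And>j. j \<in> {1..m} \<Longrightarrow> f j \<in> L2 M" and nm: "n \<le> m"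
  obtains g q where
    "\<And>k. g k \<in> closure_L2 M (orbit_span (f ` {1..m}))"
    "\<And>j. j \<in> {1..m} \<Longrightarrow> q j \<in> closure_L2 M (orbit_span (g ` {1..n}))"
    "\<And>\<Phi> p. finite \<Phi> \<Longrightarrow> card \<Phi> \<le> n \<Longrightarrow> \<Phi> \<subseteq> L2 M \<Longrightarrow> (\<And>j. j \<in> {1..m} \<Longrightarrow> p j \<in> orbit_span \<Phi>) \<Longrightarrow>
       (\<Sum>j=1..m. (norm_L2 M (f j - q j))\<^sup>2) \<le> (\<Sum>j=1..m. (norm_L2 M (f j - p j))\<^sup>2)"
proof -
  have coord: "continuous_on A (\<lambda>u::nat \<times> nat \<Rightarrow> complex. u p)" for A p
    by (rule continuous_on_subset[OF continuous_on_product_coordinates]) simp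
  obtain U where U: "U \<in> borel_measurable F" "\<And>x. x \<in> space M \<Longrightarrow> U x \<in> unitary_matrices m"
    and min: "\<And>x u. x \<in> space M \<Longrightarrow> u \<in> unitary_matrices m \<Longrightarrow> tail_energy f n m x (U x) \<le> tail_energy f n m x u"
  proof (rule measurable_unitary_argmin[of "tail_energy f n m"])
    show "(\<lambda>x. tail_energy f n m x u) \<in> borel_measurable F" for u
      unfolding tail_energy_def gram_Re_def gram_Im_def by measurable
    show "continuous_on (unitary_matrices m) (tail_energy f n m x)" for x
      unfolding tail_energy_def by (intro continuous_intros coord)
  qed blast
  define g where "g k = (\<lambda>x. \<Sum>j=1..m. U x (k, j) * f j x)" for k
  define q where "q j = (\<lambda>x. \<Sum>k\<in>{1..n}. cnj (U x (k, j)) * g k x)" for j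
  have Um: "(\<lambda>x. U x p) \<in> borel_measurable F" "(\<lambda>x. cnj (U x p)) \<in> borel_measurable F" for p
    using borel_measurable_entry[OF U(1)] borel_measurable_cnj by blast+
  have U1: "norm (U x p) \<le> 1" "norm (cnj (U x p)) \<le> 1" if "x \<in> space M" for x p
    using unitary_matrices_norm_le[OF U(2)[OF that]] by simp_all
  have fL: "f ` {1..m} \<subseteq> L2 M" using f by blast
  have gK: "g k \<in> closure_L2 M (orbit_span (f ` {1..m}))" for k
    unfolding g_def
    by (intro closed_subspace_L2_sum[OF closed_subspace_orbit[OF fL]]
        bounded_F_mult_orbit[OF fL Um(1) U1(1)] generator_in_orbit[OF fL] imageI)
  have gL: "g k \<in> L2 M" for k using gK by (simp add: closure_L2_def)
  then have gL': "g ` {1..n} \<subseteq> L2 M" by blast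
  have qK: "q j \<in> closure_L2 M (orbit_span (g ` {1..n}))" for j
    unfolding q_def
    by (intro closed_subspace_L2_sum[OF closed_subspace_orbit[OF gL']]
        bounded_F_mult_orbit[OF gL' Um(2) U1(2)] generator_in_orbit[OF gL'] imageI)
  have qL: "q j \<in> L2 M" for j using qK by (simp add: closure_L2_def)
  have sub: "{n<..m} \<subseteq> {1..m}" by auto
  have residual: "(\<Sum>j=1..m. (norm_L2 M (f j - q j))\<^sup>2) \<le> (\<Sum>k\<in>{n<..m}. (norm_L2 M (g k))\<^sup>2)"
  proof (rule sum_norm_L2_sq_mono)
    show "f j - q j \<in> L2 M" if "j \<in> {1..m}" for j by (rule L2_diff[OF f[OF that] qL])
    show "g k \<in> L2 M" for k by (rule gL)
    fix x assume x: "x \<in> space M"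
    have diff: "(f j - q j) x = (\<Sum>k\<in>{n<..m}. cnj (U x (k, j)) * g k x)" if "j \<in> {1..m}" for j
    proof -
      have "f j x = (\<Sum>k=1..m. cnj (U x (k, j)) * g k x)"
        unfolding g_def using unitary_reconstruct[OF U(2)[OF x] that, of "\<lambda>j. f j x"] by (rule sym)
      also have "{1..m} = {1..n} \<union> {n<..m}" using nm by auto
      also have "(\<Sum>k\<in>{1..n} \<union> {n<..m}. cnj (U x (k, j)) * g k x) = q j x + (\<Sum>k\<in>{n<..m}. cnj (U x (k, j)) * g k x)"
        unfolding q_def by (intro sum.union_disjoint) auto
      finally show ?thesis by simp
    qed
    have "(\<Sum>j=1..m. (norm ((f j - q j) x))\<^sup>2) = (\<Sum>j=1..m. (norm (\<Sum>k\<in>{n<..m}. cnj (U x (k, j)) * g k x))\<^sup>2)"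
      by (intro sum.cong refl) (simp only: diff)
    also have "\<dots> = (\<Sum>k\<in>{n<..m}. (norm (g k x))\<^sup>2)"
      by (rule unitary_adjoint_isometry[OF U(2)[OF x] sub])
    finally show "(\<Sum>j=1..m. (norm ((f j - q j) x))\<^sup>2) \<le> (\<Sum>k\<in>{n<..m}. (norm (g k x))\<^sup>2)" by simp
  qed
  have optimal: "(\<Sum>j=1..m. (norm_L2 M (f j - q j))\<^sup>2) \<le> (\<Sum>j=1..m. (norm_L2 M (f j - p j))\<^sup>2)"
    if \<Phi>: "finite \<Phi>" "card \<Phi> \<le> n" "\<Phi> \<subseteq> L2 M" and p: "\<And>j. j \<in> {1..m} \<Longrightarrow> p j \<in> orbit_span \<Phi>" for \<Phi> p
  proof -
    have pL: "p j \<in> L2 M" if "j \<in> {1..m}" for j using p[OF that] orbit_span_subset_L2[OF \<Phi>(3)] by blast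
    have "\<forall>j\<in>{1..m}. \<exists>a. (\<forall>\<phi>. a \<phi> \<in> borel_measurable F) \<and> p j = (\<lambda>x. \<Sum>\<phi>\<in>\<Phi>. a \<phi> x * \<phi> x)"
      using orbit_span_coefficients[OF \<Phi>(1) p] by blast
    from bchoice[OF this] obtain a where a: "\<forall>j\<in>{1..m}. (\<forall>\<phi>. a j \<phi> \<in> borel_measurable F) \<and> p j = (\<lambda>x. \<Sum>\<phi>\<in>\<Phi>. a j \<phi> x * \<phi> x)" ..
    then have am: "\<And>j \<phi>. j \<in> {1..m} \<Longrightarrow> a j \<phi> \<in> borel_measurable F"
      and pa: "\<And>j x. j \<in> {1..m} \<Longrightarrow> p j x = (\<Sum>\<phi>\<in>\<Phi>. a j \<phi> x * \<phi> x)" by simp_all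
    \<comment> \<open>The unitary matrices with suitable last rows are the zeros of \<open>\<theta>\<close>, so a measurable minimiser picks one.\<close>
    define \<theta> where "\<theta> x u = (\<Sum>k\<in>{n<..m}. \<Sum>\<phi>\<in>\<Phi>. (norm (\<Sum>j=1..m. u (k, j) * a j \<phi> x))\<^sup>2)" for x and u :: "nat \<times> nat \<Rightarrow> complex"
    obtain V where V: "V \<in> borel_measurable F" "\<And>x. x \<in> space M \<Longrightarrow> V x \<in> unitary_matrices m"
      and Vmin: "\<And>x u. x \<in> space M \<Longrightarrow> u \<in> unitary_matrices m \<Longrightarrow> \<theta> x (V x) \<le> \<theta> x u"
    proof (rule measurable_unitary_argmin[of \<theta>])
      show "(\<lambda>x. \<theta> x u) \<in> borel_measurable F" for u
        unfolding \<theta>_def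
        by (intro borel_measurable_sum borel_measurable_power measurable_compose[OF _ borel_measurable_norm] borel_measurable_times
            borel_measurable_const am)
      show "continuous_on (unitary_matrices m) (\<theta> x)" for x
        unfolding \<theta>_def by (intro continuous_intros coord)
    qed blast
    have kill: "(\<Sum>j=1..m. V x (k, j) * a j \<phi> x) = 0" if x: "x \<in> space M" and k: "k \<in> {n<..m}" and \<phi>: "\<phi> \<in> \<Phi>" for x k \<phi>
    proof -
      obtain u where u: "u \<in> unitary_matrices m" "\<And>k \<phi>. k \<in> {n<..m} \<Longrightarrow> \<phi> \<in> \<Phi> \<Longrightarrow> (\<Sum>j=1..m. u (k, j) * a j \<phi> x) = 0"
        using ex_unitary_with_kernel_rows[OF \<Phi>(1,2), of m "\<lambda>\<phi> j. a j \<phi> x"] by blast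
      have "\<theta> x u = 0" unfolding \<theta>_def using u(2) by simp
      with Vmin[OF x u(1)] have "\<theta> x (V x) \<le> 0" by simp
      moreover have "(norm (\<Sum>j=1..m. V x (k, j) * a j \<phi> x))\<^sup>2 \<le> (\<Sum>\<phi>\<in>\<Phi>. (norm (\<Sum>j=1..m. V x (k, j) * a j \<phi> x))\<^sup>2)"
        by (rule member_le_sum[OF \<phi> _ \<Phi>(1)]) simp
      moreover have "\<dots> \<le> \<theta> x (V x)" unfolding \<theta>_def
        by (rule member_le_sum[OF k]) (auto intro: sum_nonneg)
      ultimately have "(norm (\<Sum>j=1..m. V x (k, j) * a j \<phi> x))\<^sup>2 \<le> 0" by linarith
      then show ?thesis by simp
    qed
    have same: "(\<Sum>j=1..m. V x (k, j) * (f j - p j) x) = (\<Sum>j=1..m. V x (k, j) * f j x)"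
      if x: "x \<in> space M" and k: "k \<in> {n<..m}" for x k
    proof -
      have "(\<Sum>j=1..m. V x (k, j) * p j x) = (\<Sum>j=1..m. \<Sum>\<phi>\<in>\<Phi>. V x (k, j) * a j \<phi> x * \<phi> x)"
        by (intro sum.cong refl) (simp only: pa sum_distrib_left mult.assoc)
      also have "\<dots> = (\<Sum>\<phi>\<in>\<Phi>. (\<Sum>j=1..m. V x (k, j) * a j \<phi> x) * \<phi> x)"
        unfolding sum_distrib_right by (rule sum.swap)
      also have "\<dots> = 0" using kill[OF x k] by (intro sum.neutral ballI) (simp only: mult_zero_left)
      finally have "(\<Sum>j=1..m. V x (k, j) * p j x) = 0" .
      then show ?thesis by (simp add: right_diff_distrib sum_subtractf)
    qed
    have "(\<Sum>k\<in>{n<..m}. (norm_L2 M (g k))\<^sup>2) = (\<integral>x. tail_energy f n m x (U x) \<partial>M)"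
      unfolding g_def using tail_energy_integral(2)[OF f U] by (rule sym)
    also have "\<dots> \<le> (\<integral>x. tail_energy f n m x (V x) \<partial>M)"
      using min V(2) by (intro integral_mono tail_energy_integral(1)[OF f] U V) auto
    also have "\<dots> = (\<Sum>k\<in>{n<..m}. (norm_L2 M (\<lambda>x. \<Sum>j=1..m. V x (k, j) * f j x))\<^sup>2)"
      by (rule tail_energy_integral(2)[OF f V])
    also have "\<dots> \<le> (\<Sum>j=1..m. (norm_L2 M (f j - p j))\<^sup>2)"
    proof (rule sum_norm_L2_sq_mono)
      show "(\<lambda>x. \<Sum>j=1..m. V x (k, j) * f j x) \<in> L2 M" for k by (rule unitary_combination_L2[OF f V])
      show "f j - p j \<in> L2 M" if "j \<in> {1..m}" for j by (rule L2_diff[OF f[OF that] pL[OF that]])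
      fix x assume x: "x \<in> space M"
      have "(\<Sum>k\<in>{n<..m}. (norm (\<Sum>j=1..m. V x (k, j) * f j x))\<^sup>2) = (\<Sum>k\<in>{n<..m}. (norm (\<Sum>j=1..m. V x (k, j) * (f j - p j) x))\<^sup>2)"
        by (intro sum.cong refl) (simp only: same[OF x])
      also have "\<dots> \<le> (\<Sum>j=1..m. (norm ((f j - p j) x))\<^sup>2)" by (rule unitary_Bessel[OF V(2)[OF x] sub])
      finally show "(\<Sum>k\<in>{n<..m}. (norm (\<Sum>j=1..m. V x (k, j) * f j x))\<^sup>2) \<le> (\<Sum>j=1..m. (norm ((f j - p j) x))\<^sup>2)" .
    qed
    finally show ?thesis using residual by simp
  qed
  show ?thesis by (rule that[of g q, OF gK qK optimal])
qed

end

section \<open>Random characters of a countable abelian group\<close>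

text \<open>
  For \<open>r > 0\<close> this is the uniform distribution on the \<open>r\<close>-th roots of unity. For \<open>r = 0\<close>, where \<open>z ^ r = 1\<close> says
  nothing and \<open>0\<close> divides only \<open>0\<close>, it is the uniform distribution on the circle.
\<close>

lemma ex_uniform_roots_of_unity:
  "\<exists>\<kappa>::complex measure. prob_space \<kappa> \<and> sets \<kappa> = sets borel \<and> (AE z in \<kappa>. norm z = 1 \<and> z ^ r = 1) \<and>
     (\<forall>j::int. \<not> int r dvd j \<longrightarrow> (\<integral>z. z powi j \<partial>\<kappa>) = 0)"
proof (cases "r = 0")
  case True
  define N where "N = density lborel (\<lambda>t. ennreal (indicator {0..1::real} t))"
  define e where "e t = cis (2 * pi * t)" for t :: real
  have N: "prob_space N"
    by (rule prob_spaceI) (simp add: N_def emeasure_density nn_integral_indicator ennreal_indicator)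
  have sN: "sets N = sets borel" by (simp add: N_def)
  have e_meas: "e \<in> measurable N borel"
    unfolding measurable_cong_sets[OF sN refl] e_def
    by (intro borel_measurable_continuous_onI continuous_intros)
  have int0: "(\<integral>z. z powi j \<partial>distr N borel e) = 0" if "j \<noteq> 0" for j :: int
  proof -
    have pw: "(\<lambda>z::complex. z powi j) \<in> borel_measurable borel"
      unfolding power_int_def by measurable
    define c where "c = \<i> * complex_of_real (2 * pi * of_int j)"
    have "c \<noteq> 0" using that by (simp add: c_def)
    have "(\<integral>z. z powi j \<partial>distr N borel e) = (\<integral>t. e t powi j \<partial>N)"
      using e_meas pw by (rule integral_distr)
    also have "\<dots> = (\<integral>t. cis (2 * pi * of_int j * t) \<partial>N)"
      by (simp add: e_def cis_power_int mult_ac)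
    also have "\<dots> = (\<integral>t. indicator {0..1} t *\<^sub>R cis (2 * pi * of_int j * t) \<partial>lborel)"
      unfolding N_def
      by (rule integral_density) (auto intro!: borel_measurable_continuous_onI continuous_intros)
    also have "\<dots> = cis (2 * pi * of_int j * 1) / c - cis (2 * pi * of_int j * 0) / c"
    proof (rule integral_FTC_Icc)
      fix t :: real
      have "((\<lambda>z. exp (z * c) / c) has_field_derivative exp (of_real t * c)) (at (of_real t))"
        using \<open>c \<noteq> 0\<close> by (auto intro!: derivative_eq_intros)
      from has_vector_derivative_real_field[OF this, of "{0..1}"]
      show "((\<lambda>t. cis (2 * pi * of_int j * t) / c) has_vector_derivative cis (2 * pi * of_int j * t)) (at t within {0..1})"
        unfolding cis_conv_exp c_def by (simp add: mult_ac)
    qed (auto intro!: continuous_intros)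
    also have "\<dots> = 0" using cis_multiple_2pi[of "of_int j"] by (simp add: mult_ac)
    finally show ?thesis .
  qed
  have "AE z in distr N borel e. norm z = 1 \<and> z ^ r = 1"
    by (subst AE_distr_iff[OF e_meas]) (auto simp: True e_def)
  then show ?thesis
    using prob_space.prob_space_distr[OF N e_meas] int0 True by (intro exI[of _ "distr N borel e"]) auto
next
  case False
  define p where "p = pmf_of_set {..<r}"
  define e where "e a = cis (2 * pi * real a / real r)" for a :: nat
  have e_meas: "e \<in> measurable (measure_pmf p) borel" by simp
  have ne: "{..<r} \<noteq> {}" using False by (simp add: lessThan_empty_iff)
  have int0: "(\<integral>z. z powi j \<partial>distr (measure_pmf p) borel e) = 0" if j: "\<not> int r dvd j" for j :: int
  proof -
    have pw: "(\<lambda>z::complex. z powi j) \<in> borel_measurable borel"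
      unfolding power_int_def by measurable
    define w where "w = cis (2 * pi * real_of_int j / real r)"
    have wa: "e a powi j = w ^ a" for a
      unfolding e_def w_def cis_power_int Complex.DeMoivre by (rule arg_cong[where f = cis]) simp
    have w1: "w \<noteq> 1"
    proof
      assume "w = 1"
      then obtain n :: int where "2 * pi * real_of_int j / real r = of_int n * (2 * pi)"
        unfolding w_def cis_eq_1_iff by blast
      then have "real_of_int j = of_int (n * int r)" using False by (simp add: field_simps)
      then have "j = n * int r" by (simp only: of_int_eq_iff)
      with j show False by simp
    qed
    have wr: "w ^ r = 1"
    proof -
      have "real r * (2 * pi * real_of_int j / real r) = 2 * pi * of_int j" using False by simp
      then show ?thesis unfolding w_def Complex.DeMoivre using cis_multiple_2pi[of "of_int j"] by simp
    qed
    have "(\<integral>z. z powi j \<partial>distr (measure_pmf p) borel e) = (\<integral>a. e a powi j \<partial>measure_pmf p)"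
      using e_meas pw by (rule integral_distr)
    also have "\<dots> = (\<Sum>a<r. pmf p a *\<^sub>R w ^ a)"
      unfolding wa by (rule integral_measure_pmf) (use ne in \<open>auto simp: p_def\<close>)
    also have "\<dots> = (\<Sum>a<r. w ^ a) / r"
      unfolding sum_divide_distrib
      by (rule sum.cong) (use ne in \<open>auto simp: p_def pmf_of_set scaleR_conv_of_real divide_inverse\<close>)
    also have "\<dots> = 0" using geometric_sum[OF w1, of r] wr by simp
    finally show ?thesis .
  qed
  have "e a ^ r = 1" for a
  proof -
    have "real r * (2 * pi * real a / real r) = 2 * pi * real a" using False by simp
    then show ?thesis unfolding e_def Complex.DeMoivre using cis_multiple_2pi[of "real a"] by simp
  qed
  then have "AE z in distr (measure_pmf p) borel e. norm z = 1 \<and> z ^ r = 1"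
    by (subst AE_distr_iff[OF e_meas]) (auto simp: e_def)
  then show ?thesis
    using prob_space.prob_space_distr[OF prob_space_measure_pmf e_meas] int0
    by (intro exI[of _ "distr (measure_pmf p) borel e"]) auto
qed

text \<open>A root of \<open>z\<close> minimises the distance of \<open>u ^ r\<close> from \<open>z\<close> over the unit circle.\<close>

lemma ex_measurable_root:
  "\<exists>\<rho>::complex \<Rightarrow> complex. \<rho> \<in> borel_measurable borel \<and> (\<forall>z. norm (\<rho> z) = 1) \<and>
     (\<forall>z. norm z = 1 \<and> (r = 0 \<longrightarrow> z = 1) \<longrightarrow> \<rho> z ^ r = z)"
proof -
  have ne: "sphere (0::complex) 1 \<noteq> {}" by simp
  have meas: "(\<lambda>z. norm (u ^ r - z)) \<in> borel_measurable borel" for u :: complex by measurable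
  have cont: "continuous_on (sphere 0 1) (\<lambda>u. norm (u ^ r - z))" for z :: complex by (intro continuous_intros)
  obtain \<rho> :: "complex \<Rightarrow> complex" where \<rho>: "\<rho> \<in> borel_measurable borel" "\<And>z. z \<in> space borel \<Longrightarrow> \<rho> z \<in> sphere 0 1"
    "\<And>z u. z \<in> space borel \<Longrightarrow> u \<in> sphere 0 1 \<Longrightarrow> norm (\<rho> z ^ r - z) \<le> norm (u ^ r - z)"
    by (rule measurable_argmin[OF compact_sphere ne meas cont]) (rule that)
  have "\<rho> z ^ r = z" if z: "norm z = 1" "r = 0 \<longrightarrow> z = 1" for z
  proof (cases "r = 0")
    case False
    have "real r * (Arg z / real r) = Arg z" using False by simp
    then have "cis (Arg z / r) ^ r = z"
      unfolding Complex.DeMoivre using z(1) cis_Arg[of z] by (cases "z = 0") (simp_all add: sgn_div_norm)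
    then show ?thesis using \<rho>(3)[of z "cis (Arg z / r)"] by simp
  qed (use z in simp)
  with \<rho>(1,2) show ?thesis by (intro exI[of _ \<rho>]) auto
qed

text \<open>The exponents that lead into \<open>H\<close> form a subgroup of the integers; \<open>r = 0\<close> encodes infinite order.\<close>

lemma (in group) ex_order_modulo:
  assumes H: "subgroup H G" and x: "x \<in> carrier G"
  shows "\<exists>r::nat. \<forall>j::int. x [^] j \<in> H \<longleftrightarrow> int r dvd j"
proof (cases "\<exists>n>0. x [^] int n \<in> H")
  case True
  define r where "r = (LEAST n. 0 < n \<and> x [^] int n \<in> H)"
  have r: "0 < r" "x [^] int r \<in> H" using LeastI_ex[OF True] by (auto simp: r_def)
  have "int r dvd j" if "x [^] j \<in> H" for j :: int
  proof (rule ccontr)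
    assume "\<not> int r dvd j"
    then have p: "0 < j mod int r" using r(1) by (simp add: dvd_eq_mod_eq_0 order_le_neq_trans)
    have "x [^] (int r * (j div int r)) \<in> H"
      unfolding int_pow_pow[OF x, symmetric] by (rule subgroup_int_pow_closed[OF H r(2)])
    then have "x [^] j \<otimes> inv (x [^] (int r * (j div int r))) \<in> H"
      using that by (intro subgroup.m_closed[OF H] subgroup.m_inv_closed[OF H])
    also have "x [^] j \<otimes> inv (x [^] (int r * (j div int r))) = x [^] (j mod int r)"
      using x by (simp add: int_pow_diff[symmetric] minus_mult_div_eq_mod)
    finally have "x [^] int (nat (j mod int r)) \<in> H" using p by simp
    then have "0 < nat (j mod int r) \<and> x [^] int (nat (j mod int r)) \<in> H" using p by simp
    then have "r \<le> nat (j mod int r)" by (subst r_def) (rule Least_le)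
    moreover have "j mod int r < int r" using r(1) by simp
    ultimately show False using p by linarith
  qed
  moreover have "x [^] j \<in> H" if j: "int r dvd j" for j :: int
  proof -
    obtain s where "j = int r * s" using j by (rule dvdE)
    then show ?thesis using subgroup_int_pow_closed[OF H r(2), of s] int_pow_pow[OF x, of "int r" s] by simp
  qed
  ultimately show ?thesis by blast
next
  case False
  have "j = 0" if "x [^] j \<in> H" for j :: int
  proof (rule ccontr)
    assume "j \<noteq> 0"
    have "x [^] (- j) \<in> H" using subgroup.m_inv_closed[OF H that] int_pow_neg[OF x] by simp
    with that have "x [^] int (nat \<bar>j\<bar>) \<in> H" by (cases "0 \<le> j") simp_all
    moreover have "0 < nat \<bar>j\<bar>" using \<open>j \<noteq> 0\<close> by simp
    ultimately show False using False by blast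
  qed
  moreover have "x [^] (0::int) \<in> H" using subgroup.one_closed[OF H] by simp
  ultimately show ?thesis by (intro exI[of _ 0]) auto
qed

text \<open>
  Two representations of the same element differ by a power of \<open>x\<close> that lies in \<open>H\<close>, hence by a multiple of \<open>r\<close>
  in the exponent, where \<open>c\<close> and \<open>\<psi>\<close> agree.
\<close>

lemma (in comm_group) character_extension_welldefined:
  fixes \<psi> :: "'a \<Rightarrow> complex"
  assumes H: "subgroup H G" and x: "x \<in> carrier G" and r: "\<And>j::int. x [^] j \<in> H \<longleftrightarrow> int r dvd j"
    and mult: "\<And>a b. a \<in> H \<Longrightarrow> b \<in> H \<Longrightarrow> \<psi> (a \<otimes> b) = \<psi> a * \<psi> b" and nz: "\<And>a. a \<in> H \<Longrightarrow> \<psi> a \<noteq> 0"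
    and c: "c \<noteq> 0" "c ^ r = \<psi> (x [^] int r)"
    and h: "h \<in> H" "h' \<in> H" and eq: "h \<otimes> x [^] (j::int) = h' \<otimes> x [^] j'"
  shows "\<psi> h * c powi j = \<psi> h' * c powi j'"
proof -
  have HG: "a \<in> H \<Longrightarrow> a \<in> carrier G" for a using subgroup.mem_carrier[OF H] .
  have one: "\<psi> \<one> = 1" using mult[of \<one> \<one>] nz[of \<one>] subgroup.one_closed[OF H] by simp
  have nat_pow: "\<psi> (a [^] int n) = \<psi> a ^ n" if a: "a \<in> H" for a n
  proof (induction n)
    case (Suc n)
    have "a [^] int (Suc n) = a \<otimes> a [^] int n"
      using int_pow_mult[OF HG[OF a], of 1 "int n"] HG[OF a] by (simp add: add.commute)
    then show ?case using mult[OF a subgroup_int_pow_closed[OF H a, of "int n"]] Suc by simp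
  qed (simp add: one)
  have pow: "\<psi> (a [^] s) = \<psi> a powi s" if a: "a \<in> H" for a and s :: int
  proof (cases "0 \<le> s")
    case True
    then show ?thesis using nat_pow[OF a, of "nat s"] by (simp add: power_int_def)
  next
    case False
    have "\<psi> (a [^] s) * \<psi> (a [^] (- s)) = 1"
      using mult[OF subgroup_int_pow_closed[OF H a, of s] subgroup_int_pow_closed[OF H a, of "- s"]]
        int_pow_mult[OF HG[OF a], of s "- s"] one by simp
    moreover have "\<psi> (a [^] (- s)) = \<psi> a ^ nat (- s)" using nat_pow[OF a, of "nat (- s)"] False by simp
    ultimately show ?thesis using False nz[OF a] by (simp add: power_int_def field_simps)
  qed
  have e1: "x [^] (j - j') = inv h \<otimes> h'"
  proof -
    have "h \<otimes> (x [^] (j - j') \<otimes> x [^] j') = h' \<otimes> x [^] j'"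
      using eq int_pow_mult[OF x, of "j - j'" j'] by simp
    then have "(h \<otimes> x [^] (j - j')) \<otimes> x [^] j' = h' \<otimes> x [^] j'" using x h HG by (simp add: m_assoc)
    then have "h \<otimes> x [^] (j - j') = h'" using x h HG by (simp add: right_cancel)
    then have "inv h \<otimes> h' = inv h \<otimes> (h \<otimes> x [^] (j - j'))" by simp
    also have "\<dots> = x [^] (j - j')" using x h HG by (simp add: m_assoc[symmetric])
    finally show ?thesis by (rule sym)
  qed
  have inH: "x [^] (j - j') \<in> H"
    unfolding e1 by (intro subgroup.m_closed[OF H] subgroup.m_inv_closed[OF H] h)
  then obtain s where s: "j - j' = int r * s" unfolding r by (rule dvdE)
  have xr: "x [^] int r \<in> H" using r by simp
  have "\<psi> (x [^] (j - j')) = c powi (j - j')"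
    unfolding s using pow[OF xr, of s] int_pow_pow[OF x, of "int r" s] c(2) by (simp add: power_int_mult)
  moreover have "h' = h \<otimes> x [^] (j - j')" unfolding e1 using h HG by (simp add: m_assoc[symmetric])
  ultimately have "\<psi> h' = \<psi> h * c powi (j - j')" using mult[OF h(1) inH] by simp
  then show ?thesis using c(1) by (simp add: power_int_diff)
qed

text \<open>
  Functions of disjoint blocks of coordinates are independent. That \<open>g\<close> depends only on the coordinates below \<open>k\<close>
  is expressed pointwise, which allows all partial characters to live on the same infinite product.
\<close>

lemma integral_PiM_split_last:
  fixes \<kappa> :: "nat \<Rightarrow> complex measure" and g :: "(nat \<Rightarrow> complex) \<Rightarrow> complex" and h :: "complex \<Rightarrow> complex" and k :: nat
  assumes \<kappa>: "\<And>k. prob_space (\<kappa> k)" "\<And>k. sets (\<kappa> k) = sets borel"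
    and g: "g \<in> borel_measurable (PiM UNIV \<kappa>)" "\<And>\<omega>. norm (g \<omega>) \<le> 1" "\<And>\<omega> \<omega>'. (\<And>i. i < k \<Longrightarrow> \<omega> i = \<omega>' i) \<Longrightarrow> g \<omega> = g \<omega>'"
    and h: "h \<in> borel_measurable borel" "\<And>z. norm (h z) \<le> 1"
  shows "(\<integral>\<omega>. g \<omega> * h (\<omega> k) \<partial>PiM UNIV \<kappa>) = (\<integral>\<omega>. g \<omega> \<partial>PiM UNIV \<kappa>) * (\<integral>z. h z \<partial>\<kappa> k)"
proof -
  interpret \<kappa>: prob_space "\<kappa> i" for i by (rule \<kappa>(1))
  interpret P: product_prob_space \<kappa> UNIV ..
  have sp: "space (\<kappa> k) = UNIV" for k using sets_eq_imp_space_eq[OF \<kappa>(2)[of k]] by simp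
  have rv: "(\<lambda>\<omega>. \<omega> i) \<in> measurable (PiM UNIV \<kappa>) (\<kappa> i)" for i by (rule measurable_component_singleton) simp
  have ind: "P.indep_vars \<kappa> (\<lambda>i \<omega>. \<omega> i) UNIV"
  proof (subst P.indep_vars_iff_distr_eq_PiM')
    show "distr (PiM UNIV \<kappa>) (PiM UNIV \<kappa>) (\<lambda>x. \<lambda>i\<in>UNIV. x i) = (\<Pi>\<^sub>M i\<in>UNIV. distr (PiM UNIV \<kappa>) (\<kappa> i) (\<lambda>\<omega>. \<omega> i))"
      by (simp add: restrict_UNIV distr_PiM_component \<kappa>(1) distr_id2)
  qed (use rv in auto)
  define E where "E \<tau> = (\<lambda>i. if i < k then \<tau> i else 0)" for \<tau> :: "nat \<Rightarrow> complex"
  have E: "E \<in> measurable (PiM {..<k} \<kappa>) (PiM UNIV \<kappa>)"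
  proof (rule measurable_PiM_single')
    show "(\<lambda>\<tau>. E \<tau> i) \<in> measurable (PiM {..<k} \<kappa>) (\<kappa> i)" for i
      unfolding E_def by (cases "i < k") (auto simp: sp intro!: measurable_component_singleton)
  qed (auto simp: sp)
  have ga: "g \<circ> E \<in> borel_measurable (PiM {..<k} \<kappa>)" using E g(1) by (rule measurable_comp)
  have ha: "h \<circ> (\<lambda>\<tau>. \<tau> k) \<in> borel_measurable (PiM {k} \<kappa>)"
  proof (rule measurable_comp)
    show "(\<lambda>\<tau>. \<tau> k) \<in> measurable (PiM {k} \<kappa>) (\<kappa> k)" by (rule measurable_component_singleton) simp
    show "h \<in> borel_measurable (\<kappa> k)" unfolding measurable_cong_sets[OF \<kappa>(2) refl] by (rule h)
  qed
  have "P.indep_var (PiM {..<k} \<kappa>) (\<lambda>\<omega>. restrict (\<lambda>i. \<omega> i) {..<k}) (PiM {k} \<kappa>) (\<lambda>\<omega>. restrict (\<lambda>i. \<omega> i) {k})"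
    by (rule P.indep_var_restrict[OF ind]) auto
  from P.indep_var_compose[OF this ga ha]
  have "P.indep_var borel ((g \<circ> E) \<circ> (\<lambda>\<omega>. restrict (\<lambda>i. \<omega> i) {..<k})) borel ((h \<circ> (\<lambda>\<tau>. \<tau> k)) \<circ> (\<lambda>\<omega>. restrict (\<lambda>i. \<omega> i) {k}))" .
  moreover have "(g \<circ> E) \<circ> (\<lambda>\<omega>. restrict (\<lambda>i. \<omega> i) {..<k}) = g"
  proof (rule ext)
    fix \<omega> :: "nat \<Rightarrow> complex"
    have "E (restrict (\<lambda>i. \<omega> i) {..<k}) i = \<omega> i" if "i < k" for i
      using that by (simp add: E_def)
    then have "g (E (restrict (\<lambda>i. \<omega> i) {..<k})) = g \<omega>" by (rule g(3))
    then show "((g \<circ> E) \<circ> (\<lambda>\<omega>. restrict (\<lambda>i. \<omega> i) {..<k})) \<omega> = g \<omega>" by simp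
  qed
  moreover have "(h \<circ> (\<lambda>\<tau>. \<tau> k)) \<circ> (\<lambda>\<omega>. restrict (\<lambda>i. \<omega> i) {k}) = (\<lambda>\<omega>. h (\<omega> k))" by (rule ext) simp
  ultimately have iv: "P.indep_var borel g borel (\<lambda>\<omega>. h (\<omega> k))" by simp
  have hk: "h \<in> borel_measurable (\<kappa> k)" unfolding measurable_cong_sets[OF \<kappa>(2) refl] by (rule h)
  have hm: "(\<lambda>\<omega>. h (\<omega> k)) \<in> borel_measurable (PiM UNIV \<kappa>)" using rv hk by (rule measurable_compose)
  have "(\<integral>\<omega>. g \<omega> * h (\<omega> k) \<partial>PiM UNIV \<kappa>) = (\<integral>\<omega>. g \<omega> \<partial>PiM UNIV \<kappa>) * (\<integral>\<omega>. h (\<omega> k) \<partial>PiM UNIV \<kappa>)"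
    by (rule P.indep_var_lebesgue_integral[OF iv])
      (auto intro!: P.integrable_const_bound[where B=1] g hm h)
  also have "(\<integral>\<omega>. h (\<omega> k) \<partial>PiM UNIV \<kappa>) = (\<integral>z. h z \<partial>distr (PiM UNIV \<kappa>) (\<kappa> k) (\<lambda>\<omega>. \<omega> k))"
    by (rule integral_distr[OF rv hk, symmetric])
  also have "distr (PiM UNIV \<kappa>) (\<kappa> k) (\<lambda>\<omega>. \<omega> k) = \<kappa> k" by (rule distr_PiM_component[OF \<kappa>(1)]) simp
  finally show ?thesis .
qed


text \<open>
  The characters are extended along an enumeration \<open>e\<close> of the group. If \<open>r\<close> is the order of \<open>e k\<close> modulo
  the subgroup \<open>H k\<close> reached so far, the value at \<open>e k\<close> is an \<open>r\<close>-th root of the value at \<open>(e k)\<^sup>r\<close>, rotated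
  by an independent uniform \<open>r\<close>-th root of unity (a uniform point of the circle if \<open>r = 0\<close>). The rotation
  makes the mean value of every new element vanish.
\<close>

theorem (in comm_group) ex_random_characters:
  assumes countable: "countable (carrier G)"
  obtains \<Omega> :: "(nat \<Rightarrow> complex) measure" and \<xi> :: "'a \<Rightarrow> (nat \<Rightarrow> complex) \<Rightarrow> complex" where
    "prob_space \<Omega>"
    "\<And>y. y \<in> carrier G \<Longrightarrow> \<xi> y \<in> borel_measurable \<Omega>"
    "\<And>y \<omega>. y \<in> carrier G \<Longrightarrow> norm (\<xi> y \<omega>) = 1"
    "\<And>y z \<omega>. y \<in> carrier G \<Longrightarrow> z \<in> carrier G \<Longrightarrow> \<xi> (y \<otimes> z) \<omega> = \<xi> y \<omega> * \<xi> z \<omega>"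
    "\<And>y. y \<in> carrier G \<Longrightarrow> y \<noteq> \<one> \<Longrightarrow> (\<integral>\<omega>. \<xi> y \<omega> \<partial>\<Omega>) = 0"
proof -
  define e where "e = from_nat_into (carrier G)"
  have e: "e k \<in> carrier G" for k unfolding e_def by (rule from_nat_into) auto
  have e_surj: "\<exists>k. e k = y" if "y \<in> carrier G" for y
    unfolding e_def by (rule from_nat_into_surj[OF countable that])
  define H where "H = rec_nat {\<one>} (\<lambda>k S. {h \<otimes> e k [^] (j::int) | h j. h \<in> S})"
  have H0: "H 0 = {\<one>}" and HSuc: "H (Suc k) = {h \<otimes> e k [^] (j::int) | h j. h \<in> H k}" for k
    by (simp_all add: H_def)
  have H: "subgroup (H k) G" for k
  proof (induction k)
    case 0 show ?case unfolding H0 by (rule triv_subgroup)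
  next
    case (Suc k)
    have HG: "h \<in> carrier G" if "h \<in> H k" for h using subgroup.mem_carrier[OF Suc that] .
    show ?case
    proof (rule subgroupI)
      show "H (Suc k) \<subseteq> carrier G" unfolding HSuc using e[of k] HG by auto
      show "H (Suc k) \<noteq> {}" unfolding HSuc using subgroup.one_closed[OF Suc] by blast
      fix a assume "a \<in> H (Suc k)"
      then obtain h and j :: int where a: "a = h \<otimes> e k [^] j" "h \<in> H k" unfolding HSuc by blast
      have "inv a = inv h \<otimes> e k [^] (- j)"
        unfolding a(1) using e[of k] HG[OF a(2)] by (simp add: inv_mult int_pow_neg)
      then show "inv a \<in> H (Suc k)" unfolding HSuc using subgroup.m_inv_closed[OF Suc a(2)] by blast
      fix b assume "b \<in> H (Suc k)"
      then obtain h' and j' :: int where b: "b = h' \<otimes> e k [^] j'" "h' \<in> H k" unfolding HSuc by blast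
      have "a \<otimes> b = (h \<otimes> h') \<otimes> e k [^] (j + j')"
        unfolding a(1) b(1) using e[of k] HG[OF a(2)] HG[OF b(2)] by (simp add: int_pow_mult m_ac)
      then show "a \<otimes> b \<in> H (Suc k)" unfolding HSuc using subgroup.m_closed[OF Suc a(2) b(2)] by blast
    qed
  qed
  have HG: "h \<in> carrier G" if "h \<in> H k" for h k using subgroup.mem_carrier[OF H that] .
  have H_mono1: "H k \<subseteq> H (Suc k)" for k
  proof
    fix h assume h: "h \<in> H k"
    have "h = h \<otimes> e k [^] (0::int)" using HG[OF h] by simp
    with h show "h \<in> H (Suc k)" unfolding HSuc by blast
  qed
  have H_mono: "H i \<subseteq> H j" if "i \<le> j" for i j using lift_Suc_mono_le[of H, OF H_mono1 that] .
  have e_H: "e k \<in> H (Suc k)" for k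
  proof -
    have "e k = \<one> \<otimes> e k [^] (1::int)" using e[of k] by simp
    then show ?thesis unfolding HSuc using subgroup.one_closed[OF H] by blast
  qed
  have "\<forall>k. \<exists>r::nat. \<forall>j::int. e k [^] j \<in> H k \<longleftrightarrow> int r dvd j"
    using ex_order_modulo[OF H e] by blast
  from choice[OF this] obtain r where "\<forall>k. \<forall>j::int. e k [^] j \<in> H k \<longleftrightarrow> int (r k) dvd j" ..
  then have r: "e k [^] (j::int) \<in> H k \<longleftrightarrow> int (r k) dvd j" for k j by blast
  have "\<forall>k. \<exists>\<kappa>::complex measure. prob_space \<kappa> \<and> sets \<kappa> = sets borel \<and> (AE z in \<kappa>. norm z = 1 \<and> z ^ r k = 1) \<and>
     (\<forall>j::int. \<not> int (r k) dvd j \<longrightarrow> (\<integral>z. z powi j \<partial>\<kappa>) = 0)"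
    using ex_uniform_roots_of_unity by blast
  then obtain \<kappa> :: "nat \<Rightarrow> complex measure" where \<kappa>: "\<And>k. prob_space (\<kappa> k)" "\<And>k. sets (\<kappa> k) = sets borel"
    "\<And>k. AE z in \<kappa> k. norm z = 1 \<and> z ^ r k = 1"
    "\<And>k j. \<not> int (r k) dvd j \<Longrightarrow> (\<integral>z. z powi j \<partial>\<kappa> k) = 0" by metis
  have "\<forall>k. \<exists>\<rho>::complex \<Rightarrow> complex. \<rho> \<in> borel_measurable borel \<and> (\<forall>z. norm (\<rho> z) = 1) \<and>
     (\<forall>z. norm z = 1 \<and> (r k = 0 \<longrightarrow> z = 1) \<longrightarrow> \<rho> z ^ r k = z)"
    using ex_measurable_root by blast
  then obtain \<rho> :: "nat \<Rightarrow> complex \<Rightarrow> complex" where \<rho>: "\<And>k. \<rho> k \<in> borel_measurable borel" "\<And>k z. norm (\<rho> k z) = 1"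
     "\<And>k z. norm z = 1 \<Longrightarrow> (r k = 0 \<Longrightarrow> z = 1) \<Longrightarrow> \<rho> k z ^ r k = z" by metis
  \<comment> \<open>Changing a coordinate on a null set makes the algebraic identities hold at every point.\<close>
  define \<zeta> where "\<zeta> k z = (if norm z = 1 \<and> z ^ r k = 1 then z else 1)" for k and z :: complex
  have \<zeta>: "\<zeta> k \<in> borel_measurable borel" "norm (\<zeta> k z) = 1" "\<zeta> k z ^ r k = 1" for k z
  proof -
    show "\<zeta> k \<in> borel_measurable borel" unfolding \<zeta>_def by measurable
  qed (auto simp: \<zeta>_def)
  define \<Omega> where "\<Omega> = PiM UNIV \<kappa>"
  have pw: "(\<lambda>z::complex. z powi j) \<in> borel_measurable borel" for j :: int
    unfolding power_int_def by measurable
  have \<zeta>_int: "(\<integral>z. \<zeta> k z powi j \<partial>\<kappa> k) = 0" if "\<not> int (r k) dvd j" for k j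
  proof -
    have "(\<integral>z. \<zeta> k z powi j \<partial>\<kappa> k) = (\<integral>z. z powi j \<partial>\<kappa> k)"
    proof (rule integral_cong_AE)
      show "AE z in \<kappa> k. \<zeta> k z powi j = z powi j" using \<kappa>(3)[of k] by eventually_elim (simp add: \<zeta>_def)
      show "(\<lambda>z. \<zeta> k z powi j) \<in> borel_measurable (\<kappa> k)"
        unfolding measurable_cong_sets[OF \<kappa>(2) refl] by (rule measurable_compose[OF \<zeta>(1) pw])
      show "(\<lambda>z. z powi j) \<in> borel_measurable (\<kappa> k)"
        unfolding measurable_cong_sets[OF \<kappa>(2) refl] by (rule pw)
    qed
    then show ?thesis using \<kappa>(4)[OF that] by simp
  qed
  have coord: "(\<lambda>\<omega>. \<omega> k) \<in> borel_measurable \<Omega>" for k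
    unfolding \<Omega>_def measurable_cong_sets[OF refl \<kappa>(2)[of k], symmetric] by (rule measurable_component_singleton) simp
  \<comment> \<open>The induction hypothesis: a random character of \<open>H k\<close> that depends on the first \<open>k\<close> coordinates.\<close>
  define random where "random k \<xi> \<longleftrightarrow>
    (\<forall>y\<in>H k. \<xi> y \<in> borel_measurable \<Omega> \<and> (\<forall>\<omega>. norm (\<xi> y \<omega>) = 1) \<and>
       (\<forall>\<omega> \<omega>'. (\<forall>i<k. \<omega> i = \<omega>' i) \<longrightarrow> \<xi> y \<omega> = \<xi> y \<omega>') \<and> (y \<noteq> \<one> \<longrightarrow> (\<integral>\<omega>. \<xi> y \<omega> \<partial>\<Omega>) = 0)) \<and>
    (\<forall>y\<in>H k. \<forall>z\<in>H k. \<forall>\<omega>. \<xi> (y \<otimes> z) \<omega> = \<xi> y \<omega> * \<xi> z \<omega>)" for k and \<xi> :: "'a \<Rightarrow> (nat \<Rightarrow> complex) \<Rightarrow> complex"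
  have extend: "\<exists>\<xi>'. random (Suc k) \<xi>' \<and> (\<forall>y\<in>H k. \<xi>' y = \<xi> y)" if "random k \<xi>" for k \<xi>
  proof -
    from that have \<xi>_meas: "\<And>y. y \<in> H k \<Longrightarrow> \<xi> y \<in> borel_measurable \<Omega>" and \<xi>_norm: "\<And>y \<omega>. y \<in> H k \<Longrightarrow> norm (\<xi> y \<omega>) = 1"
      and \<xi>_dep: "\<And>y \<omega> \<omega>'. y \<in> H k \<Longrightarrow> (\<And>i. i < k \<Longrightarrow> \<omega> i = \<omega>' i) \<Longrightarrow> \<xi> y \<omega> = \<xi> y \<omega>'"
      and \<xi>_int: "\<And>y. y \<in> H k \<Longrightarrow> y \<noteq> \<one> \<Longrightarrow> (\<integral>\<omega>. \<xi> y \<omega> \<partial>\<Omega>) = 0"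
      and \<xi>_mult: "\<And>y z \<omega>. y \<in> H k \<Longrightarrow> z \<in> H k \<Longrightarrow> \<xi> (y \<otimes> z) \<omega> = \<xi> y \<omega> * \<xi> z \<omega>"
      unfolding random_def by blast+
    have \<xi>_nz: "\<xi> y \<omega> \<noteq> 0" if "y \<in> H k" for y \<omega> using \<xi>_norm[OF that, of \<omega>] by auto
    have one: "\<one> \<in> H k" using subgroup.one_closed[OF H] .
    have \<xi>_one: "\<xi> \<one> \<omega> = 1" for \<omega> using \<xi>_mult[OF one one, of \<omega>] \<xi>_nz[OF one, of \<omega>] by simp
    define xr where "xr = e k [^] int (r k)"
    have xr: "xr \<in> H k" unfolding xr_def r by simp
    define a where "a \<omega> = \<rho> k (\<xi> xr \<omega>)" for \<omega>
    define c where "c \<omega> = a \<omega> * \<zeta> k (\<omega> k)" for \<omega>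
    have a_norm: "norm (a \<omega>) = 1" and c_norm: "norm (c \<omega>) = 1" for \<omega>
      by (simp_all add: a_def c_def norm_mult \<rho>(2) \<zeta>(2))
    have c_nz: "c \<omega> \<noteq> 0" for \<omega> using c_norm[of \<omega>] by auto
    have c_pow: "c \<omega> ^ r k = \<xi> xr \<omega>" for \<omega>
      unfolding c_def a_def power_mult_distrib \<zeta>(3)
      using \<rho>(3)[OF \<xi>_norm[OF xr], of k \<omega>] \<xi>_one by (simp add: xr_def)
    have a_meas: "a \<in> borel_measurable \<Omega>" unfolding a_def by (rule measurable_compose[OF \<xi>_meas[OF xr] \<rho>(1)])
    have c_meas: "c \<in> borel_measurable \<Omega>"
      unfolding c_def by (rule borel_measurable_times[OF a_meas measurable_compose[OF coord \<zeta>(1)]])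
    \<comment> \<open>Representations are chosen once and for all, independently of \<open>\<omega>\<close>, to keep the extension measurable.\<close>
    have "\<forall>y\<in>H (Suc k). \<exists>p. fst p \<in> H k \<and> y = fst p \<otimes> e k [^] (snd p :: int)"
      unfolding HSuc by auto
    from bchoice[OF this] obtain p where p: "\<And>y. y \<in> H (Suc k) \<Longrightarrow> fst (p y) \<in> H k"
      "\<And>y. y \<in> H (Suc k) \<Longrightarrow> y = fst (p y) \<otimes> e k [^] (snd (p y) :: int)" by blast
    define \<xi>' where "\<xi>' y \<omega> = \<xi> (fst (p y)) \<omega> * c \<omega> powi snd (p y)" for y \<omega>
    have key: "\<xi>' (h \<otimes> e k [^] j) = (\<lambda>\<omega>. \<xi> h \<omega> * c \<omega> powi j)" if h: "h \<in> H k" for h and j :: int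
    proof
      fix \<omega>
      define y where "y = h \<otimes> e k [^] j"
      have y: "y \<in> H (Suc k)" unfolding HSuc y_def using h by blast
      show "\<xi>' (h \<otimes> e k [^] j) \<omega> = \<xi> h \<omega> * c \<omega> powi j"
        unfolding \<xi>'_def y_def[symmetric]
      proof (rule character_extension_welldefined[of "H k" "e k" "r k" "\<lambda>y. \<xi> y \<omega>", OF H e r \<xi>_mult \<xi>_nz c_nz _ p(1)[OF y] h])
        show "c \<omega> ^ r k = \<xi> (e k [^] int (r k)) \<omega>" using c_pow by (simp add: xr_def)
        show "fst (p y) \<otimes> e k [^] snd (p y) = h \<otimes> e k [^] j" using p(2)[OF y] by (simp add: y_def)
      qed
    qed
    have agree: "\<xi>' y = \<xi> y" if "y \<in> H k" for y
      using key[OF that, of 0] HG[OF that] by simp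
    have "random (Suc k) \<xi>'"
      unfolding random_def
    proof (intro conjI ballI allI impI)
      fix y assume y: "y \<in> H (Suc k)"
      then obtain h and j :: int where h: "h \<in> H k" and yh: "y = h \<otimes> e k [^] j" unfolding HSuc by blast
      have \<xi>'y: "\<xi>' y = (\<lambda>\<omega>. \<xi> h \<omega> * c \<omega> powi j)" unfolding yh by (rule key[OF h])
      show "\<xi>' y \<in> borel_measurable \<Omega>"
        unfolding \<xi>'y by (rule borel_measurable_times[OF \<xi>_meas[OF h] measurable_compose[OF c_meas pw]])
      show "norm (\<xi>' y \<omega>) = 1" for \<omega>
        unfolding \<xi>'y norm_mult norm_power_int \<xi>_norm[OF h] c_norm by simp
      show "\<xi>' y \<omega> = \<xi>' y \<omega>'" if "\<forall>i<Suc k. \<omega> i = \<omega>' i" for \<omega> \<omega>'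
      proof -
        have "\<xi> h \<omega> = \<xi> h \<omega>'" "\<xi> xr \<omega> = \<xi> xr \<omega>'" using that by (auto intro!: \<xi>_dep h xr)
        then show ?thesis using that unfolding \<xi>'y c_def a_def by simp
      qed
      show "(\<integral>\<omega>. \<xi>' y \<omega> \<partial>\<Omega>) = 0" if "y \<noteq> \<one>"
      proof (cases "int (r k) dvd j")
        case True
        then have "e k [^] j \<in> H k" by (simp only: r)
        then have "y \<in> H k" unfolding yh by (intro subgroup.m_closed[OF H] h)
        then show ?thesis using agree \<xi>_int \<open>y \<noteq> \<one>\<close> by simp
      next
        case False
        have "(\<integral>\<omega>. \<xi>' y \<omega> \<partial>\<Omega>) = (\<integral>\<omega>. (\<xi> h \<omega> * a \<omega> powi j) * (\<zeta> k (\<omega> k) powi j) \<partial>PiM UNIV \<kappa>)"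
          unfolding \<xi>'y c_def \<Omega>_def power_int_mult_distrib mult.assoc ..
        also have "\<dots> = (\<integral>\<omega>. \<xi> h \<omega> * a \<omega> powi j \<partial>PiM UNIV \<kappa>) * (\<integral>z. \<zeta> k z powi j \<partial>\<kappa> k)"
        proof (rule integral_PiM_split_last[OF \<kappa>(1,2)])
          show "(\<lambda>\<omega>. \<xi> h \<omega> * a \<omega> powi j) \<in> borel_measurable (PiM UNIV \<kappa>)"
            unfolding \<Omega>_def[symmetric]
            by (rule borel_measurable_times[OF \<xi>_meas[OF h] measurable_compose[OF a_meas pw]])
          show "norm (\<xi> h \<omega> * a \<omega> powi j) \<le> 1" for \<omega>
            unfolding norm_mult norm_power_int \<xi>_norm[OF h] a_norm by simp
          show "\<xi> h \<omega> * a \<omega> powi j = \<xi> h \<omega>' * a \<omega>' powi j" if "\<And>i. i < k \<Longrightarrow> \<omega> i = \<omega>' i" for \<omega> \<omega>'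
            unfolding a_def using \<xi>_dep[OF h that] \<xi>_dep[OF xr that] by simp
          show "(\<lambda>z. \<zeta> k z powi j) \<in> borel_measurable borel" by (rule measurable_compose[OF \<zeta>(1) pw])
          show "norm (\<zeta> k z powi j) \<le> 1" for z unfolding norm_power_int \<zeta>(2) by simp
        qed
        also have "\<dots> = 0" using \<zeta>_int[OF False] by simp
        finally show ?thesis .
      qed
      fix z \<omega> assume "z \<in> H (Suc k)"
      then obtain h' and j' :: int where h': "h' \<in> H k" and zh: "z = h' \<otimes> e k [^] j'" unfolding HSuc by blast
      have yz: "y \<otimes> z = (h \<otimes> h') \<otimes> e k [^] (j + j')"
        unfolding yh zh using e[of k] HG[OF h] HG[OF h'] by (simp add: int_pow_mult m_ac)
      show "\<xi>' (y \<otimes> z) \<omega> = \<xi>' y \<omega> * \<xi>' z \<omega>"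
        unfolding yz key[OF subgroup.m_closed[OF H h h']] unfolding yh zh key[OF h] key[OF h'] \<xi>_mult[OF h h']
        using c_nz[of \<omega>] by (simp add: power_int_add)
    qed
    with agree show ?thesis by blast
  qed
  have base: "random 0 (\<lambda>_ _. 1)" unfolding random_def H0 by simp
  have "\<exists>X. \<forall>k. random k (X k) \<and> (\<forall>y\<in>H k. X (Suc k) y = X k y)"
  proof (rule dependent_nat_choice)
    show "\<exists>\<xi>. random 0 \<xi>" by (rule exI[of _ "\<lambda>_ _. 1"]) (rule base)
  qed (rule extend)
  then obtain X where "\<forall>k. random k (X k) \<and> (\<forall>y\<in>H k. X (Suc k) y = X k y)" ..
  then have X: "\<And>k. random k (X k)" and X_step: "\<And>k y. y \<in> H k \<Longrightarrow> X (Suc k) y = X k y" by simp_all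
  have X_mono: "X j y = X i y" if "i \<le> j" "y \<in> H i" for i j y
    using that(1)
  proof (induction j rule: dec_induct)
    case (step j)
    then show ?case using X_step[of y j] H_mono[of i j] that(2) by auto
  qed simp
  define \<xi> where "\<xi> y = X (LEAST k. y \<in> H k) y" for y
  have \<xi>_X: "\<xi> y = X k y" if "y \<in> H k" for k y
    unfolding \<xi>_def using X_mono[OF Least_le[of "\<lambda>k. y \<in> H k", OF that] LeastI[of "\<lambda>k. y \<in> H k", OF that]] by simp
  have ex_H: "\<exists>k. y \<in> H k" if "y \<in> carrier G" for y using e_surj[OF that] e_H by blast
  show thesis
  proof (rule that[of \<Omega> \<xi>])
    show "prob_space \<Omega>" unfolding \<Omega>_def by (rule prob_space_PiM) (rule \<kappa>(1))
    fix y assume "y \<in> carrier G"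
    then obtain k where k: "y \<in> H k" using ex_H by blast
    show "\<xi> y \<in> borel_measurable \<Omega>" unfolding \<xi>_X[OF k] using X[of k] k unfolding random_def by blast
    show "norm (\<xi> y \<omega>) = 1" for \<omega> unfolding \<xi>_X[OF k] using X[of k] k unfolding random_def by blast
    show "(\<integral>\<omega>. \<xi> y \<omega> \<partial>\<Omega>) = 0" if "y \<noteq> \<one>" unfolding \<xi>_X[OF k] using X[of k] k that unfolding random_def by blast
    fix z \<omega> assume "z \<in> carrier G"
    then obtain l where l: "z \<in> H l" using ex_H by blast
    define i where "i = max k l"
    have yz: "y \<in> H i" "z \<in> H i" using k l H_mono[of k i] H_mono[of l i] by (auto simp: i_def)
    then have "y \<otimes> z \<in> H i" by (rule subgroup.m_closed[OF H])
    from \<xi>_X[OF this] \<xi>_X[OF yz(1)] \<xi>_X[OF yz(2)]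
    show "\<xi> (y \<otimes> z) \<omega> = \<xi> y \<omega> * \<xi> z \<omega>" using X[of i] yz unfolding random_def by simp
  qed
qed

section \<open>The Zak transform with random characters\<close>

lemma (in pair_sigma_finite) integral_pair_product:
  fixes g :: "'a \<Rightarrow> complex" and h :: "'b \<Rightarrow> complex"
  assumes g: "integrable M1 g" and h: "integrable M2 h"
  shows "integrable (M1 \<Otimes>\<^sub>M M2) (\<lambda>p. g (fst p) * h (snd p))"
    and "(\<integral>p. g (fst p) * h (snd p) \<partial>(M1 \<Otimes>\<^sub>M M2)) = (\<integral>x. g x \<partial>M1) * (\<integral>y. h y \<partial>M2)"
proof -
  have [measurable]: "g \<in> borel_measurable M1" "h \<in> borel_measurable M2"
    using g h by (auto intro: borel_measurable_integrable)
  show int: "integrable (M1 \<Otimes>\<^sub>M M2) (\<lambda>p. g (fst p) * h (snd p))"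
  proof (rule Fubini_integrable)
    have "(\<integral>y. norm (g (fst (x, y)) * h (snd (x, y))) \<partial>M2) = norm (g x) * (\<integral>y. norm (h y) \<partial>M2)" for x
      by (simp add: norm_mult)
    then show "integrable M1 (\<lambda>x. \<integral>y. norm (g (fst (x, y)) * h (snd (x, y))) \<partial>M2)" using g by simp
    show "AE x in M1. integrable M2 (\<lambda>y. g (fst (x, y)) * h (snd (x, y)))" using h by simp
  qed measurable
  have "(\<integral>p. g (fst p) * h (snd p) \<partial>(M1 \<Otimes>\<^sub>M M2)) = (\<integral>x. (\<integral>y. g x * h y \<partial>M2) \<partial>M1)"
    using integral_fst'[OF int] by simp
  also have "\<dots> = (\<integral>x. g x \<partial>M1) * (\<integral>y. h y \<partial>M2)" using h g by simp
  finally show "(\<integral>p. g (fst p) * h (snd p) \<partial>(M1 \<Otimes>\<^sub>M M2)) = (\<integral>x. g x \<partial>M1) * (\<integral>y. h y \<partial>M2)" .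
qed

text \<open>
  \<open>Q\<close> is a fundamental domain for the subgroup \<open>L\<close>, enumerated by \<open>e\<close>, and \<open>\<xi>\<close> a random character of \<open>L\<close>.
\<close>

locale lattice_model =
  fixes \<mu> :: "'g::{topological_ab_group_add, t2_space, second_countable_topology} measure"
    and L :: "'g set" and e :: "nat \<Rightarrow> 'g" and Q :: "'g set"
    and \<Omega> :: "'w measure" and \<xi> :: "'g \<Rightarrow> 'w \<Rightarrow> complex" and B :: "('g \<Rightarrow> complex) set"
  assumes sets_\<mu>: "sets \<mu> = sets borel"
    and translation_invariant: "\<And>a A. A \<in> sets borel \<Longrightarrow> emeasure \<mu> ((+) a ` A) = emeasure \<mu> A"
    and L_zero: "0 \<in> L" and L_add: "\<And>k l. k \<in> L \<Longrightarrow> l \<in> L \<Longrightarrow> k + l \<in> L"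
    and L_uminus: "\<And>l. l \<in> L \<Longrightarrow> - l \<in> L" and range_e: "range e = L"
    and Q_borel: "Q \<in> sets borel" and Q_finite: "emeasure \<mu> Q < \<infinity>"
    and Q_ex: "\<And>x. \<exists>l\<in>L. x + l \<in> Q" and Q_unique: "\<And>x k l. k \<in> L \<Longrightarrow> l \<in> L \<Longrightarrow> x + k \<in> Q \<Longrightarrow> x + l \<in> Q \<Longrightarrow> k = l"
    and prob_\<Omega>: "prob_space \<Omega>"
    and \<xi>_measurable: "\<And>l. l \<in> L \<Longrightarrow> \<xi> l \<in> borel_measurable \<Omega>"
    and \<xi>_norm: "\<And>l \<omega>. l \<in> L \<Longrightarrow> norm (\<xi> l \<omega>) = 1"
    and \<xi>_add: "\<And>k l \<omega>. k \<in> L \<Longrightarrow> l \<in> L \<Longrightarrow> \<xi> (k + l) \<omega> = \<xi> k \<omega> * \<xi> l \<omega>"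
    and \<xi>_mean: "\<And>l. l \<in> L \<Longrightarrow> l \<noteq> 0 \<Longrightarrow> (\<integral>\<omega>. \<xi> l \<omega> \<partial>\<Omega>) = 0"
    and B_measurable: "\<And>\<beta>. \<beta> \<in> B \<Longrightarrow> \<beta> \<in> borel_measurable borel"
    and B_norm: "\<And>\<beta> x. \<beta> \<in> B \<Longrightarrow> norm (\<beta> x) = 1"
    and B_add: "\<And>\<beta> x y. \<beta> \<in> B \<Longrightarrow> \<beta> (x + y) = \<beta> x * \<beta> y"
    and B_L: "\<And>\<beta> l. \<beta> \<in> B \<Longrightarrow> l \<in> L \<Longrightarrow> \<beta> l = 1"
    and B_one: "(\<lambda>_. 1) \<in> B"
    and B_mult: "\<And>\<alpha> \<beta>. \<alpha> \<in> B \<Longrightarrow> \<beta> \<in> B \<Longrightarrow> (\<lambda>x. \<alpha> x * \<beta> x) \<in> B"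
    and B_cnj: "\<And>\<beta>. \<beta> \<in> B \<Longrightarrow> (\<lambda>x. cnj (\<beta> x)) \<in> B"
begin

definition M :: "('g \<times> 'w) measure" where
  "M = restrict_space \<mu> Q \<Otimes>\<^sub>M \<Omega>"

text \<open>The cells \<open>Q - l\<close> with \<open>l \<in> L\<close> tile the group; \<open>cells A\<close> is the union of those with \<open>l \<in> A\<close>.\<close>

definition cells :: "'g set \<Rightarrow> 'g set" where
  "cells A = {x. \<exists>l\<in>A. x + l \<in> Q}"

definition zak_sum :: "'g set \<Rightarrow> ('g \<Rightarrow> complex) \<Rightarrow> 'g \<times> 'w \<Rightarrow> complex" where
  "zak_sum A f p = (\<Sum>l\<in>A. f (fst p - l) * \<xi> l (snd p))"

lemma space_\<mu>: "space \<mu> = UNIV"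
  using sets_eq_imp_space_eq[OF sets_\<mu>] by simp

lemma measurable_shift: "(\<lambda>x. x - l) \<in> measurable \<mu> \<mu>"
  unfolding measurable_cong_sets[OF sets_\<mu> sets_\<mu>]
  by (intro borel_measurable_continuous_onI continuous_intros)

lemma distr_shift: "distr \<mu> \<mu> (\<lambda>x. x - l) = \<mu>"
proof (rule measure_eqI)
  fix A assume "A \<in> sets (distr \<mu> \<mu> (\<lambda>x. x - l))"
  then have A: "A \<in> sets \<mu>" by simp
  have "(\<lambda>x. x - l) -` A \<inter> space \<mu> = (+) l ` A"
    unfolding space_\<mu> by (auto simp: image_iff algebra_simps intro!: bexI[of _ "_ - l"])
  then show "emeasure (distr \<mu> \<mu> (\<lambda>x. x - l)) A = emeasure \<mu> A"
    using A by (simp add: emeasure_distr[OF measurable_shift] translation_invariant sets_\<mu>)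
qed simp

lemma integral_shift:
  fixes h :: "'g \<Rightarrow> real"
  assumes "integrable \<mu> h"
  shows "integrable \<mu> (\<lambda>x. h (x - l))" "(\<integral>x. h (x - l) \<partial>\<mu>) = (\<integral>x. h x \<partial>\<mu>)"
  using integrable_distr_eq[OF measurable_shift borel_measurable_integrable[OF assms], of l]
    integral_distr[OF measurable_shift borel_measurable_integrable[OF assms], of l] assms
  by (simp_all add: distr_shift)

lemma shift_L2: "f \<in> L2 \<mu> \<Longrightarrow> (\<lambda>x. f (x - l)) \<in> L2 \<mu>"
  unfolding L2_def mem_Collect_eq
  using measurable_compose[OF measurable_shift] integral_shift(1) by blast

lemma B_measurable_\<mu>: "\<beta> \<in> B \<Longrightarrow> \<beta> \<in> borel_measurable \<mu>"
  unfolding measurable_cong_sets[OF sets_\<mu> refl] by (rule B_measurable)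

lemma B_minus_L: "\<beta> \<in> B \<Longrightarrow> l \<in> L \<Longrightarrow> \<beta> (x - l) = \<beta> x"
  using B_add[of \<beta> x "- l"] B_L[of \<beta> "- l"] L_uminus[of l] by simp

lemma Q_sets: "Q \<in> sets \<mu>"
  unfolding sets_\<mu> by (rule Q_borel)

lemma Q_sets': "Q \<inter> space \<mu> \<in> sets \<mu>"
  by (simp add: space_\<mu> Q_sets)

lemma finite_restrict: "finite_measure (restrict_space \<mu> Q)"
proof (rule finite_measureI)
  have "space (restrict_space \<mu> Q) = Q" by (simp add: space_restrict_space space_\<mu>)
  then have "emeasure (restrict_space \<mu> Q) (space (restrict_space \<mu> Q)) = emeasure \<mu> Q"
    by (simp only: emeasure_restrict_space[OF Q_sets' order_refl])
  then show "emeasure (restrict_space \<mu> Q) (space (restrict_space \<mu> Q)) \<noteq> \<infinity>" using Q_finite by simp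
qed

lemma finite_M: "finite_measure M"
  unfolding M_def by (rule finite_measure_pair_measure[OF prob_space.finite_measure[OF prob_\<Omega>] finite_restrict])

lemma pair_sigma_finite_M: "pair_sigma_finite (restrict_space \<mu> Q) \<Omega>"
  unfolding pair_sigma_finite_def
  using finite_measure.axioms(1)[OF finite_restrict] prob_space_imp_sigma_finite[OF prob_\<Omega>] by blast

lemma L2_restrict:
  assumes f: "f \<in> L2 \<mu>" shows "f \<in> L2 (restrict_space \<mu> Q)"
  unfolding L2_def mem_Collect_eq
proof
  show "f \<in> borel_measurable (restrict_space \<mu> Q)" by (rule measurable_restrict_space1[OF L2_measurable[OF f]])
  show "integrable (restrict_space \<mu> Q) (\<lambda>x. (norm (f x))\<^sup>2)"
    unfolding integrable_restrict_space[OF Q_sets']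
    by (rule integrable_mult_indicator[OF Q_sets L2_integrable_sq[OF f]])
qed

lemma cells_borel:
  assumes "finite A" shows "cells A \<in> sets \<mu>"
proof -
  have "cells A = (\<Union>l\<in>A. (\<lambda>x. x - (- l)) -` Q \<inter> space \<mu>)" by (auto simp: cells_def space_\<mu>)
  also have "\<dots> \<in> sets \<mu>"
    using assms Q_borel by (intro sets.finite_UN measurable_sets[OF measurable_shift]) (auto simp: sets_\<mu>)
  finally show ?thesis .
qed

lemma \<xi>_zero: "\<xi> 0 = (\<lambda>_. 1)"
proof
  show "\<xi> 0 \<omega> = 1" for \<omega>
    using \<xi>_add[OF L_zero L_zero, of \<omega>] \<xi>_norm[OF L_zero, of \<omega>] by auto
qed

lemma \<xi>_uminus:
  assumes l: "l \<in> L" shows "\<xi> (- l) \<omega> = cnj (\<xi> l \<omega>)"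
proof -
  have "\<xi> l \<omega> * \<xi> (- l) \<omega> = 1" using \<xi>_add[OF l L_uminus[OF l], of \<omega>] \<xi>_zero by simp
  moreover have "\<xi> l \<omega> * cnj (\<xi> l \<omega>) = 1" using \<xi>_norm[OF l, of \<omega>] by (simp add: complex_norm_square[symmetric])
  moreover have "\<xi> l \<omega> \<noteq> 0" using \<xi>_norm[OF l, of \<omega>] by auto
  ultimately show ?thesis by (metis mult_left_cancel)
qed

lemma \<xi>_integrable: "l \<in> L \<Longrightarrow> integrable \<Omega> (\<xi> l)"
  using \<xi>_measurable \<xi>_norm prob_\<Omega>
  by (intro finite_measure.integrable_const_bound[where B=1]) (auto simp: prob_space.finite_measure)

lemma \<xi>_orthonormal:
  assumes "k \<in> L" "l \<in> L"
  shows "integrable \<Omega> (\<lambda>\<omega>. \<xi> k \<omega> * cnj (\<xi> l \<omega>))" "(\<integral>\<omega>. \<xi> k \<omega> * cnj (\<xi> l \<omega>) \<partial>\<Omega>) = (if k = l then 1 else 0)"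
proof -
  have eq: "(\<lambda>\<omega>. \<xi> k \<omega> * cnj (\<xi> l \<omega>)) = \<xi> (k - l)"
    using \<xi>_add[OF assms(1) L_uminus[OF assms(2)]] \<xi>_uminus[OF assms(2)] by (auto simp: fun_eq_iff)
  have kl: "k - l \<in> L" using L_add[OF assms(1) L_uminus[OF assms(2)]] by simp
  show "integrable \<Omega> (\<lambda>\<omega>. \<xi> k \<omega> * cnj (\<xi> l \<omega>))" unfolding eq by (rule \<xi>_integrable[OF kl])
  show "(\<integral>\<omega>. \<xi> k \<omega> * cnj (\<xi> l \<omega>) \<partial>\<Omega>) = (if k = l then 1 else 0)"
    unfolding eq using \<xi>_mean[OF kl] prob_space.prob_space[OF prob_\<Omega>] by (auto simp: \<xi>_zero)
qed

text \<open>
  Orthonormality of the random variables \<open>\<xi> l\<close> reduces the squared norm to a sum of integrals of \<open>|f (x - l)|\<^sup>2\<close> over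
  \<open>Q\<close>, which are the integrals of \<open>|f|\<^sup>2\<close> over the disjoint cells \<open>Q - l\<close>.
\<close>

lemma zak_sum_norm:
  assumes f: "f \<in> L2 \<mu>" and A: "finite A" "A \<subseteq> L"
  shows "zak_sum A f \<in> L2 M" "norm_L2 M (zak_sum A f) = norm_L2 \<mu> (\<lambda>x. indicator (cells A) x * f x)"
proof -
  interpret pair_sigma_finite "restrict_space \<mu> Q" \<Omega> by (rule pair_sigma_finite_M)
  define g where "g l = (\<lambda>x. f (x - l))" for l
  have gL: "g l \<in> L2 (restrict_space \<mu> Q)" for l unfolding g_def by (intro L2_restrict shift_L2 f)
  have gm: "g l \<in> borel_measurable (restrict_space \<mu> Q)" for l using gL by (rule L2_measurable)
  define T where "T k l p = (g k (fst p) * cnj (g l (fst p))) * (\<xi> k (snd p) * cnj (\<xi> l (snd p)))" for k l and p :: "'g \<times> 'w"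
  have T: "integrable M (T k l)" "(\<integral>p. T k l p \<partial>M) = (if k = l then \<integral>x. g l x * cnj (g l x) \<partial>restrict_space \<mu> Q else 0)"
    if "k \<in> A" "l \<in> A" for k l
    using integral_pair_product[OF L2_integrable_mult_cnj[OF gL gL, of k l] \<xi>_orthonormal(1), of k l]
      \<xi>_orthonormal(2)[of k l] that A unfolding T_def M_def by (auto simp: subset_iff)
  have sq: "complex_of_real ((norm (zak_sum A f p))\<^sup>2) = (\<Sum>k\<in>A. \<Sum>l\<in>A. T k l p)" for p
    unfolding complex_norm_square zak_sum_def cnj_sum complex_cnj_mult sum_product T_def g_def
    by (intro sum.cong refl) (simp only: mult_ac)
  have int: "integrable M (\<lambda>p. complex_of_real ((norm (zak_sum A f p))\<^sup>2))"
    unfolding sq by (intro Bochner_Integration.integrable_sum T(1))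
  have meas: "zak_sum A f \<in> borel_measurable M"
    unfolding zak_sum_def M_def
  proof (intro borel_measurable_sum borel_measurable_times)
    fix l assume "l \<in> A"
    then have \<xi>: "\<xi> l \<in> borel_measurable \<Omega>" using A \<xi>_measurable by blast
    show "(\<lambda>p. f (fst p - l)) \<in> borel_measurable (restrict_space \<mu> Q \<Otimes>\<^sub>M \<Omega>)"
      using measurable_compose[OF measurable_fst gm[of l]] by (simp add: g_def)
    show "(\<lambda>p. \<xi> l (snd p)) \<in> borel_measurable (restrict_space \<mu> Q \<Otimes>\<^sub>M \<Omega>)"
      by (rule measurable_compose[OF measurable_snd \<xi>])
  qed
  from int have int': "integrable M (\<lambda>p. (norm (zak_sum A f p))\<^sup>2)" by (simp only: complex_of_real_integrable_eq)
  with meas show "zak_sum A f \<in> L2 M" by (simp add: L2_def)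
  define E where "E l = (\<lambda>x. indicator (cells {l}) x * (norm (f x))\<^sup>2)" for l
  have Ei: "integrable \<mu> (E l)" for l
    unfolding E_def using integrable_mult_indicator[OF cells_borel[of "{l}"] L2_integrable_sq[OF f]] by simp
  have "complex_of_real ((norm_L2 M (zak_sum A f))\<^sup>2) = (\<integral>p. complex_of_real ((norm (zak_sum A f p))\<^sup>2) \<partial>M)"
    unfolding norm_L2_sq by (rule integral_complex_of_real[symmetric])
  also have "\<dots> = (\<Sum>k\<in>A. \<Sum>l\<in>A. \<integral>p. T k l p \<partial>M)"
    unfolding sq
    by (simp only: Bochner_Integration.integral_sum Bochner_Integration.integrable_sum T(1) cong: sum.cong)
  also have "\<dots> = (\<Sum>k\<in>A. \<integral>x. g k x * cnj (g k x) \<partial>restrict_space \<mu> Q)"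
    using A by (simp add: T(2) cong: sum.cong)
  also have "\<dots> = (\<Sum>k\<in>A. complex_of_real (\<integral>x. E k x \<partial>\<mu>))"
  proof (rule sum.cong[OF refl])
    fix k
    have "(\<integral>x. g k x * cnj (g k x) \<partial>restrict_space \<mu> Q) = (\<integral>x. complex_of_real ((norm (g k x))\<^sup>2) \<partial>restrict_space \<mu> Q)"
      unfolding complex_norm_square ..
    also have "\<dots> = complex_of_real (\<integral>x. (norm (g k x))\<^sup>2 \<partial>restrict_space \<mu> Q)"
      by (rule integral_complex_of_real)
    also have "(\<integral>x. (norm (g k x))\<^sup>2 \<partial>restrict_space \<mu> Q) = (\<integral>x. indicator Q x *\<^sub>R (norm (g k x))\<^sup>2 \<partial>\<mu>)"
      using Q_borel by (intro integral_restrict_space) (simp add: sets_\<mu> space_\<mu>)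
    also have "\<dots> = (\<integral>x. E k (x - k) \<partial>\<mu>)"
      unfolding E_def g_def by (rule Bochner_Integration.integral_cong) (auto simp: cells_def indicator_def)
    also have "\<dots> = (\<integral>x. E k x \<partial>\<mu>)" by (rule integral_shift(2)[OF Ei])
    finally show "(\<integral>x. g k x * cnj (g k x) \<partial>restrict_space \<mu> Q) = complex_of_real (\<integral>x. E k x \<partial>\<mu>)" .
  qed
  also have "\<dots> = complex_of_real (\<integral>x. (\<Sum>k\<in>A. E k x) \<partial>\<mu>)"
    by (simp add: Bochner_Integration.integral_sum Ei)
  also have "(\<lambda>x. \<Sum>k\<in>A. E k x) = (\<lambda>x. (norm (indicator (cells A) x * f x))\<^sup>2)"
  proof
    fix x
    show "(\<Sum>k\<in>A. E k x) = (norm (indicator (cells A) x * f x))\<^sup>2"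
    proof (cases "x \<in> cells A")
      case True
      then obtain l where l: "l \<in> A" "x + l \<in> Q" by (auto simp: cells_def)
      have "E k x = (if k = l then (norm (f x))\<^sup>2 else 0)" if "k \<in> A" for k
        using Q_unique[of k l x] l that A by (auto simp: E_def cells_def indicator_def)
      then have "(\<Sum>k\<in>A. E k x) = (\<Sum>k\<in>A. if k = l then (norm (f x))\<^sup>2 else 0)" by (rule sum.cong[OF refl])
      then show ?thesis using True l A by simp
    next
      case False
      then have "E k x = 0" if "k \<in> A" for k using that by (auto simp: E_def cells_def)
      with False show ?thesis by simp
    qed
  qed
  finally have "(norm_L2 M (zak_sum A f))\<^sup>2 = (norm_L2 \<mu> (\<lambda>x. indicator (cells A) x * f x))\<^sup>2"
    unfolding norm_L2_sq of_real_eq_iff .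
  then show "norm_L2 M (zak_sum A f) = norm_L2 \<mu> (\<lambda>x. indicator (cells A) x * f x)"
    by (simp add: power2_eq_iff_nonneg)
qed

definition tail_norm :: "'g set \<Rightarrow> ('g \<Rightarrow> complex) \<Rightarrow> real" where
  "tail_norm A f = norm_L2 \<mu> (\<lambda>x. indicator (- cells A) x * f x)"

text \<open>
  The shift by \<open>k\<close> is needed for the intertwining property, where translating \<open>f\<close> shifts the set of summation
  indices.
\<close>

lemma tail_norm_tendsto:
  assumes f: "f \<in> L2 \<mu>" and k: "k \<in> L"
  shows "(\<lambda>n. tail_norm ((\<lambda>i. e i + k) ` {..<n}) f) \<longlonglongrightarrow> 0"
  unfolding tail_norm_def
proof (rule norm_L2_mult_tendsto_0[OF f])
  fix x :: 'g
  obtain l where l: "l \<in> L" "x + l \<in> Q" using Q_ex by blast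
  then have "l - k \<in> L" using L_add[OF l(1) L_uminus[OF k]] by simp
  then obtain i where i: "e i = l - k" using range_e by (metis imageE)
  have "x \<in> cells ((\<lambda>i. e i + k) ` {..<n})" if "n > i" for n
    using l(2) that i by (auto simp: cells_def intro!: bexI[of _ i])
  then have "\<forall>\<^sub>F n in sequentially. indicator (- cells ((\<lambda>i. e i + k) ` {..<n})) x = (0::complex)"
    unfolding eventually_sequentially by (intro exI[of _ "Suc i"]) auto
  then show "(\<lambda>n. indicator (- cells ((\<lambda>i. e i + k) ` {..<n})) x :: complex) \<longlonglongrightarrow> 0"
    by (rule tendsto_eventually)
next
  show "(\<lambda>x. indicator (- cells ((\<lambda>i. e i + k) ` {..<n})) x :: complex) \<in> borel_measurable \<mu>" for n
    using sets.compl_sets[OF cells_borel[of "(\<lambda>i. e i + k) ` {..<n}"]]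
    by (intro borel_measurable_indicator) (simp add: space_\<mu> Compl_eq_Diff_UNIV)
  show "norm (indicator (- cells ((\<lambda>i. e i + k) ` {..<n})) x :: complex) \<le> 1" for n x
    by (simp add: indicator_def)
qed

definition initial :: "nat \<Rightarrow> 'g set" where
  "initial n = e ` {..<n}"

lemma initial_L: "finite (initial n)" "initial n \<subseteq> L"
  using range_e by (auto simp: initial_def)

lemma initial_mono: "i \<le> j \<Longrightarrow> initial i \<subseteq> initial j"
  by (auto simp: initial_def)

lemma initial_exhausts:
  assumes "finite A" "A \<subseteq> L" obtains n where "A \<subseteq> initial n"
proof -
  have "\<exists>n. A \<subseteq> initial n" using assms
  proof (induction A rule: finite_induct)
    case (insert l A)
    then obtain n where n: "A \<subseteq> initial n" by auto
    obtain i where "l = e i" using insert.prems range_e by auto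
    then have "insert l A \<subseteq> initial (max n (Suc i))"
      using n initial_mono[of n "max n (Suc i)"] by (auto simp: initial_def)
    then show ?case by blast
  qed simp
  then show ?thesis using that by blast
qed

lemma tail_norm_initial: "f \<in> L2 \<mu> \<Longrightarrow> (\<lambda>n. tail_norm (initial n) f) \<longlonglongrightarrow> 0"
  using tail_norm_tendsto[OF _ L_zero, of f] by (simp add: initial_def)

lemma indicator_L2:
  assumes "f \<in> L2 \<mu>" "finite A"
  shows "(\<lambda>x. indicator (cells A) x * f x) \<in> L2 \<mu>" "(\<lambda>x. indicator (- cells A) x * f x) \<in> L2 \<mu>"
proof -
  have "- cells A \<in> sets \<mu>" using sets.compl_sets[OF cells_borel[OF assms(2)]] by (simp add: space_\<mu> Compl_eq_Diff_UNIV)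
  then show "(\<lambda>x. indicator (cells A) x * f x) \<in> L2 \<mu>" "(\<lambda>x. indicator (- cells A) x * f x) \<in> L2 \<mu>"
    using cells_borel[OF assms(2)]
    by (auto intro!: L2_bounded_mult[OF assms(1), of _ 1] borel_measurable_indicator simp: indicator_def)
qed

lemma zak_sum_diff_le:
  assumes f: "f \<in> L2 \<mu>" and A: "finite A" "A \<subseteq> L" and D: "finite D" "D \<subseteq> L" "A \<subseteq> D"
  shows "norm_L2 M (zak_sum D f - zak_sum A f) \<le> tail_norm A f"
proof -
  have "zak_sum D f - zak_sum A f = zak_sum (D - A) f"
    by (simp add: zak_sum_def fun_eq_iff sum_diff[OF D(1,3)])
  then have "norm_L2 M (zak_sum D f - zak_sum A f) = norm_L2 \<mu> (\<lambda>x. indicator (cells (D - A)) x * f x)"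
    using zak_sum_norm(2)[OF f, of "D - A"] D by auto
  also have "\<dots> = norm_L2 \<mu> (\<lambda>x. indicator (cells (D - A)) x * (indicator (- cells A) x * f x))"
  proof -
    have "indicator (cells (D - A)) x = indicator (cells (D - A)) x * (indicator (- cells A) x :: complex)" for x
      using Q_unique[of _ _ x] A D by (auto simp: cells_def indicator_def subset_iff)
    then have "(\<lambda>x. indicator (cells (D - A)) x * f x) = (\<lambda>x. indicator (cells (D - A)) x * (indicator (- cells A) x * f x))"
      unfolding mult.assoc[symmetric] by (intro ext arg_cong2[where f = "(*)"] refl)
    then show ?thesis by (rule arg_cong)
  qed
  also have "\<dots> \<le> 1 * tail_norm A f"
    unfolding tail_norm_def using cells_borel[of "D - A"] D
    by (intro norm_L2_bounded_mult indicator_L2 f A borel_measurable_indicator) (auto simp: indicator_def)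
  finally show ?thesis by simp
qed

text \<open>
  The series converges unconditionally. Stating the rate of convergence for all finite sets of indices keeps
  the limit independent of the enumeration \<open>e\<close>.
\<close>

definition zak_limit :: "('g \<Rightarrow> complex) \<Rightarrow> ('g \<times> 'w \<Rightarrow> complex) \<Rightarrow> bool" where
  "zak_limit f h \<longleftrightarrow> h \<in> L2 M \<and> (\<forall>A. finite A \<longrightarrow> A \<subseteq> L \<longrightarrow> norm_L2 M (h - zak_sum A f) \<le> tail_norm A f)"

lemma ex_zak_limit:
  assumes f: "f \<in> L2 \<mu>" shows "\<exists>h. zak_limit f h"
proof -
  define h where "h n = zak_sum (initial n) f" for n
  have hL: "h n \<in> L2 M" for n unfolding h_def by (rule zak_sum_norm(1)[OF f initial_L])
  have close: "norm_L2 M (h j - h i) \<le> tail_norm (initial i) f" if "i \<le> j" for i j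
    unfolding h_def by (rule zak_sum_diff_le[OF f initial_L initial_L initial_mono[OF that]])
  have cau: "\<exists>N. \<forall>i\<ge>N. \<forall>j\<ge>N. norm_L2 M (h i - h j) < r" if r: "0 < r" for r
  proof -
    obtain N where N: "tail_norm (initial N) f < r / 2"
      using order_tendstoD(2)[OF tail_norm_initial[OF f] half_gt_zero[OF r]] by (auto simp: eventually_sequentially)
    have "norm_L2 M (h i - h j) < r" if "i \<ge> N" "j \<ge> N" for i j
      using norm_L2_triangle_diff[OF hL[of i] hL[of N] hL[of j]] close[OF that(1)] close[OF that(2)] N
        norm_L2_minus_commute[of M "h N" "h j"] by linarith
    then show ?thesis by blast
  qed
  obtain g where g: "g \<in> L2 M" "(\<lambda>n. norm_L2 M (h n - g)) \<longlonglongrightarrow> 0" using L2_complete[OF hL cau] .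
  have "norm_L2 M (g - zak_sum A f) \<le> tail_norm A f" if A: "finite A" "A \<subseteq> L" for A
  proof -
    obtain N where N: "A \<subseteq> initial N" using initial_exhausts[OF A] .
    have le: "norm_L2 M (g - zak_sum A f) \<le> norm_L2 M (h n - g) + tail_norm A f" if n: "n \<ge> N" for n
    proof -
      have "norm_L2 M (h n - zak_sum A f) \<le> tail_norm A f"
        unfolding h_def by (rule zak_sum_diff_le[OF f A initial_L order_trans[OF N initial_mono[OF n]]])
      then show ?thesis
        using norm_L2_triangle_diff[OF g(1) hL zak_sum_norm(1)[OF f A], of n] norm_L2_minus_commute[of M g "h n"]
        by linarith
    qed
    have "(\<lambda>n. norm_L2 M (h n - g) + tail_norm A f) \<longlonglongrightarrow> 0 + tail_norm A f"
      by (intro tendsto_add g(2) tendsto_const)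
    then have "norm_L2 M (g - zak_sum A f) \<le> 0 + tail_norm A f"
      by (rule LIMSEQ_le_const) (intro exI[of _ N] allI impI le)
    then show ?thesis by simp
  qed
  with g(1) show ?thesis unfolding zak_limit_def by blast
qed

definition zak :: "('g \<Rightarrow> complex) \<Rightarrow> 'g \<times> 'w \<Rightarrow> complex" where
  "zak f = (SOME h. zak_limit f h)"

lemma zak_limit_zak: "f \<in> L2 \<mu> \<Longrightarrow> zak_limit f (zak f)"
  unfolding zak_def by (rule someI_ex[OF ex_zak_limit])

lemma zak_L2: "f \<in> L2 \<mu> \<Longrightarrow> zak f \<in> L2 M"
  using zak_limit_zak unfolding zak_limit_def by blast

lemma zak_tail: "f \<in> L2 \<mu> \<Longrightarrow> finite A \<Longrightarrow> A \<subseteq> L \<Longrightarrow> norm_L2 M (zak f - zak_sum A f) \<le> tail_norm A f"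
  using zak_limit_zak unfolding zak_limit_def by blast

lemma zak_tendsto:
  assumes f: "f \<in> L2 \<mu>" shows "(\<lambda>n. norm_L2 M (zak f - zak_sum (initial n) f)) \<longlonglongrightarrow> 0"
  by (rule tendsto_sandwich[OF _ _ tendsto_const tail_norm_initial[OF f]])
    (use zak_tail[OF f initial_L] in auto)

text \<open>Identities for the transform, such as its linearity and the action of translations and
  modulations, can therefore be checked on finite sums, where they are direct computations.\<close>

lemma zak_eqI:
  assumes f: "f \<in> L2 \<mu>" and h: "h \<in> L2 M" and lim: "(\<lambda>n. norm_L2 M (h - zak_sum (initial n) f)) \<longlonglongrightarrow> 0"
  shows "AE p in M. zak f p = h p"
proof -
  have le: "norm_L2 M (zak f - h) \<le> norm_L2 M (zak f - zak_sum (initial n) f) + norm_L2 M (h - zak_sum (initial n) f)" for n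
    using norm_L2_triangle_diff[OF zak_L2[OF f] zak_sum_norm(1)[OF f initial_L] h, of n]
      norm_L2_minus_commute[of M h] by simp
  have "(\<lambda>n. norm_L2 M (zak f - zak_sum (initial n) f) + norm_L2 M (h - zak_sum (initial n) f)) \<longlonglongrightarrow> 0 + 0"
    by (intro tendsto_add zak_tendsto[OF f] lim)
  then have "norm_L2 M (zak f - h) \<le> 0 + 0"
    by (rule LIMSEQ_le_const) (intro exI[of _ 0] allI impI le)
  then have "norm_L2 M (zak f - h) = 0" using norm_L2_nonneg[of M "zak f - h"] by linarith
  from norm_L2_eq_0_AE[OF this L2_diff[OF zak_L2[OF f] h]] show ?thesis by simp
qed

lemma zak_norm:
  assumes f: "f \<in> L2 \<mu>" shows "norm_L2 M (zak f) = norm_L2 \<mu> f"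
proof -
  have le: "\<bar>norm_L2 M (zak f) - norm_L2 \<mu> f\<bar> \<le> tail_norm (initial n) f + tail_norm (initial n) f" for n
  proof -
    have "\<bar>norm_L2 M (zak f) - norm_L2 M (zak_sum (initial n) f)\<bar> \<le> tail_norm (initial n) f"
      using norm_L2_abs_diff[OF zak_L2[OF f] zak_sum_norm(1)[OF f initial_L], of n] zak_tail[OF f initial_L, of n]
      by linarith
    moreover have "f - (\<lambda>x. indicator (cells (initial n)) x * f x) = (\<lambda>x. indicator (- cells (initial n)) x * f x)"
      by (auto simp: fun_eq_iff indicator_def)
    then have "\<bar>norm_L2 \<mu> f - norm_L2 M (zak_sum (initial n) f)\<bar> \<le> tail_norm (initial n) f"
      unfolding zak_sum_norm(2)[OF f initial_L] tail_norm_def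
      using norm_L2_abs_diff[OF f indicator_L2(1)[OF f initial_L(1)], of n] by simp
    ultimately show ?thesis by linarith
  qed
  have "(\<lambda>n. tail_norm (initial n) f + tail_norm (initial n) f) \<longlonglongrightarrow> 0 + 0"
    by (intro tendsto_add tail_norm_initial[OF f])
  then have "\<bar>norm_L2 M (zak f) - norm_L2 \<mu> f\<bar> \<le> 0 + 0"
    by (rule LIMSEQ_le_const) (intro exI[of _ 0] allI impI le)
  then show ?thesis by simp
qed

lemma zak_add:
  assumes f: "f \<in> L2 \<mu>" and g: "g \<in> L2 \<mu>"
  shows "AE p in M. zak (f + g) p = zak f p + zak g p"
proof -
  have "AE p in M. zak (f + g) p = (zak f + zak g) p"
  proof (rule zak_eqI[OF L2_add[OF f g] L2_add[OF zak_L2[OF f] zak_L2[OF g]]])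
    have eq: "(zak f + zak g) - zak_sum (initial n) (f + g) = (zak f - zak_sum (initial n) f) + (zak g - zak_sum (initial n) g)" for n
      by (simp add: fun_eq_iff zak_sum_def distrib_right sum.distrib)
    have le: "norm_L2 M ((zak f + zak g) - zak_sum (initial n) (f + g))
        \<le> norm_L2 M (zak f - zak_sum (initial n) f) + norm_L2 M (zak g - zak_sum (initial n) g)" for n
      unfolding eq by (intro norm_L2_triangle L2_diff zak_L2 zak_sum_norm(1) f g initial_L)
    show "(\<lambda>n. norm_L2 M ((zak f + zak g) - zak_sum (initial n) (f + g))) \<longlonglongrightarrow> 0"
      by (rule tendsto_sandwich[OF _ _ tendsto_const tendsto_add_zero[OF zak_tendsto[OF f] zak_tendsto[OF g]]])
        (intro always_eventually allI norm_L2_nonneg le)+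
  qed
  then show ?thesis by simp
qed

lemma zak_scale:
  assumes f: "f \<in> L2 \<mu>"
  shows "AE p in M. zak (\<lambda>x. c * f x) p = c * zak f p"
proof (rule zak_eqI[OF L2_scale[OF f] L2_scale[OF zak_L2[OF f]]])
  have eq: "(\<lambda>p. c * zak f p) - zak_sum (initial n) (\<lambda>x. c * f x) = (\<lambda>p. c * (zak f - zak_sum (initial n) f) p)" for n
    by (simp add: fun_eq_iff zak_sum_def right_diff_distrib sum_distrib_left mult.assoc)
  show "(\<lambda>n. norm_L2 M ((\<lambda>p. c * zak f p) - zak_sum (initial n) (\<lambda>x. c * f x))) \<longlonglongrightarrow> 0"
    unfolding eq norm_L2_scale by (rule tendsto_mult_right_zero[OF zak_tendsto[OF f]])
qed

text \<open>The multiplier that represents \<open>T\<^sub>k M\<^sub>\<beta>\<close> after the transform.\<close>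

definition symbol :: "'g \<Rightarrow> ('g \<Rightarrow> complex) \<Rightarrow> 'g \<times> 'w \<Rightarrow> complex" where
  "symbol k \<beta> p = \<beta> (fst p) * \<xi> (- k) (snd p)"

lemma symbol_norm: "k \<in> L \<Longrightarrow> \<beta> \<in> B \<Longrightarrow> norm (symbol k \<beta> p) = 1"
  by (simp add: symbol_def norm_mult B_norm \<xi>_norm L_uminus)

lemma symbol_measurable:
  assumes "k \<in> L" "\<beta> \<in> B" shows "symbol k \<beta> \<in> borel_measurable M"
  unfolding symbol_def M_def
  by (intro borel_measurable_times measurable_compose[OF measurable_fst measurable_restrict_space1[OF B_measurable_\<mu>[OF assms(2)]]]
      measurable_compose[OF measurable_snd \<xi>_measurable[OF L_uminus[OF assms(1)]]])

lemma translation_modulation_L2: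
  assumes f: "f \<in> L2 \<mu>" and \<beta>: "\<beta> \<in> B" shows "translation k (modulation \<beta> f) \<in> L2 \<mu>"
proof -
  have "(\<lambda>x. \<beta> x * f x) \<in> L2 \<mu>"
    using B_norm[OF \<beta>] by (intro L2_bounded_mult[OF f B_measurable_\<mu>[OF \<beta>], of 1]) simp
  from shift_L2[OF this, of k] show ?thesis by (simp add: translation_def modulation_def)
qed

text \<open>
  Translation by \<open>k\<close> re-indexes the sum, at the price of the factor \<open>\<xi> (- k)\<close>, and \<open>\<beta>\<close> can be taken out of the
  sum because it is constant on the cosets of \<open>L\<close>.
\<close>

lemma zak_intertwines:
  assumes f: "f \<in> L2 \<mu>" and k: "k \<in> L" and \<beta>: "\<beta> \<in> B"
  shows "AE p in M. zak (translation k (modulation \<beta> f)) p = symbol k \<beta> p * zak f p"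
proof (rule zak_eqI[OF translation_modulation_L2[OF f \<beta>]])
  have mult: "(\<lambda>p. symbol k \<beta> p * h p) \<in> L2 M" "norm_L2 M (\<lambda>p. symbol k \<beta> p * h p) \<le> 1 * norm_L2 M h"
    if "h \<in> L2 M" for h
    using symbol_norm[OF k \<beta>]
    by (intro L2_bounded_mult[OF that symbol_measurable[OF k \<beta>], of 1] norm_L2_bounded_mult[OF that symbol_measurable[OF k \<beta>]]; simp)+
  show "(\<lambda>p. symbol k \<beta> p * zak f p) \<in> L2 M" by (rule mult(1)[OF zak_L2[OF f]])
  define A where "A n = (\<lambda>i. e i + k) ` {..<n}" for n
  have A: "finite (A n)" "A n \<subseteq> L" for n using range_e L_add[OF _ k] by (auto simp: A_def)
  have sum_eq: "zak_sum (initial n) (translation k (modulation \<beta> f)) p = symbol k \<beta> p * zak_sum (A n) f p" for n p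
  proof -
    have An: "A n = (\<lambda>l. l + k) ` initial n" by (auto simp: A_def initial_def)
    have inj: "inj_on (\<lambda>l. l + k) (initial n)" by (auto simp: inj_on_def)
    have "symbol k \<beta> p * zak_sum (A n) f p = (\<Sum>l\<in>initial n. symbol k \<beta> p * (f (fst p - (l + k)) * \<xi> (l + k) (snd p)))"
      unfolding zak_sum_def An sum.reindex[OF inj] comp_def by (rule sum_distrib_left)
    also have "\<dots> = (\<Sum>l\<in>initial n. translation k (modulation \<beta> f) (fst p - l) * \<xi> l (snd p))"
    proof (rule sum.cong[OF refl])
      fix l assume "l \<in> initial n"
      then have l: "l \<in> L" using initial_L by blast
      have "\<beta> (fst p - (l + k)) = \<beta> (fst p)" by (rule B_minus_L[OF \<beta> L_add[OF l k]])
      moreover have "\<xi> l (snd p) = \<xi> (l + k) (snd p) * \<xi> (- k) (snd p)"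
        using \<xi>_add[OF L_add[OF l k] L_uminus[OF k], of "snd p"] by simp
      moreover have "fst p - l - k = fst p - (l + k)" by (rule diff_diff_eq)
      ultimately show "symbol k \<beta> p * (f (fst p - (l + k)) * \<xi> (l + k) (snd p)) = translation k (modulation \<beta> f) (fst p - l) * \<xi> l (snd p)"
        by (simp only: symbol_def translation_def modulation_def mult_ac)
    qed
    finally show ?thesis by (simp add: zak_sum_def)
  qed
  have le: "norm_L2 M ((\<lambda>p. symbol k \<beta> p * zak f p) - zak_sum (initial n) (translation k (modulation \<beta> f))) \<le> tail_norm (A n) f" for n
  proof -
    have "(\<lambda>p. symbol k \<beta> p * zak f p) - zak_sum (initial n) (translation k (modulation \<beta> f)) = (\<lambda>p. symbol k \<beta> p * (zak f - zak_sum (A n) f) p)"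
      by (simp add: fun_eq_iff sum_eq right_diff_distrib)
    then show ?thesis
      using mult(2)[OF L2_diff[OF zak_L2[OF f] zak_sum_norm(1)[OF f A]], of n] zak_tail[OF f A, of n] by simp
  qed
  show "(\<lambda>n. norm_L2 M ((\<lambda>p. symbol k \<beta> p * zak f p) - zak_sum (initial n) (translation k (modulation \<beta> f)))) \<longlonglongrightarrow> 0"
    by (rule tendsto_sandwich[OF _ _ tendsto_const tail_norm_tendsto[OF f k, folded A_def]])
      (intro always_eventually allI norm_L2_nonneg le)+
qed

end

section \<open>Transfer to the lattice action\<close>

context lattice_model
begin

definition symbols :: "('g \<times> 'w \<Rightarrow> complex) set" where
  "symbols = {symbol k \<beta> | k \<beta>. k \<in> L \<and> \<beta> \<in> B}"

sublocale unimodular_group M symbols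
proof (intro unimodular_group.intro finite_M unimodular_group_axioms.intro)
  fix \<gamma> assume "\<gamma> \<in> symbols"
  then obtain k \<beta> where k: "k \<in> L" and \<beta>: "\<beta> \<in> B" and \<gamma>: "\<gamma> = symbol k \<beta>" unfolding symbols_def by blast
  show "\<gamma> \<in> borel_measurable M" unfolding \<gamma> by (rule symbol_measurable[OF k \<beta>])
  show "norm (\<gamma> p) = 1" for p unfolding \<gamma> by (rule symbol_norm[OF k \<beta>])
  have "(\<lambda>p. cnj (\<gamma> p)) = symbol (- k) (\<lambda>x. cnj (\<beta> x))"
    using \<xi>_uminus[OF k] by (simp add: \<gamma> symbol_def fun_eq_iff)
  then show "(\<lambda>p. cnj (\<gamma> p)) \<in> symbols" unfolding symbols_def using L_uminus[OF k] B_cnj[OF \<beta>] by blast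
  fix \<delta> assume "\<delta> \<in> symbols"
  then obtain l \<alpha> where l: "l \<in> L" and \<alpha>: "\<alpha> \<in> B" and \<delta>: "\<delta> = symbol l \<alpha>" unfolding symbols_def by blast
  have "(\<lambda>p. \<gamma> p * \<delta> p) = symbol (k + l) (\<lambda>x. \<beta> x * \<alpha> x)"
    using \<xi>_add[OF L_uminus[OF k] L_uminus[OF l]] by (simp add: \<gamma> \<delta> symbol_def fun_eq_iff mult_ac)
  then show "(\<lambda>p. \<gamma> p * \<delta> p) \<in> symbols" unfolding symbols_def using L_add[OF k l] B_mult[OF \<beta> \<alpha>] by blast
next
  have "(\<lambda>_. 1) = symbol 0 (\<lambda>_. 1)" by (simp add: symbol_def \<xi>_zero fun_eq_iff)
  then show "(\<lambda>_. 1) \<in> symbols" unfolding symbols_def using L_zero B_one by blast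
qed

definition lattice_span :: "('g \<Rightarrow> complex) set \<Rightarrow> ('g \<Rightarrow> complex) set" where
  "lattice_span A = cfun.span {translation l (modulation \<beta> \<phi>) | \<phi> l \<beta>. \<phi> \<in> A \<and> (l, \<beta>) \<in> L \<times> B}"

lemma generated_subspace_eq: "generated_subspace \<mu> (L \<times> B) A = closure_L2 \<mu> (lattice_span A)"
  unfolding generated_subspace_def lattice_span_def ..

lemma lattice_span_L2:
  assumes "A \<subseteq> L2 \<mu>" shows "lattice_span A \<subseteq> L2 \<mu>"
  unfolding lattice_span_def
  by (rule cfun.span_minimal[OF _ subspace_L2]) (use assms translation_modulation_L2 in blast)

lemma closed_subspace_generated:
  "A \<subseteq> L2 \<mu> \<Longrightarrow> closed_subspace_L2 \<mu> (generated_subspace \<mu> (L \<times> B) A)"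
  unfolding generated_subspace_eq
  by (rule closed_subspace_closure_L2[OF lattice_span_L2]) (simp_all add: lattice_span_def)

lemma zak_0: "AE p in M. zak 0 p = 0"
proof -
  have "norm_L2 M (zak 0) = 0" using zak_norm[OF L2_zero] by (simp add: norm_L2_def)
  from norm_L2_eq_0_AE[OF this zak_L2[OF L2_zero]] show ?thesis .
qed

lemma zak_linear:
  assumes f: "f \<in> L2 \<mu>" and g: "g \<in> L2 \<mu>"
  shows "AE p in M. zak ((\<lambda>x. c * f x) + g) p = c * zak f p + zak g p"
  using zak_add[OF L2_scale[OF f, of c] g] zak_scale[OF f, of c] by eventually_elim simp

lemma zak_isometry:
  assumes f: "f \<in> L2 \<mu>" and g: "g \<in> L2 \<mu>" and F: "F' \<in> L2 M" "AE p in M. zak f p = F' p" and G: "G' \<in> L2 M" "AE p in M. zak g p = G' p"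
  shows "norm_L2 M (F' - G') = norm_L2 \<mu> (f - g)"
proof -
  have eq: "f - g = (\<lambda>x. (-1) * g x) + f" by (simp add: fun_eq_iff)
  have "AE p in M. zak (f - g) p = - zak g p + zak f p"
    unfolding eq using zak_linear[OF g f, of "-1"] by simp
  then have "AE p in M. norm ((F' - G') p) = norm (zak (f - g) p)"
    using F(2) G(2) by eventually_elim (simp add: norm_minus_commute)
  then have "norm_L2 M (F' - G') = norm_L2 M (zak (f - g))"
    by (rule norm_L2_AE_cong[OF _ L2_diff[OF F(1) G(1)] zak_L2[OF L2_diff[OF f g]]])
  then show ?thesis using zak_norm[OF L2_diff[OF f g]] by simp
qed

lemma zak_image_L2: "A \<subseteq> L2 \<mu> \<Longrightarrow> zak ` A \<subseteq> L2 M"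
  using zak_L2 by blast

lemma zak_lattice_span:
  assumes A: "A \<subseteq> L2 \<mu>" and r: "r \<in> lattice_span A"
  shows "\<exists>s\<in>orbit_span (zak ` A). AE p in M. zak r p = s p"
proof -
  have "r \<in> L2 \<mu> \<and> (\<exists>s\<in>orbit_span (zak ` A). AE p in M. zak r p = s p)"
    using r unfolding lattice_span_def
  proof (induction rule: cfun.span_induct_alt)
    case base
    have "0 \<in> orbit_span (zak ` A)" unfolding orbit_span_def by (rule cfun.span_zero)
    moreover have "AE p in M. zak 0 p = 0 p" using zak_0 by eventually_elim simp
    ultimately show ?case using L2_zero by blast
  next
    case (step c x y)
    from step(1) obtain \<phi> l \<beta> where \<phi>: "\<phi> \<in> A" and l: "l \<in> L" and \<beta>: "\<beta> \<in> B"
      and x: "x = translation l (modulation \<beta> \<phi>)" by blast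
    from step(2) obtain s where yL: "y \<in> L2 \<mu>" and s: "s \<in> orbit_span (zak ` A)" "AE p in M. zak y p = s p" by blast
    have \<phi>L: "\<phi> \<in> L2 \<mu>" using \<phi> A by blast
    have xL: "x \<in> L2 \<mu>" unfolding x by (rule translation_modulation_L2[OF \<phi>L \<beta>])
    have base: "(\<lambda>p. symbol l \<beta> p * zak \<phi> p) \<in> orbit_span (zak ` A)"
      unfolding orbit_span_def
      by (intro cfun.span_base CollectI exI[of _ "symbol l \<beta>"] exI[of _ "zak \<phi>"])
        (use l \<beta> \<phi> in \<open>auto simp: symbols_def\<close>)
    have mem: "(\<lambda>p. c * (symbol l \<beta> p * zak \<phi> p)) + s \<in> orbit_span (zak ` A)"
      using base s(1) unfolding orbit_span_def by (intro cfun.span_add cfun.span_scale)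
    have "AE p in M. zak ((\<lambda>z. c * x z) + y) p = ((\<lambda>p. c * (symbol l \<beta> p * zak \<phi> p)) + s) p"
      using zak_linear[OF xL yL, of c] zak_intertwines[OF \<phi>L l \<beta>] s(2)
      by eventually_elim (simp add: x)
    with mem L2_add[OF L2_scale[OF xL] yL] show ?case by blast
  qed
  then show ?thesis by (rule conjunct2)
qed

lemma orbit_span_zak:
  assumes A: "A \<subseteq> L2 \<mu>" and s: "s \<in> orbit_span (zak ` A)"
  shows "\<exists>r\<in>lattice_span A. AE p in M. zak r p = s p"
  using s unfolding orbit_span_def
proof (induction rule: cfun.span_induct_alt)
  case base
  have "0 \<in> lattice_span A" unfolding lattice_span_def by (rule cfun.span_zero)
  moreover have "AE p in M. zak 0 p = 0 p" using zak_0 by eventually_elim simp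
  ultimately show ?case by (intro bexI[of _ 0])
next
  case (step c x y)
  from step(1) obtain \<phi> l \<beta> where \<phi>: "\<phi> \<in> A" and l: "l \<in> L" and \<beta>: "\<beta> \<in> B"
    and x: "x = (\<lambda>p. symbol l \<beta> p * zak \<phi> p)" unfolding symbols_def by blast
  from step(2) obtain r where r: "r \<in> lattice_span A" "AE p in M. zak r p = y p" by blast
  define t where "t = translation l (modulation \<beta> \<phi>)"
  have \<phi>L: "\<phi> \<in> L2 \<mu>" using \<phi> A by blast
  have tL: "t \<in> L2 \<mu>" unfolding t_def by (rule translation_modulation_L2[OF \<phi>L \<beta>])
  have rL: "r \<in> L2 \<mu>" using r(1) lattice_span_L2[OF A] by blast
  have base: "t \<in> lattice_span A"
    unfolding lattice_span_def t_def using \<phi> l \<beta> by (intro cfun.span_base) blast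
  have mem: "(\<lambda>z. c * t z) + r \<in> lattice_span A"
    using base r(1) unfolding lattice_span_def by (intro cfun.span_add cfun.span_scale)
  have "AE p in M. zak ((\<lambda>z. c * t z) + r) p = ((\<lambda>p. c * x p) + y) p"
    using zak_linear[OF tL rL, of c] zak_intertwines[OF \<phi>L l \<beta>] r(2)
    by eventually_elim (simp add: x t_def)
  with mem show ?case by blast
qed

text \<open>The transform has closed range on closed spans: Cauchy sequences can be pulled back.\<close>

lemma closure_orbit_span_zak:
  assumes A: "A \<subseteq> L2 \<mu>" and h: "h \<in> closure_L2 M (orbit_span (zak ` A))"
  shows "\<exists>r\<in>generated_subspace \<mu> (L \<times> B) A. AE p in M. zak r p = h p"
proof -
  have hL: "h \<in> L2 M" using h by (simp add: closure_L2_def)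
  have "\<forall>k. \<exists>s. \<exists>r. s \<in> orbit_span (zak ` A) \<and> norm_L2 M (h - s) < 1 / real (Suc k) \<and> r \<in> lattice_span A \<and> (AE p in M. zak r p = s p)"
  proof
    fix k
    obtain s where s: "s \<in> orbit_span (zak ` A)" "norm_L2 M (h - s) < 1 / real (Suc k)"
      using closure_L2_approx[OF h, of "1 / real (Suc k)"] by auto
    then show "\<exists>s. \<exists>r. s \<in> orbit_span (zak ` A) \<and> norm_L2 M (h - s) < 1 / real (Suc k) \<and> r \<in> lattice_span A \<and> (AE p in M. zak r p = s p)"
      using orbit_span_zak[OF A s(1)] by blast
  qed
  from choice[OF this] obtain s where
    "\<forall>k. \<exists>r. s k \<in> orbit_span (zak ` A) \<and> norm_L2 M (h - s k) < 1 / real (Suc k) \<and> r \<in> lattice_span A \<and> (AE p in M. zak r p = s k p)" ..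
  from choice[OF this] obtain r where
    "\<forall>k. s k \<in> orbit_span (zak ` A) \<and> norm_L2 M (h - s k) < 1 / real (Suc k) \<and> r k \<in> lattice_span A \<and> (AE p in M. zak (r k) p = s k p)" ..
  then have s: "\<And>k. s k \<in> orbit_span (zak ` A)" "\<And>k. norm_L2 M (h - s k) < 1 / real (Suc k)"
    and r: "\<And>k. r k \<in> lattice_span A" "\<And>k. AE p in M. zak (r k) p = s k p" by auto
  have sL: "s k \<in> L2 M" for k using s(1) orbit_span_subset_L2[OF zak_image_L2[OF A]] by blast
  have rL: "r k \<in> L2 \<mu>" for k using r(1) lattice_span_L2[OF A] by blast
  have inv0: "(\<lambda>k. 1 / real (Suc k)) \<longlonglongrightarrow> 0"
    using LIMSEQ_inverse_real_of_nat by (simp add: inverse_eq_divide)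
  have cau: "\<exists>N. \<forall>i\<ge>N. \<forall>j\<ge>N. norm_L2 \<mu> (r i - r j) < d" if d: "0 < d" for d
  proof -
    obtain N where N: "\<And>k. k \<ge> N \<Longrightarrow> 1 / real (Suc k) < d / 2"
      using order_tendstoD(2)[OF inv0 half_gt_zero[OF d]] unfolding eventually_sequentially by blast
    have "norm_L2 \<mu> (r i - r j) < d" if "i \<ge> N" "j \<ge> N" for i j
    proof -
      have "norm_L2 \<mu> (r i - r j) = norm_L2 M (s i - s j)"
        by (rule zak_isometry[OF rL rL sL r(2) sL r(2), symmetric])
      also have "\<dots> \<le> norm_L2 M (s i - h) + norm_L2 M (h - s j)" by (rule norm_L2_triangle_diff[OF sL hL sL])
      finally show ?thesis
        using s(2)[of i] s(2)[of j] N[OF that(1)] N[OF that(2)] norm_L2_minus_commute[of M "s i" h] by linarith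
    qed
    then show ?thesis by blast
  qed
  obtain g where g: "g \<in> L2 \<mu>" "(\<lambda>k. norm_L2 \<mu> (r k - g)) \<longlonglongrightarrow> 0" using L2_complete[OF rL cau] .
  have "g \<in> generated_subspace \<mu> (L \<times> B) A"
  proof (rule closed_subspace_L2_limit[OF closed_subspace_generated[OF A] g(1)])
    show "r k \<in> generated_subspace \<mu> (L \<times> B) A" for k
      unfolding generated_subspace_eq using closure_L2_superset[OF lattice_span_L2[OF A]] r(1) by blast
    show "(\<lambda>k. norm_L2 \<mu> (g - r k)) \<longlonglongrightarrow> 0" using g(2) norm_L2_minus_commute[of \<mu> g] by simp
  qed
  moreover have "AE p in M. zak g p = h p"
  proof -
    have le: "norm_L2 M (zak g - h) \<le> norm_L2 \<mu> (r k - g) + 1 / real (Suc k)" for k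
    proof -
      have "norm_L2 M (s k - zak g) = norm_L2 \<mu> (r k - g)"
        by (rule zak_isometry[OF rL g(1) sL r(2) zak_L2[OF g(1)]]) simp
      then show ?thesis
        using norm_L2_triangle_diff[OF zak_L2[OF g(1)] sL[of k] hL] s(2)[of k]
          norm_L2_minus_commute[of M "zak g" "s k"] norm_L2_minus_commute[of M h "s k"] by linarith
    qed
    have "(\<lambda>k. norm_L2 \<mu> (r k - g) + 1 / real (Suc k)) \<longlonglongrightarrow> 0" by (rule tendsto_add_zero[OF g(2) inv0])
    then have "norm_L2 M (zak g - h) \<le> 0" by (rule LIMSEQ_le_const) (intro exI[of _ 0] allI impI le)
    then have "norm_L2 M (zak g - h) = 0" using norm_L2_nonneg[of M "zak g - h"] by linarith
    from norm_L2_eq_0_AE[OF this L2_diff[OF zak_L2[OF g(1)] hL]] show ?thesis by simp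
  qed
  ultimately show ?thesis by blast
qed

text \<open>
  A closed orbit span is a closed invariant subspace. This allows generators to be exchanged for others that
  agree with them almost everywhere.
\<close>

lemma closure_orbit_span_subset:
  assumes A: "A \<subseteq> L2 M" and C: "C \<subseteq> closure_L2 M (orbit_span A)"
  shows "closure_L2 M (orbit_span C) \<subseteq> closure_L2 M (orbit_span A)"
proof -
  have W: "closed_subspace_L2 M (closure_L2 M (orbit_span A))" by (rule closed_subspace_orbit[OF A])
  have "orbit_span C \<subseteq> closure_L2 M (orbit_span A)"
    unfolding orbit_span_def[of C]
  proof (rule cfun.span_minimal)
    show "{\<lambda>x. \<gamma> x * \<phi> x |\<gamma> \<phi>. \<gamma> \<in> symbols \<and> \<phi> \<in> C} \<subseteq> closure_L2 M (orbit_span A)"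
      using closure_orbit_invariant[OF _ A] C by blast
    show "cfun.subspace (closure_L2 M (orbit_span A))" using W by (simp add: closed_subspace_L2_def)
  qed
  then have "closure_L2 M (orbit_span C) \<subseteq> closure_L2 M (closure_L2 M (orbit_span A))"
    unfolding closure_L2_def by blast
  then show ?thesis using W unfolding closed_subspace_L2_def by blast
qed

lemma approx_error_le:
  assumes V: "closed_subspace_L2 \<mu> V" and f: "\<And>j. j \<in> {1..m} \<Longrightarrow> f j \<in> L2 \<mu>" and p: "\<And>j. j \<in> {1..m} \<Longrightarrow> p j \<in> V"
  shows "approx_error \<mu> m f V \<le> (\<Sum>j=1..m. (norm_L2 \<mu> (f j - p j))\<^sup>2)"
  unfolding approx_error_def
  by (intro sum_mono power_mono proj_L2_nearest(2)[OF V] f p norm_L2_nonneg)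

text \<open>The projections of the data are limits of elements of the span.\<close>

lemma le_approx_error:
  assumes A: "A \<subseteq> L2 \<mu>" and f: "\<And>j. j \<in> {1..m} \<Longrightarrow> f j \<in> L2 \<mu>"
    and le: "\<And>r. (\<And>j. j \<in> {1..m} \<Longrightarrow> r j \<in> lattice_span A) \<Longrightarrow> c \<le> (\<Sum>j=1..m. (norm_L2 \<mu> (f j - r j))\<^sup>2)"
  shows "c \<le> approx_error \<mu> m f (generated_subspace \<mu> (L \<times> B) A)"
proof -
  define P where "P j = proj_L2 \<mu> (generated_subspace \<mu> (L \<times> B) A) (f j)" for j
  have P: "P j \<in> closure_L2 \<mu> (lattice_span A)" if "j \<in> {1..m}" for j
    using proj_L2_nearest(1)[OF closed_subspace_generated[OF A] f[OF that]] unfolding P_def generated_subspace_eq .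
  have PL: "P j \<in> L2 \<mu>" if "j \<in> {1..m}" for j using P[OF that] by (simp add: closure_L2_def)
  have "\<forall>j\<in>{1..m}. \<exists>r. \<forall>k. r k \<in> lattice_span A \<and> norm_L2 \<mu> (P j - r k) < 1 / real (Suc k)"
  proof
    fix j assume j: "j \<in> {1..m}"
    have "\<forall>k. \<exists>r. r \<in> lattice_span A \<and> norm_L2 \<mu> (P j - r) < 1 / real (Suc k)"
      using closure_L2_approx[OF P[OF j]] by (simp add: Bex_def)
    then show "\<exists>r. \<forall>k. r k \<in> lattice_span A \<and> norm_L2 \<mu> (P j - r k) < 1 / real (Suc k)" by (rule choice)
  qed
  from bchoice[OF this] obtain r where
    "\<forall>j\<in>{1..m}. \<forall>k. r j k \<in> lattice_span A \<and> norm_L2 \<mu> (P j - r j k) < 1 / real (Suc k)" ..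
  then have r: "\<And>j k. j \<in> {1..m} \<Longrightarrow> r j k \<in> lattice_span A"
    and r_lim: "\<And>j k. j \<in> {1..m} \<Longrightarrow> norm_L2 \<mu> (P j - r j k) < 1 / real (Suc k)" by auto
  have rL: "r j k \<in> L2 \<mu>" if "j \<in> {1..m}" for j k using r[OF that] lattice_span_L2[OF A] by blast
  have upper: "(\<Sum>j=1..m. (norm_L2 \<mu> (f j - r j k))\<^sup>2) \<le> (\<Sum>j=1..m. (norm_L2 \<mu> (f j - P j) + 1 / real (Suc k))\<^sup>2)" for k
  proof (intro sum_mono power_mono norm_L2_nonneg)
    fix j assume j: "j \<in> {1..m}"
    show "norm_L2 \<mu> (f j - r j k) \<le> norm_L2 \<mu> (f j - P j) + 1 / real (Suc k)"
      using norm_L2_triangle_diff[OF f[OF j] PL[OF j] rL[OF j, of k]] r_lim[OF j, of k] by linarith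
  qed
  have "(\<lambda>k. \<Sum>j=1..m. (norm_L2 \<mu> (f j - P j) + 1 / real (Suc k))\<^sup>2) \<longlonglongrightarrow> (\<Sum>j=1..m. (norm_L2 \<mu> (f j - P j) + 0)\<^sup>2)"
    using LIMSEQ_inverse_real_of_nat by (intro tendsto_intros) (simp add: inverse_eq_divide)
  then have "c \<le> (\<Sum>j=1..m. (norm_L2 \<mu> (f j - P j) + 0)\<^sup>2)"
    by (rule LIMSEQ_le_const) (intro exI[of _ 0] allI impI order_trans[OF le[OF r] upper])
  then show ?thesis by (simp add: approx_error_def P_def)
qed

text \<open>
  The optimal generators and approximants of the transformed data lie in closed spans of transforms, so they
  can be pulled back; isometry transfers all distances.
\<close>

theorem ex_optimal_lattice_generators:
  assumes f: "\<And>j. j \<in> {1..m} \<Longrightarrow> f j \<in> L2 \<mu>" and nm: "n \<le> m"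
  obtains \<psi> :: "nat \<Rightarrow> 'g \<Rightarrow> complex" where "\<And>i. \<psi> i \<in> L2 \<mu>"
    "\<And>A. finite A \<Longrightarrow> card A \<le> n \<Longrightarrow> A \<subseteq> L2 \<mu> \<Longrightarrow>
       approx_error \<mu> m f (generated_subspace \<mu> (L \<times> B) (\<psi> ` {1..n}))
         \<le> approx_error \<mu> m f (generated_subspace \<mu> (L \<times> B) A)"
proof -
  have fL: "f ` {1..m} \<subseteq> L2 \<mu>" using f by blast
  have zf: "zak (f j) \<in> L2 M" if "j \<in> {1..m}" for j by (rule zak_L2[OF f[OF that]])
  show thesis
  proof (rule ex_optimal_generators[where f = "\<lambda>j. zak (f j)", OF zf nm], assumption)
    fix g q assume g: "\<And>k. g k \<in> closure_L2 M (orbit_span ((\<lambda>j. zak (f j)) ` {1..m}))"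
      and q: "\<And>j. j \<in> {1..m} \<Longrightarrow> q j \<in> closure_L2 M (orbit_span (g ` {1..n}))"
      and opt: "\<And>\<Phi> p. finite \<Phi> \<Longrightarrow> card \<Phi> \<le> n \<Longrightarrow> \<Phi> \<subseteq> L2 M \<Longrightarrow> (\<And>j. j \<in> {1..m} \<Longrightarrow> p j \<in> orbit_span \<Phi>) \<Longrightarrow>
         (\<Sum>j=1..m. (norm_L2 M (zak (f j) - q j))\<^sup>2) \<le> (\<Sum>j=1..m. (norm_L2 M (zak (f j) - p j))\<^sup>2)"
    have "\<forall>k. \<exists>r. r \<in> L2 \<mu> \<and> (AE p in M. zak r p = g k p)"
    proof
      fix k
      have "g k \<in> closure_L2 M (orbit_span (zak ` (f ` {1..m})))" using g[of k] by (simp only: image_image)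
      from closure_orbit_span_zak[OF fL this] show "\<exists>r. r \<in> L2 \<mu> \<and> (AE p in M. zak r p = g k p)"
        unfolding generated_subspace_eq closure_L2_def by blast
    qed
    from choice[OF this] obtain \<psi> where "\<forall>k. \<psi> k \<in> L2 \<mu> \<and> (AE p in M. zak (\<psi> k) p = g k p)" ..
    then have \<psi>: "\<psi> k \<in> L2 \<mu>" "AE p in M. zak (\<psi> k) p = g k p" for k by auto
    have \<psi>L: "\<psi> ` {1..n} \<subseteq> L2 \<mu>" using \<psi>(1) by blast
    have gL: "g k \<in> L2 M" for k using g[of k] by (simp add: closure_L2_def)
    have z\<psi>: "zak ` \<psi> ` {1..n} \<subseteq> L2 M" by (rule zak_image_L2[OF \<psi>L])
    have "g ` {1..n} \<subseteq> closure_L2 M (orbit_span (zak ` \<psi> ` {1..n}))"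
    proof
      fix h assume "h \<in> g ` {1..n}"
      then obtain k where k: "k \<in> {1..n}" "h = g k" by blast
      have "zak (\<psi> k) \<in> zak ` \<psi> ` {1..n}" using k(1) by blast
      then have "zak (\<psi> k) \<in> closure_L2 M (orbit_span (zak ` \<psi> ` {1..n}))" by (rule generator_in_orbit[OF z\<psi>])
      then show "h \<in> closure_L2 M (orbit_span (zak ` \<psi> ` {1..n}))"
        unfolding k(2)
      proof (rule closed_subspace_L2_AE[OF closed_subspace_orbit[OF z\<psi>] gL])
        show "AE p in M. g k p = zak (\<psi> k) p" using \<psi>(2)[of k] by eventually_elim simp
      qed
    qed
    note sub = closure_orbit_span_subset[OF z\<psi> this]
    have "\<forall>j\<in>{1..m}. \<exists>p. p \<in> generated_subspace \<mu> (L \<times> B) (\<psi> ` {1..n}) \<and> (AE x in M. zak p x = q j x)"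
      using closure_orbit_span_zak[OF \<psi>L] q sub by blast
    from bchoice[OF this] obtain p where
      "\<forall>j\<in>{1..m}. p j \<in> generated_subspace \<mu> (L \<times> B) (\<psi> ` {1..n}) \<and> (AE x in M. zak (p j) x = q j x)" ..
    then have p: "\<And>j. j \<in> {1..m} \<Longrightarrow> p j \<in> generated_subspace \<mu> (L \<times> B) (\<psi> ` {1..n})"
      "\<And>j. j \<in> {1..m} \<Longrightarrow> AE x in M. zak (p j) x = q j x" by auto
    have pL: "p j \<in> L2 \<mu>" if "j \<in> {1..m}" for j
      using p(1)[OF that] by (simp add: generated_subspace_def closure_L2_def)
    have qL: "q j \<in> L2 M" if "j \<in> {1..m}" for j using q[OF that] by (simp add: closure_L2_def)
    have "approx_error \<mu> m f (generated_subspace \<mu> (L \<times> B) (\<psi> ` {1..n})) \<le> approx_error \<mu> m f (generated_subspace \<mu> (L \<times> B) A)"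
      if A: "finite A" "card A \<le> n" "A \<subseteq> L2 \<mu>" for A
    proof (rule le_approx_error[OF A(3) f])
      fix r assume r: "\<And>j. j \<in> {1..m} \<Longrightarrow> r j \<in> lattice_span A"
      have rL: "r j \<in> L2 \<mu>" if "j \<in> {1..m}" for j using r[OF that] lattice_span_L2[OF A(3)] by blast
      have "\<forall>j\<in>{1..m}. \<exists>s. s \<in> orbit_span (zak ` A) \<and> (AE x in M. zak (r j) x = s x)"
        using zak_lattice_span[OF A(3) r] by blast
      from bchoice[OF this] obtain s where "\<forall>j\<in>{1..m}. s j \<in> orbit_span (zak ` A) \<and> (AE x in M. zak (r j) x = s j x)" ..
      then have s: "\<And>j. j \<in> {1..m} \<Longrightarrow> s j \<in> orbit_span (zak ` A)" "\<And>j. j \<in> {1..m} \<Longrightarrow> AE x in M. zak (r j) x = s j x" by auto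
      have sL: "s j \<in> L2 M" if "j \<in> {1..m}" for j using s(1)[OF that] orbit_span_subset_L2[OF zak_image_L2[OF A(3)]] by blast
      have "approx_error \<mu> m f (generated_subspace \<mu> (L \<times> B) (\<psi> ` {1..n})) \<le> (\<Sum>j=1..m. (norm_L2 \<mu> (f j - p j))\<^sup>2)"
        by (rule approx_error_le[OF closed_subspace_generated[OF \<psi>L] f p(1)])
      also have "\<dots> = (\<Sum>j=1..m. (norm_L2 M (zak (f j) - q j))\<^sup>2)"
      proof (rule sum.cong[OF refl])
        fix j assume j: "j \<in> {1..m}"
        have "norm_L2 M (zak (f j) - q j) = norm_L2 \<mu> (f j - p j)"
          by (rule zak_isometry[OF f[OF j] pL[OF j] zf[OF j] _ qL[OF j] p(2)[OF j]]) simp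
        then show "(norm_L2 \<mu> (f j - p j))\<^sup>2 = (norm_L2 M (zak (f j) - q j))\<^sup>2" by simp
      qed
      also have "\<dots> \<le> (\<Sum>j=1..m. (norm_L2 M (zak (f j) - s j))\<^sup>2)"
        by (rule opt[OF finite_imageI[OF A(1)] order_trans[OF card_image_le[OF A(1)] A(2)] zak_image_L2[OF A(3)] s(1)])
      also have "\<dots> = (\<Sum>j=1..m. (norm_L2 \<mu> (f j - r j))\<^sup>2)"
      proof (rule sum.cong[OF refl])
        fix j assume j: "j \<in> {1..m}"
        have "norm_L2 M (zak (f j) - s j) = norm_L2 \<mu> (f j - r j)"
          by (rule zak_isometry[OF f[OF j] rL[OF j] zf[OF j] _ sL[OF j] s(2)[OF j]]) simp
        then show "(norm_L2 M (zak (f j) - s j))\<^sup>2 = (norm_L2 \<mu> (f j - r j))\<^sup>2" by simp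
      qed
      finally show "approx_error \<mu> m f (generated_subspace \<mu> (L \<times> B) (\<psi> ` {1..n})) \<le> (\<Sum>j=1..m. (norm_L2 \<mu> (f j - r j))\<^sup>2)" .
    qed
    with \<psi>(1) show thesis by (rule that)
  qed
qed

end

section \<open>Uniform lattices\<close>

lemma comm_group_additive_on:
  fixes L :: "'g::ab_group_add set"
  assumes "0 \<in> L" "\<And>k l. k \<in> L \<Longrightarrow> l \<in> L \<Longrightarrow> k + l \<in> L" "\<And>l. l \<in> L \<Longrightarrow> - l \<in> L"
  shows "comm_group \<lparr>carrier = L, monoid.mult = (+), one = 0\<rparr>"
proof (rule comm_groupI)
  fix x assume "x \<in> carrier \<lparr>carrier = L, monoid.mult = (+), one = 0\<rparr>"
  then show "\<exists>y\<in>carrier \<lparr>carrier = L, monoid.mult = (+), one = 0\<rparr>.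
      y \<otimes>\<^bsub>\<lparr>carrier = L, monoid.mult = (+), one = 0\<rparr>\<^esub> x = \<one>\<^bsub>\<lparr>carrier = L, monoid.mult = (+), one = 0\<rparr>\<^esub>"
    using assms(3)[of x] by (intro bexI[of _ "- x"]) simp_all
qed (use assms in \<open>simp_all add: algebra_simps\<close>)

lemma subgroup_additive_group:
  assumes "subgroup L additive_group"
  shows "0 \<in> L" "\<And>k l. k \<in> L \<Longrightarrow> l \<in> L \<Longrightarrow> k + l \<in> L" "\<And>l. l \<in> L \<Longrightarrow> - l \<in> L"
proof -
  interpret comm_group "additive_group :: 'a monoid"
    using comm_group_additive_on[of "UNIV :: 'a set"] by (simp add: additive_group_def)
  show "0 \<in> L" using subgroup.one_closed[OF assms] by (simp add: additive_group_def)
  show "k + l \<in> L" if "k \<in> L" "l \<in> L" for k l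
    using subgroup.m_closed[OF assms that] by (simp add: additive_group_def)
  have "inv\<^bsub>additive_group\<^esub> l = - l" for l :: 'a
    by (rule inv_equality) (simp_all add: additive_group_def)
  then show "- l \<in> L" if "l \<in> L" for l
    using subgroup.m_inv_closed[OF assms that] by simp
qed

lemma character_measurable:
  fixes \<alpha> :: "'g::topological_ab_group_add \<Rightarrow> complex"
  shows "\<alpha> \<in> characters \<Longrightarrow> \<alpha> \<in> borel_measurable borel"
  unfolding characters_def mem_Collect_eq by (elim conjE) (rule borel_measurable_continuous_onI)

lemma subgroup_dual_group:
  fixes B :: "('g::topological_ab_group_add \<Rightarrow> complex) set"
  assumes "subgroup B dual_group"
  shows "B \<subseteq> characters" "(\<lambda>_. 1) \<in> B" "\<And>\<alpha> \<beta>. \<alpha> \<in> B \<Longrightarrow> \<beta> \<in> B \<Longrightarrow> (\<lambda>x. \<alpha> x * \<beta> x) \<in> B"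
    "\<And>\<beta>. \<beta> \<in> B \<Longrightarrow> (\<lambda>x. cnj (\<beta> x)) \<in> B"
proof -
  show sub: "B \<subseteq> characters" using subgroup.subset[OF assms] by (simp add: dual_group_def)
  show "(\<lambda>_. 1) \<in> B" using subgroup.one_closed[OF assms] by (simp add: dual_group_def)
  show "(\<lambda>x. \<alpha> x * \<beta> x) \<in> B" if "\<alpha> \<in> B" "\<beta> \<in> B" for \<alpha> \<beta>
    using subgroup.m_closed[OF assms that] by (simp add: dual_group_def)
  show "(\<lambda>x. cnj (\<beta> x)) \<in> B" if \<beta>: "\<beta> \<in> B" for \<beta>
  proof -
    have ch: "\<beta> \<in> characters" using sub \<beta> by blast
    then have one: "\<beta> x * cnj (\<beta> x) = 1" for x
      by (simp add: characters_def complex_norm_square[symmetric])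
    have cnj: "(\<lambda>x. cnj (\<beta> x)) \<in> characters"
      using ch by (auto simp: characters_def intro!: continuous_intros)
    have "inv\<^bsub>dual_group\<^esub> \<beta> = (\<lambda>x. cnj (\<beta> x))"
      unfolding m_inv_def
    proof (rule the_equality)
      show "(\<lambda>x. cnj (\<beta> x)) \<in> carrier dual_group \<and> \<beta> \<otimes>\<^bsub>dual_group\<^esub> (\<lambda>x. cnj (\<beta> x)) = \<one>\<^bsub>dual_group\<^esub> \<and>
          (\<lambda>x. cnj (\<beta> x)) \<otimes>\<^bsub>dual_group\<^esub> \<beta> = \<one>\<^bsub>dual_group\<^esub>"
        using cnj one by (simp add: dual_group_def fun_eq_iff mult.commute)
    next
      fix y assume y: "y \<in> carrier dual_group \<and> \<beta> \<otimes>\<^bsub>dual_group\<^esub> y = \<one>\<^bsub>dual_group\<^esub> \<and> y \<otimes>\<^bsub>dual_group\<^esub> \<beta> = \<one>\<^bsub>dual_group\<^esub>"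
      show "y = (\<lambda>x. cnj (\<beta> x))"
      proof
        fix x
        have "y x * \<beta> x = 1" using y by (simp add: dual_group_def fun_eq_iff)
        then have "y x * (\<beta> x * cnj (\<beta> x)) = cnj (\<beta> x)" by (simp only: mult.assoc[symmetric] mult_1_left)
        then show "y x = cnj (\<beta> x)" by (simp only: one mult_1_right)
      qed
    qed
    then show ?thesis using subgroup.m_inv_closed[OF assms \<beta>] by simp
  qed
qed

lemma haar_measureD:
  assumes "haar_measure \<mu>"
  shows "sets \<mu> = sets borel" "A \<in> sets borel \<Longrightarrow> emeasure \<mu> ((+) a ` A) = emeasure \<mu> A"
    "K \<in> sets borel \<Longrightarrow> compact K \<Longrightarrow> emeasure \<mu> K < \<infinity>"
proof -
  have "sets \<mu> = sets borel \<and> (\<forall>a. \<forall>A\<in>sets borel. emeasure \<mu> ((+) a ` A) = emeasure \<mu> A) \<and>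
      (\<forall>K\<in>sets borel. compact K \<longrightarrow> emeasure \<mu> K < \<infinity>)"
    using assms unfolding haar_measure_def by (elim conjE) (intro conjI)
  then show "sets \<mu> = sets borel" "A \<in> sets borel \<Longrightarrow> emeasure \<mu> ((+) a ` A) = emeasure \<mu> A"
    "K \<in> sets borel \<Longrightarrow> compact K \<Longrightarrow> emeasure \<mu> K < \<infinity>"
    by blast+
qed

lemma open_translate:
  fixes U :: "'g::topological_ab_group_add set"
  assumes "open U" shows "open {y. y - a \<in> U}"
proof -
  have "open ((\<lambda>y. y - a) -` U)" by (intro open_vimage assms continuous_intros)
  then show ?thesis by (simp add: vimage_def)
qed

text \<open>Basic open sets that isolate the points of \<open>L\<close> are pairwise different.\<close>

lemma discrete_subgroup_countable:
  fixes L :: "'g::{topological_ab_group_add, second_countable_topology} set"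
  assumes W: "open W" "W \<inter> L = {0}" and L: "\<And>k l. k \<in> L \<Longrightarrow> l \<in> L \<Longrightarrow> k - l \<in> L"
  shows "countable L"
proof -
  obtain \<B> :: "'g set set" where \<B>: "countable \<B>" "topological_basis \<B>" using ex_countable_basis by blast
  have "\<forall>l. \<exists>X. X \<in> \<B> \<and> l \<in> X \<and> X \<subseteq> {y. y - l \<in> W}"
  proof
    fix l
    have "0 \<in> W" using W(2) by blast
    then have "l \<in> {y. y - l \<in> W}" by simp
    from topological_basisE[OF \<B>(2) open_translate[OF W(1), of l] this]
    show "\<exists>X. X \<in> \<B> \<and> l \<in> X \<and> X \<subseteq> {y. y - l \<in> W}" by blast
  qed
  from choice[OF this] obtain X where "\<forall>l. X l \<in> \<B> \<and> l \<in> X l \<and> X l \<subseteq> {y. y - l \<in> W}" ..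
  then have X: "\<And>l. X l \<in> \<B>" "\<And>l. l \<in> X l" "\<And>l. X l \<subseteq> {y. y - l \<in> W}" by auto
  have "inj_on X L"
  proof (rule inj_onI)
    fix k l assume kl: "k \<in> L" "l \<in> L" "X k = X l"
    then have "k - l \<in> W" using X(2)[of k] X(3)[of l] by auto
    then have "k - l = 0" using W(2) L[OF kl(1,2)] by blast
    then show "k = l" by simp
  qed
  moreover have "countable (X ` L)" by (rule countable_subset[OF _ \<B>(1)]) (use X(1) in blast)
  ultimately show ?thesis using countable_image_inj_on by blast
qed

text \<open>
  Finitely many relatively compact open sets, each injecting into the quotient, cover it; removing
  from each set the translates of its predecessors leaves one representative of every coset.
\<close>

lemma ex_fundamental_domain:
  fixes \<mu> :: "'g::{topological_ab_group_add, t2_space, second_countable_topology} measure" and L :: "'g set"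
  assumes lc: "locally_compact_space (euclidean :: 'g topology)"
    and \<mu>: "haar_measure \<mu>" and L: "uniform_lattice additive_group euclidean L"
  obtains Q where "countable L" "Q \<in> sets borel" "emeasure \<mu> Q < \<infinity>" "\<And>x. \<exists>l\<in>L. x + l \<in> Q"
    "\<And>x k l. k \<in> L \<Longrightarrow> l \<in> L \<Longrightarrow> x + k \<in> Q \<Longrightarrow> x + l \<in> Q \<Longrightarrow> k = l"
proof -
  have subgr: "subgroup L additive_group" and disc: "subtopology euclidean L = discrete_topology L"
    and cpt: "compact_space (quotient_topology euclidean (\<lambda>x. L #>\<^bsub>additive_group\<^esub> x))"
    using L by (auto simp: uniform_lattice_def)
  note L0 = subgroup_additive_group(1)[OF subgr] and Lp = subgroup_additive_group(2)[OF subgr]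
    and Lm = subgroup_additive_group(3)[OF subgr]
  have Ld: "k - l \<in> L" if "k \<in> L" "l \<in> L" for k l using Lp[OF that(1) Lm[OF that(2)]] by simp
  have "openin (subtopology euclidean L) {0}" unfolding disc using L0 by simp
  then obtain W where "openin euclidean W" "{0} = W \<inter> L" unfolding openin_subtopology by blast
  then have W: "open W" "W \<inter> L = {0}" by simp_all
  have cL: "countable L" by (rule discrete_subgroup_countable[OF W Ld])
  have "open ((\<lambda>p. fst p - snd p) -` W :: ('g \<times> 'g) set)" by (intro open_vimage W(1) continuous_intros)
  moreover have "(0, 0) \<in> ((\<lambda>p. fst p - snd p) -` W :: ('g \<times> 'g) set)" using W(2) by auto
  ultimately obtain N1 N2 :: "'g set" where N: "open N1" "open N2" "(0, 0) \<in> N1 \<times> N2" "N1 \<times> N2 \<subseteq> (\<lambda>p. fst p - snd p) -` W"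
    by (rule open_prod_elim)
  define q where "q x = L #>\<^bsub>additive_group\<^esub> x" for x :: 'g
  have q_iff: "q x = q y \<longleftrightarrow> x - y \<in> L" for x y
  proof
    assume "q x = q y"
    moreover have "x \<in> q x" unfolding q_def r_coset_def additive_group_def using L0 by force
    ultimately show "x - y \<in> L" unfolding q_def r_coset_def additive_group_def by auto
  next
    have sub: "q x \<subseteq> q y" if "x - y \<in> L" for x y
    proof
      fix z assume "z \<in> q x"
      then obtain l where "l \<in> L" "z = l + x" unfolding q_def r_coset_def additive_group_def by auto
      then have "z = (l + (x - y)) + y" "l + (x - y) \<in> L" using Lp that by auto
      then show "z \<in> q y" unfolding q_def r_coset_def additive_group_def by force
    qed
    assume "x - y \<in> L"
    moreover from Lm[OF this] have "y - x \<in> L" by simp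
    ultimately show "q x = q y" using sub by blast
  qed
  have "\<exists>U C. open U \<and> x \<in> U \<and> compact C \<and> U \<subseteq> C \<and> (\<forall>a\<in>U. \<forall>b\<in>U. a - b \<in> L \<longrightarrow> a = b)" for x
  proof -
    have "\<forall>x::'g. \<exists>V. open V \<and> (\<exists>C. compact C \<and> x \<in> V \<and> V \<subseteq> C)"
      using lc by (simp add: locally_compact_space_def)
    then obtain V C where V: "open V" "compact C" "x \<in> V" "V \<subseteq> C" by blast
    define U where "U = V \<inter> {y. y - x \<in> N1} \<inter> {y. y - x \<in> N2}"
    have "a = b" if ab: "a \<in> U" "b \<in> U" "a - b \<in> L" for a b
    proof -
      have "(a - x, b - x) \<in> N1 \<times> N2" using ab by (auto simp: U_def)
      then have "(a - x) - (b - x) \<in> W" using N(4) by auto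
      then have "a - b \<in> W \<inter> L" using ab(3) by simp
      then show ?thesis using W(2) by simp
    qed
    moreover have "open U" unfolding U_def by (intro open_Int V(1) open_translate N)
    moreover have "x \<in> U" "U \<subseteq> C" using V N(3) by (auto simp: U_def)
    ultimately show ?thesis using V(2) by blast
  qed
  then have "\<forall>x. \<exists>U. \<exists>C. open U \<and> x \<in> U \<and> compact C \<and> U \<subseteq> C \<and> (\<forall>a\<in>U. \<forall>b\<in>U. a - b \<in> L \<longrightarrow> a = b)" by blast
  from choice[OF this] obtain U where
    "\<forall>x. \<exists>C. open (U x) \<and> x \<in> U x \<and> compact C \<and> U x \<subseteq> C \<and> (\<forall>a\<in>U x. \<forall>b\<in>U x. a - b \<in> L \<longrightarrow> a = b)" ..
  then have U': "\<exists>C. open (U x) \<and> x \<in> U x \<and> compact C \<and> U x \<subseteq> C \<and> (\<forall>a\<in>U x. \<forall>b\<in>U x. a - b \<in> L \<longrightarrow> a = b)" for x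
    by (rule spec)
  have U: "open (U x)" "x \<in> U x" "\<exists>C. compact C \<and> U x \<subseteq> C" "a \<in> U x \<Longrightarrow> b \<in> U x \<Longrightarrow> a - b \<in> L \<Longrightarrow> a = b" for x a b
    using U'[of x] by (elim exE conjE; blast)+
  have sat: "{y. q y \<in> q ` U x} = (\<Union>l\<in>L. {y. y - l \<in> U x})" for x
  proof (intro equalityI subsetI)
    fix y assume "y \<in> {y. q y \<in> q ` U x}"
    then obtain u where "u \<in> U x" "y - u \<in> L" by (auto simp: q_iff)
    then show "y \<in> (\<Union>l\<in>L. {y. y - l \<in> U x})" by (intro UN_I[of "y - u"]) simp_all
  next
    fix y assume "y \<in> (\<Union>l\<in>L. {y. y - l \<in> U x})"
    then obtain l where "l \<in> L" "y - l \<in> U x" by blast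
    moreover from this have "q y = q (y - l)" by (simp add: q_iff)
    ultimately show "y \<in> {y. q y \<in> q ` U x}" by blast
  qed
  have sat_open: "open {y. q y \<in> q ` U x}" for x
    unfolding sat by (intro open_UN ballI open_translate U(1))
  have top: "topspace (quotient_topology euclidean q) = range q" by (simp add: topspace_quotient_topology)
  have "\<exists>\<F>. finite \<F> \<and> \<F> \<subseteq> range (\<lambda>x. q ` U x) \<and> range q \<subseteq> \<Union>\<F>"
  proof (rule compactinD)
    show "compactin (quotient_topology euclidean q) (range q)"
      using cpt unfolding q_def[symmetric] compact_space_def top .
    have "openin (quotient_topology euclidean q) (q ` U x)" for x
      unfolding openin_quotient_topology using sat_open[of x] by auto
    then show "openin (quotient_topology euclidean q) X" if "X \<in> range (\<lambda>x. q ` U x)" for X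
      using that by blast
    show "range q \<subseteq> \<Union>(range (\<lambda>x. q ` U x))" using U(2) by blast
  qed
  then obtain \<F> where \<F>: "finite \<F>" "\<F> \<subseteq> range (\<lambda>x. q ` U x)" "range q \<subseteq> \<Union>\<F>" by blast
  obtain S where "finite S" "\<F> = (\<lambda>x. q ` U x) ` S" using finite_subset_image[OF \<F>(1,2)] by blast
  with \<F>(3) have S: "finite S" "range q \<subseteq> (\<Union>x\<in>S. q ` U x)" by simp_all
  obtain xs where xs: "set xs = S" using finite_list[OF S(1)] by blast
  define n where "n = length xs"
  define O' where "O' i = {y. q y \<in> q ` U (xs ! i)}" for i
  have cover: "\<exists>i<n. y \<in> O' i" for y
  proof -
    obtain x where "x \<in> S" "q y \<in> q ` U x" using S(2) by blast
    then obtain i where "i < n" "xs ! i = x" unfolding n_def xs[symmetric] in_set_conv_nth by blast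
    then show ?thesis unfolding O'_def using \<open>q y \<in> q ` U x\<close> by blast
  qed
  define Q where "Q = (\<Union>i<n. U (xs ! i) - (\<Union>j<i. O' j))"
  have O'_inv: "x + l \<in> O' i \<longleftrightarrow> x \<in> O' i" if "l \<in> L" for x l i
  proof -
    have "q (x + l) = q x" using that by (simp add: q_iff)
    then show ?thesis by (simp add: O'_def)
  qed
  have U_O': "U (xs ! i) \<subseteq> O' i" for i by (auto simp: O'_def)
  show thesis
  proof (rule that[OF cL])
    show "Q \<in> sets borel"
      unfolding Q_def using U(1) sat_open
      by (intro sets.finite_UN sets.Diff borel_open) (auto simp: O'_def)
    have "emeasure \<mu> Q \<le> emeasure \<mu> (\<Union>i<n. U (xs ! i))"
      using U(1) by (intro emeasure_mono) (auto simp: Q_def haar_measureD(1)[OF \<mu>])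
    also have "\<dots> \<le> (\<Sum>i<n. emeasure \<mu> (U (xs ! i)))"
      using U(1) by (intro emeasure_subadditive_finite) (auto simp: haar_measureD(1)[OF \<mu>])
    also have "\<dots> < \<infinity>"
    proof -
      have "emeasure \<mu> (U x) < \<infinity>" for x
      proof -
        obtain C where C: "compact C" "U x \<subseteq> C" using U(3) by blast
        then have Cb: "C \<in> sets borel" by (auto intro: borel_closed compact_imp_closed)
        have "emeasure \<mu> (U x) \<le> emeasure \<mu> C" using Cb C(2) by (intro emeasure_mono) (auto simp: haar_measureD(1)[OF \<mu>])
        also have "\<dots> < \<infinity>" by (rule haar_measureD(3)[OF \<mu> Cb C(1)])
        finally show ?thesis .
      qed
      then show ?thesis by (simp add: ennreal_sum_less_top)
    qed
    finally show "emeasure \<mu> Q < \<infinity>" .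
    show "\<exists>l\<in>L. x + l \<in> Q" for x
    proof -
      define i where "i = (LEAST i. i < n \<and> x \<in> O' i)"
      have i: "i < n" "x \<in> O' i" using LeastI_ex[OF cover[of x]] by (auto simp: i_def)
      have least: "x \<notin> O' j" if "j < i" for j
        using not_less_Least[of j "\<lambda>i. i < n \<and> x \<in> O' i"] that i(1) unfolding i_def by auto
      obtain u where u: "u \<in> U (xs ! i)" "q x = q u" using i(2) by (auto simp: O'_def)
      have l: "u - x \<in> L" using u(2) by (simp add: q_iff[symmetric])
      have "x + (u - x) \<in> U (xs ! i)" using u(1) by simp
      moreover have "x + (u - x) \<notin> O' j" if "j < i" for j
        unfolding O'_inv[OF l] by (rule least[OF that])
      ultimately have "x + (u - x) \<in> Q" unfolding Q_def using i(1) by blast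
      with l show ?thesis by blast
    qed
    fix x k l assume kl: "k \<in> L" "l \<in> L" and in_Q: "x + k \<in> Q" "x + l \<in> Q"
    obtain i where i: "i < n" "x + k \<in> U (xs ! i)" "\<And>j. j < i \<Longrightarrow> x + k \<notin> O' j" using in_Q(1) unfolding Q_def by blast
    obtain i' where i': "i' < n" "x + l \<in> U (xs ! i')" "\<And>j. j < i' \<Longrightarrow> x + l \<notin> O' j" using in_Q(2) unfolding Q_def by blast
    have "\<not> i < i'" using i'(3)[of i] i(2) U_O'[of i] O'_inv[OF kl(1)] O'_inv[OF kl(2)] by blast
    moreover have "\<not> i' < i" using i(3)[of i'] i'(2) U_O'[of i'] O'_inv[OF kl(1)] O'_inv[OF kl(2)] by blast
    ultimately have "i = i'" by simp
    then have "x + k = x + l" using i(2) i'(2) Ld[OF kl] by (intro U(4)) auto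
    then show "k = l" by simp
  qed
qed

text \<open>
  The least positive length exists whenever \<open>V\<close> has finite length: the space generated by the empty set is also
  generated by the zero function.
\<close>

lemma ex_generators_card_le:
  assumes V: "finite_length \<mu> \<Gamma> V" and n: "invariant_length \<mu> \<Gamma> V \<le> n"
  shows "\<exists>A. generators \<mu> \<Gamma> V A \<and> card A \<le> n"
proof -
  have "\<exists>k A. 0 < k \<and> generators \<mu> \<Gamma> V A \<and> card A = k"
  proof -
    obtain A where A: "generators \<mu> \<Gamma> V A" using V by (auto simp: finite_length_def)
    show ?thesis
    proof (cases "A = {}")
      case False
      then have "0 < card A" using A by (auto simp: generators_def card_gt_0_iff)
      with A show ?thesis by blast
    next
      case True
      have zero: "translation l (modulation \<beta> 0) = 0" for l :: 'a and \<beta> :: "'a \<Rightarrow> complex"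
        by (simp add: translation_def modulation_def fun_eq_iff)
      have "{translation l (modulation \<beta> \<phi>) | \<phi> l \<beta>. \<phi> \<in> {0} \<and> (l, \<beta>) \<in> \<Gamma>} \<subseteq> {0}" using zero by auto
      then have "cfun.span {translation l (modulation \<beta> \<phi>) | \<phi> l \<beta>. \<phi> \<in> {0} \<and> (l, \<beta>) \<in> \<Gamma>} \<subseteq> {0}"
        by (rule cfun.span_minimal) (rule cfun.subspace_single_0)
      then have "cfun.span {translation l (modulation \<beta> \<phi>) | \<phi> l \<beta>. \<phi> \<in> {0} \<and> (l, \<beta>) \<in> \<Gamma>} = {0}"
        using cfun.span_zero by blast
      then have "generated_subspace \<mu> \<Gamma> {0} = generated_subspace \<mu> \<Gamma> A"
        by (simp add: generated_subspace_def True cfun.span_empty)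
      then have "generators \<mu> \<Gamma> V {0}" using A L2_zero by (simp add: generators_def)
      then show ?thesis by (intro exI[of _ 1] exI[of _ "{0}"]) simp
    qed
  qed
  then have "\<exists>k. 0 < k \<and> (\<exists>A. generators \<mu> \<Gamma> V A \<and> card A = k)" by blast
  from LeastI_ex[OF this] obtain A where "generators \<mu> \<Gamma> V A" "card A = invariant_length \<mu> \<Gamma> V"
    unfolding invariant_length_def by blast
  with n show ?thesis by auto
qed

theorem theorem1p1:
  fixes \<mu> :: "'g::{topological_ab_group_add, t2_space, second_countable_topology} measure"
    and L :: "'g set" and B :: "('g \<Rightarrow> complex) set"
    and f :: "nat \<Rightarrow> 'g \<Rightarrow> complex" and m n :: nat
  assumes "locally_compact_space (euclidean :: 'g topology)"
    and "haar_measure \<mu>"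
    and "uniform_lattice additive_group euclidean L"
    and "uniform_lattice dual_group dual_topology B"
    and "B \<subseteq> annihilator L"
    and "\<forall>j\<in>{1..m}. f j \<in> L2 \<mu>"
    and "n < m"
  shows "\<exists>\<psi> :: nat \<Rightarrow> 'g \<Rightarrow> complex. (\<forall>i\<in>{1..n}. \<psi> i \<in> L2 \<mu>) \<and>
           (\<forall>V. invariant_subspace \<mu> (L \<times> B) V \<and> finite_length \<mu> (L \<times> B) V \<and>
                invariant_length \<mu> (L \<times> B) V \<le> n \<longrightarrow>
              approx_error \<mu> m f (generated_subspace \<mu> (L \<times> B) (\<psi> ` {1..n}))
                \<le> approx_error \<mu> m f V)"
proof -
  have subgr: "subgroup L additive_group" and dual: "subgroup B dual_group"
    using assms(3,4) by (auto simp: uniform_lattice_def)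
  note L = subgroup_additive_group[OF subgr] and B = subgroup_dual_group[OF dual]
  obtain Q where cL: "countable L" and Q: "Q \<in> sets borel" "emeasure \<mu> Q < \<infinity>" "\<And>x. \<exists>l\<in>L. x + l \<in> Q"
    "\<And>x k l. k \<in> L \<Longrightarrow> l \<in> L \<Longrightarrow> x + k \<in> Q \<Longrightarrow> x + l \<in> Q \<Longrightarrow> k = l"
    by (rule ex_fundamental_domain[OF assms(1-3)]) blast
  define G :: "'g monoid" where "G = \<lparr>carrier = L, monoid.mult = (+), one = 0\<rparr>"
  have G: "carrier G = L" "\<And>x y. x \<otimes>\<^bsub>G\<^esub> y = x + y" "\<one>\<^bsub>G\<^esub> = 0" by (simp_all add: G_def)
  interpret G: comm_group G unfolding G_def by (rule comm_group_additive_on[OF L])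
  have cG: "countable (carrier G)" using cL by (simp add: G)
  obtain \<Omega> :: "(nat \<Rightarrow> complex) measure" and \<xi> :: "'g \<Rightarrow> (nat \<Rightarrow> complex) \<Rightarrow> complex" where \<xi>: "prob_space \<Omega>"
    "\<And>y. y \<in> carrier G \<Longrightarrow> \<xi> y \<in> borel_measurable \<Omega>"
    "\<And>y \<omega>. y \<in> carrier G \<Longrightarrow> norm (\<xi> y \<omega>) = 1"
    "\<And>y z \<omega>. y \<in> carrier G \<Longrightarrow> z \<in> carrier G \<Longrightarrow> \<xi> (y \<otimes>\<^bsub>G\<^esub> z) \<omega> = \<xi> y \<omega> * \<xi> z \<omega>"
    "\<And>y. y \<in> carrier G \<Longrightarrow> y \<noteq> \<one>\<^bsub>G\<^esub> \<Longrightarrow> (\<integral>\<omega>. \<xi> y \<omega> \<partial>\<Omega>) = 0"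
    by (rule G.ex_random_characters[OF cG]) blast
  have "L \<noteq> {}" using L(1) by blast
  have character: "\<beta> \<in> characters" if "\<beta> \<in> B" for \<beta> using B(1) that by blast
  interpret lattice_model \<mu> L "from_nat_into L" Q \<Omega> \<xi> B
  proof (rule lattice_model.intro)
    show "sets \<mu> = sets borel" "\<And>a A. A \<in> sets borel \<Longrightarrow> emeasure \<mu> ((+) a ` A) = emeasure \<mu> A"
      by (rule haar_measureD[OF assms(2)])+
    show "range (from_nat_into L) = L" by (rule range_from_nat_into[OF \<open>L \<noteq> {}\<close> cL])
    fix \<beta> assume \<beta>: "\<beta> \<in> B"
    show "\<beta> \<in> borel_measurable borel" by (rule character_measurable[OF character[OF \<beta>]])
    show "norm (\<beta> x) = 1" "\<beta> (x + y) = \<beta> x * \<beta> y" for x y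
      using character[OF \<beta>] by (simp_all add: characters_def)
    show "\<beta> l = 1" if "l \<in> L" for l using assms(5) \<beta> that by (auto simp: annihilator_def)
  qed (assumption | rule L B(2-) Q \<xi>[unfolded G])+
  have f: "\<And>j. j \<in> {1..m} \<Longrightarrow> f j \<in> L2 \<mu>" using assms(6) by blast
  obtain \<psi> :: "nat \<Rightarrow> 'g \<Rightarrow> complex" where \<psi>: "\<And>i. \<psi> i \<in> L2 \<mu>"
    "\<And>A. finite A \<Longrightarrow> card A \<le> n \<Longrightarrow> A \<subseteq> L2 \<mu> \<Longrightarrow>
       approx_error \<mu> m f (generated_subspace \<mu> (L \<times> B) (\<psi> ` {1..n}))
         \<le> approx_error \<mu> m f (generated_subspace \<mu> (L \<times> B) A)"
    by (rule ex_optimal_lattice_generators[of m f n, OF f less_imp_le[OF assms(7)]]) (assumption, blast)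
  show ?thesis
  proof (intro exI[of _ \<psi>] conjI ballI allI impI)
    show "\<psi> i \<in> L2 \<mu>" for i by (rule \<psi>(1))
    fix V assume V: "invariant_subspace \<mu> (L \<times> B) V \<and> finite_length \<mu> (L \<times> B) V \<and> invariant_length \<mu> (L \<times> B) V \<le> n"
    then obtain A where A: "generators \<mu> (L \<times> B) V A" "card A \<le> n" using ex_generators_card_le by blast
    then have "finite A" "A \<subseteq> L2 \<mu>" "V = generated_subspace \<mu> (L \<times> B) A" by (auto simp: generators_def)
    with \<psi>(2)[of A] A(2) show "approx_error \<mu> m f (generated_subspace \<mu> (L \<times> B) (\<psi> ` {1..n})) \<le> approx_error \<mu> m f V"
      by simp
  qed
qed

end
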